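(* Let $\Omega\subset\mathbb{R}^N$ be a smooth bounded domain, let $A_n=T_n=\bigcup_j T_n(j)$ be the union of the $\frac1n$-periodic holes $T_n(j)$ contained in $\Omega$ and $B_n=\Omega\setminus A_n$ (see context), let $X$ be the constant weak-$*$ limit of $\chi_{A_n}$ in $L^\infty(\Omega)$ with $0<X<1$, and let $f_n,f\in L^2(\Omega)$ with $\int_\Omega f_n\,dx=0$ and $f_n\to f$ strongly in $L^2(\Omega)$. Let $(u_n,v_n)\in W_n$ be the weak solution of the coupled local/nonlocal problem with source $f_n$ (see context). Let $(u,v)\in L^2(\Omega)\times L^2(\Omega)$, with $u$ continuous on $\overline\Omega$, be the solution of $$f(x)X=\int_\Omega J(x-y)\big(Xv(y)-(1-X)u(x)\big)\,dy,\quad x\in\Omega,$$ $$f(x)(1-X)=\int_\Omega G(x-y)\big((1-X)v(y)-(1-X)v(x)\big)\,dy+\int_\Omega J(x-y)\big((1-X)u(y)-Xv(x)\big)\,dy,\quad x\in\Omega,$$ satisfying $\int_\Omega u\,dx+\int_\Omega v\,dx=0$. Define $$w_{1,n}(x)=\begin{cases}\dfrac{u(x)}{X}, & x\in B_n,\\[1ex] \dfrac1{|T_n(j)|}\displaystyle\int_{T_n(j)}\frac{u(z)}{X}\,dz, & x\in T_n(j)\subset A_n,\end{cases}\qquad w_{2,n}=\frac{\chi_{B_n}v}{1-X},\qquad m_n=\int_{A_n}w_{1,n}\,dx+\int_{B_n}w_{2,n}\,dx.$$ Then, as $n\to\infty$, $$\Big\|u_n-\Big(w_{1,n}-\frac1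2\frac{m_n}{|A_n|}\Big)\Big\|_{L^2(A_n)}+\Big\|v_n-\Big(w_{2,n}-\frac12\frac{m_n}{|B_n|}\Big)\Big\|_{L^2(B_n)}\longrightarrow0.$$
   Context: Kernels. $N\ge2$. Each $K\in\{J,G\}$ is a continuous, nonnegative, radial, compactly supported function $K:\mathbb{R}^N\to\mathbb{R}$ with $K(0)>0$ and $\int_{\mathbb{R}^N}K(z)\,dz=1$. Moreover $B_R(0)\subset\operatorname{supp}J$ for some $R>\operatorname{diam}(\Omega)$. Holes. $Y=(0,\ell_1)\times\cdots\times(0,\ell_N)$ is a reference cell, $T\subset Y$ is a (nonempty) open set with smooth boundary and $\overline T\subset Y$. For $k\in\mathbb{Z}^N$ write $k\ell=(k_1\ell_1,\dots,k_N\ell_N)$. The set of holes is $$T_n=\bigcup\Big\{\tfrac1n(k\ell+\overline T)\;:\;k\in\mathbb{Z}^N,\ \tfrac1n(k\ell+\overline T)\subset\Omega\Big\},$$ and the individual sets $\frac1n(k\ell+\overline T)$ in this union are enumerated as $T_n(1),\dots,T_n(N_n)$. Only $n$ for which $T_n\neq\emptyset$ are considered. Here $A_n=T_n$ and $B_n=\Omega\setminus T_n$, and $\chi_{A_n}\rightharpoonup X$, $\chi_{B_n}\rightharpoonup 1-X$ weakly-$*$ in $L^\infty(\Omega)$. Problem. $W_n=\{(u,v)\in H^1(A_n)\times L^2(B_n):\int_{A_n}u\,dx+\int_{B_n}v\,dx=0\}$ (with $H^1(A_n)$ the Sobolev space on the interior of $A_n$). The weak solution $(u_n,v_n)$ is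 the unique element of $W_n$ such that for all $(\varphi,\phi)\in W_n$ $$a_n((u_n,v_n),(\varphi,\phi))=-\int_{A_n}f_n\varphi\,dx-\int_{B_n}f_n\phi\,dx,$$ where $$a_n((u,v),(\varphi,\phi))=\int_{A_n}\nabla u\cdot\nabla\varphi\,dx+\frac12\int_{B_n}\int_{B_n}G(x-y)(v(y)-v(x))(\phi(y)-\phi(x))\,dy\,dx+\int_{A_n}\int_{B_n}J(x-y)(v(y)-u(x))(\phi(y)-\varphi(x))\,dy\,dx.$$ (This is the weak form of $\Delta u_n+\int_{B_n}J(x-y)(v_n(y)-u_n(x))dy=f_n$ in $A_n$ with $\partial u_n/\partial\eta=0$ on $\partial A_n$, coupled with $\int_{B_n}G(x-y)(v_n(y)-v_n(x))dy+\int_{A_n}J(x-y)(u_n(y)-v_n(x))dy=f_n$ in $B_n$.) *)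

theory Defs
  imports "HOL-Analysis.Analysis"
begin

subsection \<open>Smooth functions and smooth boundaries\<close>

primrec C_k :: "nat \<Rightarrow> (real^'n \<Rightarrow> real) \<Rightarrow> bool" where
  "C_k 0 f \<longleftrightarrow> continuous_on UNIV f"
| "C_k (Suc k) f \<longleftrightarrow> (\<forall>x. f differentiable (at x)) \<and>
     (\<forall>i. C_k k (\<lambda>x. frechet_derivative f (at x) (axis i 1)))"

definition smooth_fun :: "(real^'n \<Rightarrow> real) \<Rightarrow> bool" where
  "smooth_fun f \<longleftrightarrow> (\<forall>k. C_k k f)"

text \<open>The boundary is locally the graph of a smooth function, with the set lying on one side
  of it. The vertical direction is a unit vector \<open>e\<close>, and \<open>x - (x \<bullet> e) *\<^sub>R e\<close> is the
  horizontal part of \<open>x\<close>; a smooth function of \<open>N - 1\<close> variables is the same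
  as a smooth function on the whole space evaluated at horizontal vectors only.\<close>

definition smooth_boundary :: "(real^'n) set \<Rightarrow> bool" where
  "smooth_boundary S \<longleftrightarrow> (\<forall>p\<in>frontier S. \<exists>r>0. \<exists>e \<psi>. norm e = 1 \<and> smooth_fun \<psi> \<and>
     S \<inter> ball p r = {x \<in> ball p r. x \<bullet> e > \<psi> (x - (x \<bullet> e) *\<^sub>R e)})"

definition smooth_bounded_domain :: "(real^'n) set \<Rightarrow> bool" where
  "smooth_bounded_domain S \<longleftrightarrow>
     open S \<and> connected S \<and> S \<noteq> {} \<and> bounded S \<and> smooth_boundary S"

subsection \<open>Kernels\<close>

definition fun_support :: "(real^'n \<Rightarrow> real) \<Rightarrow> (real^'n) set" where
  "fun_support K = closure {x. K x \<noteq> 0}"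

definition interaction_kernel :: "(real^'n \<Rightarrow> real) \<Rightarrow> bool" where
  "interaction_kernel K \<longleftrightarrow> continuous_on UNIV K \<and> (\<forall>x. K x \<ge> 0) \<and>
     (\<forall>x y. norm x = norm y \<longrightarrow> K x = K y) \<and> compact (fun_support K) \<and> K 0 > 0 \<and>
     (\<integral>z. K z \<partial>lebesgue) = 1"

subsection \<open>Function spaces\<close>

definition L2_on :: "(real^'n) set \<Rightarrow> (real^'n \<Rightarrow> real) \<Rightarrow> bool" where
  "L2_on S f \<longleftrightarrow> f \<in> borel_measurable (lebesgue_on S) \<and> integrable (lebesgue_on S) (\<lambda>x. (f x)\<^sup>2)"

definition L2_norm_on :: "(real^'n) set \<Rightarrow> (real^'n \<Rightarrow> real) \<Rightarrow> real" where
  "L2_norm_on S f = sqrt (\<integral>x. (f x)\<^sup>2 \<partial>lebesgue_on S)"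

definition test_function :: "(real^'n) set \<Rightarrow> (real^'n \<Rightarrow> real) \<Rightarrow> bool" where
  "test_function U \<eta> \<longleftrightarrow> smooth_fun \<eta> \<and> compact (fun_support \<eta>) \<and> fun_support \<eta> \<subseteq> U"

text \<open>For open \<open>U\<close>: \<open>u\<close> lies in the Sobolev space \<open>H\<^sup>1(U)\<close> and \<open>g\<close> represents its
  distributional gradient (which is determined almost everywhere on \<open>U\<close>).\<close>

definition H1_gradient ::
  "(real^'n) set \<Rightarrow> (real^'n \<Rightarrow> real) \<Rightarrow> (real^'n \<Rightarrow> real^'n) \<Rightarrow> bool" where
  "H1_gradient U u g \<longleftrightarrow> L2_on U u \<and> (\<forall>i. L2_on U (\<lambda>x. g x $ i)) \<and>
     (\<forall>\<eta> i. test_function U \<eta> \<longrightarrow>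
        (\<integral>x. u x * frechet_derivative \<eta> (at x) (axis i 1) \<partial>lebesgue_on U)
          = - (\<integral>x. (g x $ i) * \<eta> x \<partial>lebesgue_on U))"

definition H1 :: "(real^'n) set \<Rightarrow> (real^'n \<Rightarrow> real) set" where
  "H1 U = {u. \<exists>g. H1_gradient U u g}"

definition weak_star_Linfty ::
  "(real^'n) set \<Rightarrow> (nat \<Rightarrow> real^'n \<Rightarrow> real) \<Rightarrow> (real^'n \<Rightarrow> real) \<Rightarrow> bool" where
  "weak_star_Linfty S h h\<^sub>0 \<longleftrightarrow> (\<forall>g. integrable (lebesgue_on S) g \<longrightarrow>
     (\<lambda>n. \<integral>x. h n x * g x \<partial>lebesgue_on S) \<longlonglongrightarrow> (\<integral>x. h\<^sub>0 x * g x \<partial>lebesgue_on S))"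

subsection \<open>Periodic holes\<close>

definition hole :: "real^'n \<Rightarrow> (real^'n) set \<Rightarrow> nat \<Rightarrow> int^'n \<Rightarrow> (real^'n) set" where
  "hole l T n k = (\<lambda>x. (1 / real n) *\<^sub>R ((\<chi> i. real_of_int (k $ i) * l $ i) + x)) ` closure T"

definition hole_indices ::
  "(real^'n) set \<Rightarrow> real^'n \<Rightarrow> (real^'n) set \<Rightarrow> nat \<Rightarrow> (int^'n) set" where
  "hole_indices \<Omega> l T n = {k. hole l T n k \<subseteq> \<Omega>}"

definition holes :: "(real^'n) set \<Rightarrow> real^'n \<Rightarrow> (real^'n) set \<Rightarrow> nat \<Rightarrow> (real^'n) set" where
  "holes \<Omega> l T n = (\<Union>k\<in>hole_indices \<Omega> l T n. hole l T n k)"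

subsection \<open>The coupled local/nonlocal problem\<close>

definition W_space ::
  "(real^'n) set \<Rightarrow> (real^'n) set \<Rightarrow> ((real^'n \<Rightarrow> real) \<times> (real^'n \<Rightarrow> real)) set" where
  "W_space A B = {(u, v). u \<in> H1 (interior A) \<and> L2_on B v \<and>
     (\<integral>x. u x \<partial>lebesgue_on A) + (\<integral>x. v x \<partial>lebesgue_on B) = 0}"

text \<open>The arguments \<open>Du\<close> and \<open>D\<phi>\<close> are the weak gradients of \<open>u\<close> and \<open>\<phi>\<close>. They are passed
  explicitly because they are only determined almost everywhere.\<close>

definition energy_form ::
  "(real^'n \<Rightarrow> real) \<Rightarrow> (real^'n \<Rightarrow> real) \<Rightarrow> (real^'n) set \<Rightarrow> (real^'n) set \<Rightarrow>
   (real^'n \<Rightarrow> real) \<Rightarrow> (real^'n \<Rightarrow> real^'n) \<Rightarrow> (real^'n \<Rightarrow> real) \<Rightarrow>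
   (real^'n \<Rightarrow> real) \<Rightarrow> (real^'n \<Rightarrow> real^'n) \<Rightarrow> (real^'n \<Rightarrow> real) \<Rightarrow> real" where
  "energy_form J G A B u Du v \<phi> D\<phi> \<theta> =
     (\<integral>x. Du x \<bullet> D\<phi> x \<partial>lebesgue_on A)
   + 1/2 * (\<integral>x. (\<integral>y. G (x - y) * (v y - v x) * (\<theta> y - \<theta> x) \<partial>lebesgue_on B) \<partial>lebesgue_on B)
   + (\<integral>x. (\<integral>y. J (x - y) * (v y - u x) * (\<theta> y - \<phi> x) \<partial>lebesgue_on B) \<partial>lebesgue_on A)"

definition weak_solution ::
  "(real^'n \<Rightarrow> real) \<Rightarrow> (real^'n \<Rightarrow> real) \<Rightarrow> (real^'n) set \<Rightarrow> (real^'n) set \<Rightarrow>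
   (real^'n \<Rightarrow> real) \<Rightarrow> (real^'n \<Rightarrow> real) \<Rightarrow> (real^'n \<Rightarrow> real) \<Rightarrow> bool" where
  "weak_solution J G A B f u v \<longleftrightarrow> (u, v) \<in> W_space A B \<and>
     (\<forall>(\<phi>, \<theta>) \<in> W_space A B. \<forall>Du D\<phi>.
        H1_gradient (interior A) u Du \<longrightarrow> H1_gradient (interior A) \<phi> D\<phi> \<longrightarrow>
        energy_form J G A B u Du v \<phi> D\<phi> \<theta>
          = - (\<integral>x. f x * \<phi> x \<partial>lebesgue_on A) - (\<integral>x. f x * \<theta> x \<partial>lebesgue_on B))"

subsection \<open>The limit problem and the corrector\<close>

definition limit_solution ::
  "(real^'n \<Rightarrow> real) \<Rightarrow> (real^'n \<Rightarrow> real) \<Rightarrow> (real^'n) set \<Rightarrow> real \<Rightarrow>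
   (real^'n \<Rightarrow> real) \<Rightarrow> (real^'n \<Rightarrow> real) \<Rightarrow> (real^'n \<Rightarrow> real) \<Rightarrow> bool" where
  "limit_solution J G \<Omega> X f u v \<longleftrightarrow>
     (AE x in lebesgue_on \<Omega>.
        f x * X = (\<integral>y. J (x - y) * (X * v y - (1 - X) * u x) \<partial>lebesgue_on \<Omega>)) \<and>
     (AE x in lebesgue_on \<Omega>.
        f x * (1 - X) = (\<integral>y. G (x - y) * ((1 - X) * v y - (1 - X) * v x) \<partial>lebesgue_on \<Omega>)
                      + (\<integral>y. J (x - y) * ((1 - X) * u y - X * v x) \<partial>lebesgue_on \<Omega>)) \<and>
     (\<integral>x. u x \<partial>lebesgue_on \<Omega>) + (\<integral>x. v x \<partial>lebesgue_on \<Omega>) = 0"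

text \<open>For \<open>n \<ge> 1\<close> and \<open>closure T \<subseteq> box 0 l\<close> the holes are pairwise disjoint, so the index \<open>k\<close> below is unique.\<close>

definition corrector_1 ::
  "(real^'n) set \<Rightarrow> real^'n \<Rightarrow> (real^'n) set \<Rightarrow> real \<Rightarrow> (real^'n \<Rightarrow> real) \<Rightarrow> nat \<Rightarrow>
   real^'n \<Rightarrow> real" where
  "corrector_1 \<Omega> l T X u n x =
     (if x \<in> holes \<Omega> l T n
      then let H = hole l T n (THE k. k \<in> hole_indices \<Omega> l T n \<and> x \<in> hole l T n k)
           in 1 / measure lebesgue H * (\<integral>z. u z / X \<partial>lebesgue_on H)
      else u x / X)"

definition corrector_2 ::
  "(real^'n) set \<Rightarrow> real^'n \<Rightarrow> (real^'n) set \<Rightarrow> real \<Rightarrow> (real^'n \<Rightarrow> real) \<Rightarrow> nat \<Rightarrow>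
   real^'n \<Rightarrow> real" where
  "corrector_2 \<Omega> l T X v n x = indicator (\<Omega> - holes \<Omega> l T n) x * v x / (1 - X)"

end

theory Submission
  imports Defs
begin

text \<open>
  The proof is an energy estimate. Write the solution \<open>(u\<^sub>n, v\<^sub>n)\<close> and the corrector as functions
  \<open>z\<close> and \<open>w\<close> on all of \<open>\<Omega>\<close>, glued along \<open>A n\<close> and \<open>B n\<close>, and let \<open>h = z - w\<close> be the error. It has
  mean zero by the choice of the corrections \<open>m n\<close>, and it has the same weak gradient in the holes as
  \<open>u\<^sub>n\<close>, because the corrector is constant on every hole (\<open>H1_gradient_diff_piecewise_constant\<close>). So
  \<open>h\<close> is an admissible test function, and testing the weak formulation with it gives
  (\<open>weak_solution_error_energy\<close>)
    \<open>E\<^sub>n(h) \<le> - \<integral> h R\<^sub>n\<close>,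
  where \<open>E\<^sub>n\<close> is the nonlocal energy and \<open>R\<^sub>n = f\<^sub>n - L\<^sub>n w\<close> is the residual of the corrector under
  the nonlocal operator \<open>L\<^sub>n\<close>; the gradient term has a sign.

  The residual tends to 0 in \<open>L\<^sup>2\<close> (\<open>residual_tendsto_0\<close>). Indeed \<open>u\<close> is uniformly continuous and
  the holes shrink, so \<open>w\<close> is uniformly close to \<open>u / X\<close> on \<open>A n\<close> and to \<open>v / (1 - X)\<close> on \<open>B n\<close>; and
  in \<open>L\<^sub>n w\<close> the indicators of \<open>A n\<close> and \<open>B n\<close> occur only under an integral against a fixed kernel, so
  weak-* convergence replaces them by \<open>X\<close> and \<open>1 - X\<close>, strongly in \<open>L\<^sup>2\<close>
  (\<open>oscillating_average_tendsto_0\<close>). What is left is the limit problem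
  (\<open>coupling_average_limit\<close>).

  The energy controls the error uniformly in \<open>n\<close>: \<open>\<integral> h\<^sup>2 \<le> C E\<^sub>n(h)\<close> for functions of mean zero
  (\<open>finely_mixed_poincare\<close>). The interaction between \<open>A n\<close> and \<open>B n\<close> alone suffices, since both sets
  fill a definite proportion of every small cell: values on one set are compared with each other
  through the other set. Connectedness of \<open>\<Omega>\<close> passes this from cell to cell.

  Combining the three facts with Young's inequality yields \<open>\<integral> h\<^sup>2 \<le> C\<^sup>2 \<integral> R\<^sub>n\<^sup>2\<close>, which tends to 0.
\<close>

section \<open>Square-integrable functions\<close>

definition square_integrable :: "'a measure \<Rightarrow> ('a \<Rightarrow> real) \<Rightarrow> bool" where
  "square_integrable M h \<longleftrightarrow> h \<in> borel_measurable M \<and> integrable M (\<lambda>x. (h x)\<^sup>2)"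

lemma square_integrable_measurable [measurable_dest]:
  "square_integrable M h \<Longrightarrow> h \<in> borel_measurable M"
  by (simp add: square_integrable_def)

lemma integrable_mult_square_integrable:
  assumes "square_integrable M a" "square_integrable M b"
  shows "integrable M (\<lambda>x. a x * b x)"
proof (rule Bochner_Integration.integrable_bound[of M "\<lambda>x. (a x)\<^sup>2 + (b x)\<^sup>2"])
  show "integrable M (\<lambda>x. (a x)\<^sup>2 + (b x)\<^sup>2)" "(\<lambda>x. a x * b x) \<in> borel_measurable M"
    using assms by (auto simp: square_integrable_def intro: borel_measurable_times)
  have "\<bar>s * t\<bar> \<le> s\<^sup>2 + t\<^sup>2" for s t :: real
  proof -
    have "0 \<le> \<bar>s\<bar> * \<bar>t\<bar>" by simp
    with sum_squares_bound[of "\<bar>s\<bar>" "\<bar>t\<bar>"] show ?thesis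
      unfolding abs_mult power2_abs by linarith
  qed
  then show "AE x in M. norm (a x * b x) \<le> norm ((a x)\<^sup>2 + (b x)\<^sup>2)"
    by auto
qed

lemma square_integrable_cmult:
  assumes "square_integrable M a"
  shows "square_integrable M (\<lambda>x. c * a x)"
  using assms by (auto simp: square_integrable_def power_mult_distrib)

lemma square_integrable_add:
  assumes "square_integrable M a" "square_integrable M b"
  shows "square_integrable M (\<lambda>x. a x + b x)"
  using assms integrable_mult_square_integrable[OF assms]
  by (auto simp: square_integrable_def power2_sum mult.assoc)

lemma square_integrable_diff:
  assumes "square_integrable M a" "square_integrable M b"
  shows "square_integrable M (\<lambda>x. a x - b x)"
  using square_integrable_add[OF assms(1) square_integrable_cmult[OF assms(2), of "-1"]] by simp

lemma square_integrable_bounded_mult: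
  assumes a: "square_integrable M a" and c: "c \<in> borel_measurable M"
    and K: "\<And>x. x \<in> space M \<Longrightarrow> \<bar>c x\<bar> \<le> K"
  shows "square_integrable M (\<lambda>x. c x * a x)"
  unfolding square_integrable_def
proof
  show "(\<lambda>x. c x * a x) \<in> borel_measurable M"
    using a c by measurable
  show "integrable M (\<lambda>x. (c x * a x)\<^sup>2)"
  proof (rule Bochner_Integration.integrable_bound[of M "\<lambda>x. K\<^sup>2 * (a x)\<^sup>2"])
    show "integrable M (\<lambda>x. K\<^sup>2 * (a x)\<^sup>2)" "(\<lambda>x. (c x * a x)\<^sup>2) \<in> borel_measurable M"
      using a c unfolding square_integrable_def by auto
    have "(c x * a x)\<^sup>2 \<le> K\<^sup>2 * (a x)\<^sup>2" if "x \<in> space M" for x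
      using K[OF that] by (simp add: power_mult_distrib mult_right_mono abs_le_square_iff[symmetric])
    then show "AE x in M. norm ((c x * a x)\<^sup>2) \<le> norm (K\<^sup>2 * (a x)\<^sup>2)"
      by (intro AE_I2) auto
  qed
qed

lemma square_integrable_indicator_mult:
  assumes "square_integrable M a" "A \<in> sets M"
  shows "square_integrable M (\<lambda>x. indicator A x * a x)"
  by (rule square_integrable_bounded_mult[where K = 1]) (use assms in \<open>auto simp: indicator_def\<close>)

context finite_measure
begin

lemma square_integrable_const: "square_integrable M (\<lambda>x. c)"
  by (simp add: square_integrable_def)

lemma square_integrable_bounded:
  assumes "c \<in> borel_measurable M" "\<And>x. x \<in> space M \<Longrightarrow> \<bar>c x\<bar> \<le> K"
  shows "square_integrable M c"
  using square_integrable_bounded_mult[OF square_integrable_const[of 1] assms] by simp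

lemma square_integrable_imp_integrable:
  assumes "square_integrable M a"
  shows "integrable M a"
  using integrable_mult_square_integrable[OF assms square_integrable_const[of 1]] by simp

lemma integrable_indicator_sq:
  assumes "square_integrable M h" "U \<in> sets M"
  shows "integrable M (\<lambda>x. indicator U x * (h x - a)\<^sup>2)"
proof -
  have "square_integrable M (\<lambda>x. h x - a)"
    by (intro square_integrable_diff square_integrable_const assms)
  then have "square_integrable M (\<lambda>x. indicator U x * (h x - a))"
    using assms(2) by (rule square_integrable_indicator_mult)
  then have "integrable M (\<lambda>x. (indicator U x * (h x - a))\<^sup>2)"
    by (simp add: square_integrable_def)
  moreover have "(indicator U x * (h x - a))\<^sup>2 = indicator U x * (h x - a)\<^sup>2" for x
    by (simp add: indicator_def)
  ultimately show ?thesis by simp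
qed

end

section \<open>Quadratic forms of bounded kernels\<close>

definition bounded_kernel :: "'a measure \<Rightarrow> ('a \<Rightarrow> 'a \<Rightarrow> real) \<Rightarrow> bool" where
  "bounded_kernel M k \<longleftrightarrow> (\<lambda>p. k (fst p) (snd p)) \<in> borel_measurable (M \<Otimes>\<^sub>M M) \<and>
     (\<exists>K. \<forall>x\<in>space M. \<forall>y\<in>space M. \<bar>k x y\<bar> \<le> K)"

text \<open>The bilinear form of the nonlocal diffusion operator that sends \<open>w\<close> to
  \<open>x \<mapsto> \<integral> k x y (w y - w x) dy\<close>; see \<open>nonlocal_form_by_parts\<close> for the factor \<open>-2\<close> between the two.\<close>

definition nonlocal_form ::
  "'a measure \<Rightarrow> ('a \<Rightarrow> 'a \<Rightarrow> real) \<Rightarrow> ('a \<Rightarrow> real) \<Rightarrow> ('a \<Rightarrow> real) \<Rightarrow> real" where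
  "nonlocal_form M k w h = (\<integral>x. (\<integral>y. k x y * (w y - w x) * (h y - h x) \<partial>M) \<partial>M)"

lemma bounded_kernel_add:
  assumes "bounded_kernel M k" "bounded_kernel M k'"
  shows "bounded_kernel M (\<lambda>x y. k x y + k' x y)"
proof -
  obtain K K' where K: "\<forall>x\<in>space M. \<forall>y\<in>space M. \<bar>k x y\<bar> \<le> K"
      "\<forall>x\<in>space M. \<forall>y\<in>space M. \<bar>k' x y\<bar> \<le> K'"
    using assms by (auto simp: bounded_kernel_def)
  then have "\<forall>x\<in>space M. \<forall>y\<in>space M. \<bar>k x y + k' x y\<bar> \<le> K + K'"
    by (meson abs_triangle_ineq add_mono order_trans)
  then show ?thesis using assms unfolding bounded_kernel_def by (auto intro!: borel_measurable_add)
qed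

lemma bounded_kernel_cut:
  assumes k: "bounded_kernel M k" and "A \<in> sets M" "B \<in> sets M"
  shows "bounded_kernel M (\<lambda>x y. c * (indicator A x * indicator B y * k x y))"
proof -
  have [measurable]: "(\<lambda>p. k (fst p) (snd p)) \<in> borel_measurable (M \<Otimes>\<^sub>M M)"
    using k by (simp add: bounded_kernel_def)
  obtain K where K: "\<forall>x\<in>space M. \<forall>y\<in>space M. \<bar>k x y\<bar> \<le> K"
    using k by (auto simp: bounded_kernel_def)
  have "\<bar>c * (indicator A x * indicator B y * k x y)\<bar> \<le> \<bar>c\<bar> * \<bar>K\<bar>"
    if "x \<in> space M" "y \<in> space M" for x y
    using K that by (auto simp: indicator_def abs_mult intro!: mult_left_mono) (smt (verit))
  moreover have "(\<lambda>p. c * (indicator A (fst p) * indicator B (snd p) * k (fst p) (snd p)))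
      \<in> borel_measurable (M \<Otimes>\<^sub>M M)"
    using assms(2,3) by measurable
  ultimately show ?thesis
    unfolding bounded_kernel_def by blast
qed

context finite_measure
begin

lemma pair_sigma_finite_self: "pair_sigma_finite M M"
  by unfold_locales

lemma integrable_snd_coordinate:
  fixes g :: "'a \<Rightarrow> real"
  assumes "integrable M g"
  shows "integrable (M \<Otimes>\<^sub>M M) (\<lambda>p. g (snd p))"
proof -
  interpret P: pair_sigma_finite M M by (rule pair_sigma_finite_self)
  show ?thesis
    by (rule P.Fubini_integrable) (use assms in auto)
qed

lemma integrable_fst_coordinate:
  fixes g :: "'a \<Rightarrow> real"
  assumes "integrable M g"
  shows "integrable (M \<Otimes>\<^sub>M M) (\<lambda>p. g (fst p))"
proof -
  interpret P: pair_sigma_finite M M by (rule pair_sigma_finite_self)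
  show ?thesis
    using P.integrable_product_swap[OF integrable_snd_coordinate[OF assms]]
    by (simp add: split_beta')
qed

lemma square_integrable_coordinates:
  assumes "square_integrable M h"
  shows "square_integrable (M \<Otimes>\<^sub>M M) (\<lambda>p. h (fst p))"
    and "square_integrable (M \<Otimes>\<^sub>M M) (\<lambda>p. h (snd p))"
  using assms integrable_fst_coordinate integrable_snd_coordinate
  by (auto simp: square_integrable_def)

lemma integrable_kernel_mult:
  assumes k: "bounded_kernel M k"
    and F: "square_integrable (M \<Otimes>\<^sub>M M) F" and G: "square_integrable (M \<Otimes>\<^sub>M M) G"
  shows "integrable (M \<Otimes>\<^sub>M M) (\<lambda>p. k (fst p) (snd p) * F p * G p)"
proof -
  obtain K where K: "\<forall>x\<in>space M. \<forall>y\<in>space M. \<bar>k x y\<bar> \<le> K"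
    using k by (auto simp: bounded_kernel_def)
  have "square_integrable (M \<Otimes>\<^sub>M M) (\<lambda>p. k (fst p) (snd p) * F p)"
    by (rule square_integrable_bounded_mult[OF F, where K = K])
      (use k K in \<open>auto simp: bounded_kernel_def space_pair_measure\<close>)
  then show ?thesis
    using integrable_mult_square_integrable[OF _ G] by simp
qed

lemma
  assumes k: "bounded_kernel M k" and "square_integrable M w" "square_integrable M h"
  shows integrable_nonlocal:
      "integrable (M \<Otimes>\<^sub>M M) (\<lambda>(x, y). k x y * (w y - w x) * (h y - h x))"
    and nonlocal_form_eq_pair:
      "nonlocal_form M k w h
        = (\<integral>p. (case p of (x, y) \<Rightarrow> k x y * (w y - w x) * (h y - h x)) \<partial>(M \<Otimes>\<^sub>M M))"
proof -
  interpret P: pair_sigma_finite M M by (rule pair_sigma_finite_self)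
  have "integrable (M \<Otimes>\<^sub>M M)
      (\<lambda>p. k (fst p) (snd p) * (w (snd p) - w (fst p)) * (h (snd p) - h (fst p)))"
    by (intro integrable_kernel_mult k square_integrable_diff square_integrable_coordinates assms)
  then show 1: "integrable (M \<Otimes>\<^sub>M M) (\<lambda>(x, y). k x y * (w y - w x) * (h y - h x))"
    by (simp add: split_beta')
  show "nonlocal_form M k w h
        = (\<integral>p. (case p of (x, y) \<Rightarrow> k x y * (w y - w x) * (h y - h x)) \<partial>(M \<Otimes>\<^sub>M M))"
    unfolding nonlocal_form_def by (rule P.integral_fst[OF 1])
qed

lemma nonlocal_form_diff:
  assumes "bounded_kernel M k" "square_integrable M z" "square_integrable M w"
    "square_integrable M h"
  shows "nonlocal_form M k (\<lambda>x. z x - w x) h = nonlocal_form M k z h - nonlocal_form M k w h"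
proof -
  note i = integrable_nonlocal[OF assms(1,2,4)] integrable_nonlocal[OF assms(1,3,4)]
  show ?thesis
    unfolding nonlocal_form_eq_pair[OF assms(1) square_integrable_diff[OF assms(2,3)] assms(4)]
      nonlocal_form_eq_pair[OF assms(1,2,4)] nonlocal_form_eq_pair[OF assms(1,3,4)]
      Bochner_Integration.integral_diff[OF i, symmetric]
    by (rule Bochner_Integration.integral_cong) (auto simp: algebra_simps)
qed

lemma nonlocal_form_add_kernel:
  assumes "bounded_kernel M k" "bounded_kernel M k'" "square_integrable M w" "square_integrable M h"
  shows "nonlocal_form M (\<lambda>x y. k x y + k' x y) w h = nonlocal_form M k w h + nonlocal_form M k' w h"
proof -
  note i = integrable_nonlocal[OF assms(1,3,4)] integrable_nonlocal[OF assms(2,3,4)]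
  show ?thesis
    unfolding nonlocal_form_eq_pair[OF bounded_kernel_add[OF assms(1,2)] assms(3,4)]
      nonlocal_form_eq_pair[OF assms(1,3,4)] nonlocal_form_eq_pair[OF assms(2,3,4)]
      Bochner_Integration.integral_add[OF i, symmetric]
    by (rule Bochner_Integration.integral_cong) (auto simp: algebra_simps)
qed

lemma nonlocal_form_mono_kernel:
  assumes "bounded_kernel M k" "bounded_kernel M k'" "square_integrable M h"
    and "\<And>x y. x \<in> space M \<Longrightarrow> y \<in> space M \<Longrightarrow> k x y \<le> k' x y"
  shows "nonlocal_form M k h h \<le> nonlocal_form M k' h h"
  unfolding nonlocal_form_eq_pair[OF assms(1,3,3)] nonlocal_form_eq_pair[OF assms(2,3,3)]
  by (rule integral_mono)
    (use integrable_nonlocal[OF assms(1,3,3)] integrable_nonlocal[OF assms(2,3,3)] assms(4) in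
      \<open>auto simp: space_pair_measure mult.assoc intro!: mult_right_mono\<close>)

text \<open>Exchanging the names of the two variables does not change the form. A one-sided kernel
  such as \<open>1\<^sub>A(x) 1\<^sub>B(y) J(x - y)\<close> may therefore be replaced by its symmetrisation, to which
  integration by parts applies.\<close>

lemma nonlocal_form_swap_kernel:
  assumes k: "bounded_kernel M k" and "square_integrable M w" "square_integrable M h"
  shows "nonlocal_form M (\<lambda>x y. k y x) w h = nonlocal_form M k w h"
proof -
  interpret P: pair_sigma_finite M M by (rule pair_sigma_finite_self)
  have "nonlocal_form M k w h = (\<integral>y. (\<integral>x. k x y * (w y - w x) * (h y - h x) \<partial>M) \<partial>M)"
    unfolding nonlocal_form_def by (rule P.Fubini_integral[OF integrable_nonlocal[OF assms], symmetric])
  also have "\<dots> = nonlocal_form M (\<lambda>x y. k y x) w h"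
    unfolding nonlocal_form_def by (simp add: algebra_simps)
  finally show ?thesis by simp
qed

text \<open>Nonlocal integration by parts. Split \<open>h y - h x\<close> and exchange the variables in the part
  that carries \<open>h y\<close>: since \<open>k\<close> is symmetric and \<open>w y - w x\<close> is antisymmetric, that part equals
  the other one.\<close>

lemma nonlocal_form_by_parts:
  assumes k: "bounded_kernel M k" and w: "square_integrable M w" and h: "square_integrable M h"
    and sym: "\<And>x y. k x y = k y x"
  shows "nonlocal_form M k w h = - 2 * (\<integral>x. h x * (\<integral>y. k x y * (w y - w x) \<partial>M) \<partial>M)"
proof -
  interpret P: pair_sigma_finite M M by (rule pair_sigma_finite_self)
  let ?F = "\<lambda>x y. k x y * (w y - w x) * h y" and ?G = "\<lambda>x y. k x y * (w y - w x) * h x"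
  have F: "integrable (M \<Otimes>\<^sub>M M) (\<lambda>(x, y). ?F x y)"
    using integrable_kernel_mult[OF k square_integrable_diff[OF
        square_integrable_coordinates(2)[OF w] square_integrable_coordinates(1)[OF w]]
        square_integrable_coordinates(2)[OF h]] by (simp add: split_beta')
  have G: "integrable (M \<Otimes>\<^sub>M M) (\<lambda>(x, y). ?G x y)"
    using integrable_kernel_mult[OF k square_integrable_diff[OF
        square_integrable_coordinates(2)[OF w] square_integrable_coordinates(1)[OF w]]
        square_integrable_coordinates(1)[OF h]] by (simp add: split_beta')
  have "(\<integral>x. (\<integral>y. ?F x y \<partial>M) \<partial>M) = (\<integral>y. (\<integral>x. ?F x y \<partial>M) \<partial>M)"
    by (rule P.Fubini_integral[OF F, symmetric])
  also have "\<dots> = (\<integral>y. (\<integral>x. - ?G y x \<partial>M) \<partial>M)"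
    using sym by (intro Bochner_Integration.integral_cong) (auto simp: algebra_simps)
  finally have FG: "(\<integral>x. (\<integral>y. ?F x y \<partial>M) \<partial>M) = - (\<integral>x. (\<integral>y. ?G x y \<partial>M) \<partial>M)"
    by simp
  have "nonlocal_form M k w h
      = (\<integral>p. (case p of (x, y) \<Rightarrow> ?F x y) - (case p of (x, y) \<Rightarrow> ?G x y) \<partial>(M \<Otimes>\<^sub>M M))"
    unfolding nonlocal_form_eq_pair[OF k w h]
    by (rule Bochner_Integration.integral_cong) (auto simp: algebra_simps)
  also have "\<dots> = (\<integral>x. (\<integral>y. ?F x y \<partial>M) \<partial>M) - (\<integral>x. (\<integral>y. ?G x y \<partial>M) \<partial>M)"
    by (simp only: Bochner_Integration.integral_diff[OF F G] P.integral_fst[OF F] P.integral_fst[OF G])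
  also have "\<dots> = - 2 * (\<integral>x. (\<integral>y. ?G x y \<partial>M) \<partial>M)"
    unfolding FG by simp
  also have "(\<integral>x. (\<integral>y. ?G x y \<partial>M) \<partial>M) = (\<integral>x. h x * (\<integral>y. k x y * (w y - w x) \<partial>M) \<partial>M)"
    by (simp add: mult.commute)
  finally show ?thesis .
qed

end

section \<open>Averages against oscillating weights\<close>

context finite_measure
begin

lemma integrable_kernel_section:
  assumes k: "bounded_kernel M k" and a: "square_integrable M a" and x: "x \<in> space M"
  shows "integrable M (\<lambda>y. k x y * (a y - r))"
proof -
  have "(\<lambda>p. k (fst p) (snd p)) \<in> borel_measurable (M \<Otimes>\<^sub>M M)"
    using k by (simp add: bounded_kernel_def)
  then have [measurable]: "(\<lambda>(x, y). k x y) \<in> borel_measurable (M \<Otimes>\<^sub>M M)"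
    by (simp add: split_beta')
  obtain K where K: "\<forall>x\<in>space M. \<forall>y\<in>space M. \<bar>k x y\<bar> \<le> K"
    using k by (auto simp: bounded_kernel_def)
  have "square_integrable M (\<lambda>y. k x y * (a y - r))"
    by (rule square_integrable_bounded_mult[where K = K])
      (use K x in \<open>auto intro!: square_integrable_diff square_integrable_const a\<close>)
  then show ?thesis by (rule square_integrable_imp_integrable)
qed

text \<open>The bound \<open>g\<close> is the same for all weights \<open>c\<close> of modulus at most 1, which makes it a
  dominating function for a whole sequence of weights.\<close>

lemma kernel_average_dominated:
  assumes k: "bounded_kernel M k" and a: "square_integrable M a" and b: "square_integrable M b"
  obtains g where "square_integrable M g"
    and "\<And>c x. c \<in> borel_measurable M \<Longrightarrow> (\<And>y. y \<in> space M \<Longrightarrow> \<bar>c y\<bar> \<le> 1) \<Longrightarrow> x \<in> space M \<Longrightarrow>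
      \<bar>\<integral>y. c y * (k x y * (a y - b x)) \<partial>M\<bar> \<le> g x"
proof -
  obtain K0 where K0: "\<forall>x\<in>space M. \<forall>y\<in>space M. \<bar>k x y\<bar> \<le> K0"
    using k by (auto simp: bounded_kernel_def)
  define K where "K = \<bar>K0\<bar>"
  have K: "\<bar>k x y\<bar> \<le> K" if "x \<in> space M" "y \<in> space M" for x y
    using K0 that unfolding K_def by fastforce
  have K_nonneg: "K \<ge> 0" unfolding K_def by simp
  let ?g = "\<lambda>x. K * ((\<integral>y. \<bar>a y\<bar> \<partial>M) + measure M (space M) * \<bar>b x\<bar>)"
  have ia: "integrable M (\<lambda>y. \<bar>a y\<bar>)"
    using square_integrable_imp_integrable[OF a] by simp
  have bound: "\<bar>\<integral>y. c y * (k x y * (a y - b x)) \<partial>M\<bar> \<le> ?g x"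
    if x: "x \<in> space M" and c: "\<And>y. y \<in> space M \<Longrightarrow> \<bar>c y\<bar> \<le> 1" for c x
  proof -
    have "\<bar>\<integral>y. c y * (k x y * (a y - b x)) \<partial>M\<bar> \<le> (\<integral>y. K * (\<bar>a y\<bar> + \<bar>b x\<bar>) \<partial>M)"
    proof (rule order_trans[OF integral_abs_bound], rule integral_mono_AE')
      show "integrable M (\<lambda>y. K * (\<bar>a y\<bar> + \<bar>b x\<bar>))"
        using ia by simp
      show "AE y in M. \<bar>c y * (k x y * (a y - b x))\<bar> \<le> K * (\<bar>a y\<bar> + \<bar>b x\<bar>)"
      proof (rule AE_I2)
        fix y assume y: "y \<in> space M"
        have "\<bar>c y\<bar> * (\<bar>k x y\<bar> * \<bar>a y - b x\<bar>) \<le> 1 * (K * (\<bar>a y\<bar> + \<bar>b x\<bar>))"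
          using c[OF y] K[OF x y] K_nonneg by (intro mult_mono) auto
        then show "\<bar>c y * (k x y * (a y - b x))\<bar> \<le> K * (\<bar>a y\<bar> + \<bar>b x\<bar>)"
          by (simp add: abs_mult)
      qed
      show "AE y in M. 0 \<le> K * (\<bar>a y\<bar> + \<bar>b x\<bar>)"
        using K_nonneg by simp
    qed
    also have "\<dots> = ?g x"
      using ia by (simp add: mult.commute)
    finally show ?thesis .
  qed
  have "square_integrable M (\<lambda>x. \<bar>b x\<bar>)"
    using b by (auto simp: square_integrable_def)
  then have "square_integrable M ?g"
    by (intro square_integrable_cmult square_integrable_add square_integrable_const)
  then show thesis using that bound by blast
qed

lemma measurable_kernel_average:
  assumes k: "bounded_kernel M k" and a: "square_integrable M a" and b: "square_integrable M b"
    and c: "c \<in> borel_measurable M"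
  shows "(\<lambda>x. \<integral>y. c y * (k x y * (a y - b x)) \<partial>M) \<in> borel_measurable M"
proof -
  have "(\<lambda>p. k (fst p) (snd p)) \<in> borel_measurable (M \<Otimes>\<^sub>M M)"
    using k by (simp add: bounded_kernel_def)
  then have [measurable]: "(\<lambda>(x, y). k x y) \<in> borel_measurable (M \<Otimes>\<^sub>M M)"
    by (simp add: split_beta')
  note [measurable] = square_integrable_measurable[OF a] square_integrable_measurable[OF b] c
  show ?thesis by measurable
qed

lemma square_integrable_dominated:
  assumes "square_integrable M g" "D \<in> borel_measurable M" "AE x in M. \<bar>D x\<bar> \<le> g x"
  shows "square_integrable M D"
  unfolding square_integrable_def
proof
  show "integrable M (\<lambda>x. (D x)\<^sup>2)"
  proof (rule Bochner_Integration.integrable_bound[of M "\<lambda>x. (g x)\<^sup>2"])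
    show "AE x in M. norm ((D x)\<^sup>2) \<le> norm ((g x)\<^sup>2)"
      using assms(3)
    proof eventually_elim
      case (elim x)
      from power_mono[OF elim, of 2] show ?case by simp
    qed
  qed (use assms in \<open>auto simp: square_integrable_def\<close>)
qed (rule assms(2))

lemma square_integrable_kernel_average:
  assumes k: "bounded_kernel M k" and a: "square_integrable M a" and b: "square_integrable M b"
    and c: "c \<in> borel_measurable M" "\<And>y. y \<in> space M \<Longrightarrow> \<bar>c y\<bar> \<le> 1"
  shows "square_integrable M (\<lambda>x. \<integral>y. c y * (k x y * (a y - b x)) \<partial>M)"
proof -
  obtain g where "square_integrable M g"
    "\<And>c x. c \<in> borel_measurable M \<Longrightarrow> (\<And>y. y \<in> space M \<Longrightarrow> \<bar>c y\<bar> \<le> 1) \<Longrightarrow> x \<in> space M \<Longrightarrow>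
      \<bar>\<integral>y. c y * (k x y * (a y - b x)) \<partial>M\<bar> \<le> g x"
    using kernel_average_dominated[OF k a b] by blast
  then show ?thesis
    by (intro square_integrable_dominated[OF _ measurable_kernel_average[OF k a b c(1)]])
      (auto intro: c)
qed

text \<open>For fixed \<open>x\<close> the weight \<open>c n\<close> is tested against a fixed integrable function of \<open>y\<close>, so
  the inner integral tends to 0 by weak convergence. Domination by an \<open>L\<^sup>2\<close> function that does not
  depend on \<open>n\<close> turns this pointwise convergence into convergence in \<open>L\<^sup>2\<close>.\<close>

lemma oscillating_average_tendsto_0:
  assumes k: "bounded_kernel M k" and a: "square_integrable M a" and b: "square_integrable M b"
    and c: "\<And>n. c n \<in> borel_measurable M" "\<And>n x. x \<in> space M \<Longrightarrow> \<bar>c n x\<bar> \<le> 1"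
    and weak: "\<And>g :: _ \<Rightarrow> real. integrable M g \<Longrightarrow> (\<lambda>n. \<integral>x. c n x * g x \<partial>M) \<longlonglongrightarrow> 0"
  shows "(\<lambda>n. \<integral>x. (\<integral>y. c n y * (k x y * (a y - b x)) \<partial>M)\<^sup>2 \<partial>M) \<longlonglongrightarrow> 0"
proof -
  let ?D = "\<lambda>n x. \<integral>y. c n y * (k x y * (a y - b x)) \<partial>M"
  obtain g where g: "square_integrable M g"
    "\<And>c x. c \<in> borel_measurable M \<Longrightarrow> (\<And>y. y \<in> space M \<Longrightarrow> \<bar>c y\<bar> \<le> 1) \<Longrightarrow> x \<in> space M \<Longrightarrow>
      \<bar>\<integral>y. c y * (k x y * (a y - b x)) \<partial>M\<bar> \<le> g x"
    using kernel_average_dominated[OF k a b] by blast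
  have bound: "\<bar>?D n x\<bar> \<le> g x" if "x \<in> space M" for n x
    by (rule g(2)) (use that c in auto)
  have "(\<lambda>n. \<integral>x. (?D n x)\<^sup>2 \<partial>M) \<longlonglongrightarrow> (\<integral>x. 0 \<partial>M)"
  proof (rule integral_dominated_convergence[where w = "\<lambda>x. (g x)\<^sup>2"])
    show "integrable M (\<lambda>x. (g x)\<^sup>2)"
      using g by (simp add: square_integrable_def)
    show "AE x in M. (\<lambda>n. (?D n x)\<^sup>2) \<longlonglongrightarrow> 0"
    proof (rule AE_I2)
      fix x assume "x \<in> space M"
      then show "(\<lambda>n. (?D n x)\<^sup>2) \<longlonglongrightarrow> 0"
        using tendsto_power[OF weak[OF integrable_kernel_section[OF k a]], of x "b x" 2] by simp
    qed
    show "AE x in M. norm ((?D n x)\<^sup>2) \<le> (g x)\<^sup>2" for n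
    proof (rule AE_I2)
      fix x assume "x \<in> space M"
      from power_mono[OF bound[OF this, of n], of 2]
      show "norm ((?D n x)\<^sup>2) \<le> (g x)\<^sup>2" by simp
    qed
    show "(\<lambda>x. (?D n x)\<^sup>2) \<in> borel_measurable M" for n
      using measurable_kernel_average[OF k a b c(1)[of n]] by (rule borel_measurable_power)
  qed simp
  then show ?thesis by simp
qed

end

section \<open>A Poincare inequality for finely mixed sets\<close>

text \<open>Take a subfamily of maximal size whose union satisfies \<open>P\<close>. If it does not cover
  everything, connectedness forces one of the remaining members to meet its union, and adding
  that member contradicts maximality.\<close>

lemma connected_finite_cover_induct:
  fixes F :: "'a::topological_space set set"
  assumes fin: "finite F" and ne: "F \<noteq> {}" and conn: "connected (\<Union>F)"
    and cell: "\<And>U. U \<in> F \<Longrightarrow> open U \<and> U \<noteq> {} \<and> P U"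
    and union: "\<And>U V. open U \<Longrightarrow> open V \<Longrightarrow> U \<inter> V \<noteq> {} \<Longrightarrow> P U \<Longrightarrow> P V \<Longrightarrow> P (U \<union> V)"
  shows "P (\<Union>F)"
proof -
  let ?Q = "\<lambda>S. S \<subseteq> F \<and> S \<noteq> {} \<and> P (\<Union>S)"
  obtain U0 where "U0 \<in> F" using ne by blast
  then have "?Q {U0}" using cell by auto
  moreover have bd: "\<forall>S. ?Q S \<longrightarrow> card S < Suc (card F)"
    using fin by (auto simp: less_Suc_eq_le card_mono)
  ultimately obtain S where S: "?Q S" and max: "\<And>S'. ?Q S' \<Longrightarrow> card S' \<le> card S"
    using ex_has_greatest_nat[of ?Q "{U0}" card "Suc (card F)"] by (metis less_imp_le)
  have "\<Union>S = \<Union>F"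
  proof (rule ccontr)
    assume neq: "\<Union>S \<noteq> \<Union>F"
    have meet: "\<exists>U\<in>F - S. \<Union>S \<inter> U \<noteq> {}"
    proof (rule ccontr)
      assume "\<not> ?thesis"
      then have "\<Union>S \<inter> \<Union>(F - S) = {}" by blast
      moreover have "open (\<Union>S)" "open (\<Union>(F - S))"
        using S cell by (blast intro: open_Union)+
      moreover have "\<Union>F \<subseteq> \<Union>S \<union> \<Union>(F - S)" by blast
      moreover have "\<Union>S \<inter> \<Union>F \<noteq> {}" using S cell by blast
      moreover have "\<Union>(F - S) \<inter> \<Union>F \<noteq> {}" using S neq by blast
      ultimately show False
        using conn unfolding connected_def by blast
    qed
    then obtain U where U: "U \<in> F" "U \<notin> S" "\<Union>S \<inter> U \<noteq> {}" by blast
    have "open (\<Union>S)" using S cell by (blast intro: open_Union)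
    then have "P (\<Union>S \<union> U)"
      using S U cell by (intro union) auto
    then have "?Q (insert U S)" using S U by (simp add: Un_commute)
    from max[OF this] show False
      using U(2) finite_subset[OF _ fin] S by simp
  qed
  then show ?thesis using S by simp
qed

text \<open>A Poincare inequality on \<open>U\<close> for a sequence of energies \<open>E n\<close>. The constant \<open>C\<close> is uniform
  in \<open>n\<close>, whereas the subtracted value \<open>a\<close> may depend on \<open>n\<close> and \<open>h\<close>. Leaving \<open>a\<close> free,
  instead of taking the mean of \<open>h\<close> over \<open>U\<close>, is what makes it easy to pass to unions.\<close>

definition poincare_on ::
  "'a measure \<Rightarrow> (nat \<Rightarrow> ('a \<Rightarrow> real) \<Rightarrow> real) \<Rightarrow> 'a set \<Rightarrow> bool" where
  "poincare_on M E U \<longleftrightarrow> (\<exists>C\<ge>0. \<forall>\<^sub>F n in sequentially. \<forall>h. square_integrable M h \<longrightarrow>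
     (\<exists>a. (\<integral>x. indicator U x * (h x - a)\<^sup>2 \<partial>M) \<le> C * E n h))"

lemma bounded_kernel_one: "bounded_kernel M (\<lambda>_ _. 1)"
  by (auto simp: bounded_kernel_def intro: exI[of _ 1])

lemma sq_diff_le: "(s - t)\<^sup>2 \<le> 2 * (s - r)\<^sup>2 + 2 * (r - t)\<^sup>2" for s t r :: real
proof -
  have "2 * (s - r)\<^sup>2 + 2 * (r - t)\<^sup>2 - (s - t)\<^sup>2 = (s - 2 * r + t)\<^sup>2"
    by (simp add: power2_eq_square algebra_simps)
  then show ?thesis by (metis diff_ge_0_iff_ge zero_le_power2)
qed

context finite_measure
begin

lemma integrable_indicator_sets [simp]: "W \<in> sets M \<Longrightarrow> integrable M (indicator W :: _ \<Rightarrow> real)"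
  by (intro integrable_real_indicator) (auto simp: less_top[symmetric])

text \<open>On the overlap \<open>h\<close> is close to both constants \<open>a\<close> and \<open>b\<close>. As the overlap has positive
  measure, this controls \<open>a - b\<close>, and \<open>a\<close> may be used in place of \<open>b\<close> on \<open>V\<close>.\<close>

lemma poincare_on_union:
  assumes U: "U \<in> sets M" and V: "V \<in> sets M" and pos: "measure M (U \<inter> V) > 0"
    and E: "\<And>n h. E n h \<ge> 0"
    and PU: "poincare_on M E U" and PV: "poincare_on M E V"
  shows "poincare_on M E (U \<union> V)"
proof -
  obtain C where C: "C \<ge> 0" "\<forall>\<^sub>F n in sequentially. \<forall>h. square_integrable M h \<longrightarrow>
     (\<exists>a. (\<integral>x. indicator U x * (h x - a)\<^sup>2 \<partial>M) \<le> C * E n h)"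
    using PU unfolding poincare_on_def by blast
  obtain D where D: "D \<ge> 0" "\<forall>\<^sub>F n in sequentially. \<forall>h. square_integrable M h \<longrightarrow>
     (\<exists>a. (\<integral>x. indicator V x * (h x - a)\<^sup>2 \<partial>M) \<le> D * E n h)"
    using PV unfolding poincare_on_def by blast
  define \<mu> where "\<mu> = measure M (U \<inter> V)"
  define L where "L = C + 2 * D + 2 * measure M V * ((2 * C + 2 * D) / \<mu>)"
  have \<mu>: "\<mu> > 0" using pos by (simp add: \<mu>_def)
  have "L \<ge> 0" unfolding L_def using C(1) D(1) \<mu> by simp
  moreover have "\<forall>\<^sub>F n in sequentially. \<forall>h. square_integrable M h \<longrightarrow>
     (\<exists>a. (\<integral>x. indicator (U \<union> V) x * (h x - a)\<^sup>2 \<partial>M) \<le> L * E n h)"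
    using C(2) D(2)
  proof eventually_elim
    case (elim n)
    show ?case
    proof (intro allI impI)
      fix h assume h: "square_integrable M h"
      obtain a where a: "(\<integral>x. indicator U x * (h x - a)\<^sup>2 \<partial>M) \<le> C * E n h"
        using elim h by blast
      obtain b where b: "(\<integral>x. indicator V x * (h x - b)\<^sup>2 \<partial>M) \<le> D * E n h"
        using elim h by blast
      note i = integrable_indicator_sq[OF h]
      have "(\<integral>x. indicator (U \<inter> V) x * (a - b)\<^sup>2 \<partial>M)
          \<le> (\<integral>x. 2 * (indicator U x * (h x - a)\<^sup>2) + 2 * (indicator V x * (h x - b)\<^sup>2) \<partial>M)"
      proof (rule integral_mono)
        fix x assume "x \<in> space M"
        show "indicator (U \<inter> V) x * (a - b)\<^sup>2
            \<le> 2 * (indicator U x * (h x - a)\<^sup>2) + 2 * (indicator V x * (h x - b)\<^sup>2)"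
          using sq_diff_le[of a b "h x"]
          by (auto simp: indicator_def power2_commute[of a "h x"])
      qed (use i U V in auto)
      also have "\<dots> \<le> 2 * (C * E n h) + 2 * (D * E n h)"
        using a b i U V by simp
      finally have "\<mu> * (a - b)\<^sup>2 \<le> (2 * C + 2 * D) * E n h"
        using U V by (simp add: \<mu>_def algebra_simps)
      then have ab: "(b - a)\<^sup>2 \<le> (2 * C + 2 * D) / \<mu> * E n h"
        using \<mu> by (simp add: field_simps power2_commute[of a b])
      have "(\<integral>x. indicator (U \<union> V) x * (h x - a)\<^sup>2 \<partial>M)
         \<le> (\<integral>x. indicator U x * (h x - a)\<^sup>2
              + (2 * (indicator V x * (h x - b)\<^sup>2) + 2 * (indicator V x * (b - a)\<^sup>2)) \<partial>M)"
      proof (rule integral_mono)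
        fix x assume "x \<in> space M"
        show "indicator (U \<union> V) x * (h x - a)\<^sup>2 \<le> indicator U x * (h x - a)\<^sup>2
              + (2 * (indicator V x * (h x - b)\<^sup>2) + 2 * (indicator V x * (b - a)\<^sup>2))"
          using sq_diff_le[of "h x" a b] by (auto simp: indicator_def)
      qed (use i U V in auto)
      also have "\<dots> \<le> C * E n h + (2 * (D * E n h) + 2 * (measure M V * (b - a)\<^sup>2))"
        using a b i U V by simp
      also have "\<dots> \<le> C * E n h + (2 * (D * E n h)
          + 2 * (measure M V * ((2 * C + 2 * D) / \<mu> * E n h)))"
        using ab by (intro add_left_mono mult_left_mono) auto
      also have "\<dots> = L * E n h"
        by (simp add: L_def algebra_simps)
      finally show "\<exists>a. (\<integral>x. indicator (U \<union> V) x * (h x - a)\<^sup>2 \<partial>M) \<le> L * E n h" by blast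
    qed
  qed
  ultimately show ?thesis unfolding poincare_on_def by blast
qed

text \<open>The second moment of \<open>h\<close> about \<open>r\<close> is its second moment about its mean, which is
  nonnegative, plus \<open>measure M Q\<close> times the squared distance from \<open>r\<close> to the mean.\<close>

lemma variance_le:
  assumes h: "square_integrable M h" and Q: "Q \<in> sets M" "measure M Q > 0"
  shows "measure M Q * (r - (\<integral>y. indicator Q y * h y \<partial>M) / measure M Q)\<^sup>2
    \<le> (\<integral>y. indicator Q y * (h y - r)\<^sup>2 \<partial>M)"
proof -
  define b where "b = (\<integral>y. indicator Q y * h y \<partial>M) / measure M Q"
  have mean: "(\<integral>y. indicator Q y * h y \<partial>M) = b * measure M Q"
    using Q(2) by (simp add: b_def)
  have i0: "integrable M (\<lambda>y. indicator Q y * h y)"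
    by (rule square_integrable_imp_integrable[OF square_integrable_indicator_mult[OF h Q(1)]])
  have i1: "integrable M (\<lambda>y. indicator Q y * (h y - b)\<^sup>2)"
    by (rule integrable_indicator_sq[OF h Q(1)])
  have "0 \<le> (\<integral>y. indicator Q y * (h y - b)\<^sup>2 \<partial>M)"
    by (rule Bochner_Integration.integral_nonneg) simp
  moreover have "(\<integral>y. indicator Q y * (h y - r)\<^sup>2 \<partial>M)
      = (\<integral>y. indicator Q y * (h y - b)\<^sup>2
          + (2 * (b - r) * (indicator Q y * h y) + indicator Q y * (r\<^sup>2 - b\<^sup>2)) \<partial>M)"
    by (rule Bochner_Integration.integral_cong)
      (auto simp: indicator_def power2_eq_square algebra_simps)
  moreover have "\<dots> = (\<integral>y. indicator Q y * (h y - b)\<^sup>2 \<partial>M)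
      + (2 * (b - r) * (b * measure M Q) + measure M Q * (r\<^sup>2 - b\<^sup>2))"
    using i0 i1 Q(1) by (simp add: mean)
  moreover have "2 * (b - r) * (b * measure M Q) + measure M Q * (r\<^sup>2 - b\<^sup>2)
      = measure M Q * (r - b)\<^sup>2"
    by (simp add: power2_eq_square algebra_simps)
  ultimately show ?thesis by (simp add: b_def)
qed

text \<open>The energy compares only values on \<open>P\<close> with values on \<open>Q\<close>, yet it controls the
  oscillation on both. A value on \<open>P\<close> is compared with the mean over \<open>Q\<close> by \<open>variance_le\<close>; a value
  on \<open>Q\<close> is compared with that mean by passing through a point of \<open>P\<close>, which accounts for the
  factor 4.\<close>

lemma mixed_cell_poincare:
  assumes h: "square_integrable M h" and P: "P \<in> sets M" and Q: "Q \<in> sets M"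
    and pos: "measure M P > 0" "measure M Q > 0" and disj: "P \<inter> Q = {}"
  defines "b \<equiv> (\<integral>y. indicator Q y * h y \<partial>M) / measure M Q"
  shows "(\<integral>x. indicator (P \<union> Q) x * (h x - b)\<^sup>2 \<partial>M)
    \<le> (1 / measure M Q + 4 / measure M P)
        * nonlocal_form M (\<lambda>x y. indicator P x * indicator Q y) h h"
proof -
  define e where "e x = (\<integral>y. indicator Q y * (h y - h x)\<^sup>2 \<partial>M)" for x
  let ?S = "nonlocal_form M (\<lambda>x y. indicator P x * indicator Q y) h h"
  have k: "bounded_kernel M (\<lambda>x y. indicator P x * indicator Q y :: real)"
    using bounded_kernel_cut[OF bounded_kernel_one P Q, of 1] by simp
  interpret PP: pair_sigma_finite M M by (rule pair_sigma_finite_self)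
  have S: "?S = (\<integral>x. indicator P x * e x \<partial>M)"
    unfolding nonlocal_form_def e_def
    by (simp add: power2_eq_square mult.assoc flip: integral_mult_right_zero)
  have ie: "integrable M (\<lambda>x. indicator P x * e x)"
    using PP.integrable_fst[OF integrable_nonlocal[OF k h h]]
    by (simp add: e_def power2_eq_square mult.assoc flip: integral_mult_right_zero)
  note i = integrable_indicator_sq[OF h]
  have eb: "measure M Q * (h x - b)\<^sup>2 \<le> e x" for x
    unfolding e_def b_def by (rule variance_le[OF h Q pos(2)])
  have "measure M Q * (\<integral>x. indicator P x * (h x - b)\<^sup>2 \<partial>M)
      = (\<integral>x. indicator P x * (measure M Q * (h x - b)\<^sup>2) \<partial>M)"
    by (simp add: algebra_simps flip: integral_mult_right_zero)
  also have "\<dots> \<le> ?S"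
    unfolding S
  proof (rule integral_mono)
    show "integrable M (\<lambda>x. indicator P x * (measure M Q * (h x - b)\<^sup>2))"
      using integrable_mult_right[OF i[OF P, of b], of "measure M Q"] by (simp add: algebra_simps)
  qed (use ie eb in \<open>auto intro!: mult_left_mono\<close>)
  finally have 1: "(\<integral>x. indicator P x * (h x - b)\<^sup>2 \<partial>M) \<le> 1 / measure M Q * ?S"
    using pos by (simp add: field_simps)
  let ?I = "\<integral>y. indicator Q y * (h y - b)\<^sup>2 \<partial>M"
  have "?I \<le> 4 * e x" for x
  proof -
    have "?I \<le> (\<integral>y. 2 * (indicator Q y * (h y - h x)\<^sup>2) + 2 * (indicator Q y * (h x - b)\<^sup>2) \<partial>M)"
    proof (rule integral_mono)
      show "indicator Q y * (h y - b)\<^sup>2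
          \<le> 2 * (indicator Q y * (h y - h x)\<^sup>2) + 2 * (indicator Q y * (h x - b)\<^sup>2)" for y
        using sq_diff_le[of "h y" b "h x"] by (auto simp: indicator_def)
    qed (use i[OF Q] Q in simp_all)
    also have "\<dots> = 2 * e x + 2 * (measure M Q * (h x - b)\<^sup>2)"
      using i[OF Q] Q by (simp add: e_def)
    finally show ?thesis using eb[of x] by simp
  qed
  then have "(\<integral>x. indicator P x * ?I \<partial>M) \<le> (\<integral>x. 4 * (indicator P x * e x) \<partial>M)"
    using ie P by (intro integral_mono) (auto split: split_indicator)
  then have "measure M P * ?I \<le> 4 * ?S"
    unfolding S using P by simp
  then have 2: "?I \<le> 4 / measure M P * ?S"
    using pos by (simp add: field_simps)
  have "indicator (P \<union> Q) x * (h x - b)\<^sup>2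
      = indicator P x * (h x - b)\<^sup>2 + indicator Q x * (h x - b)\<^sup>2" for x
    using disj by (auto simp: indicator_def)
  then have "(\<integral>x. indicator (P \<union> Q) x * (h x - b)\<^sup>2 \<partial>M)
      = (\<integral>x. indicator P x * (h x - b)\<^sup>2 \<partial>M) + ?I"
    using i P Q by simp
  then show ?thesis using 1 2 by (simp add: algebra_simps)
qed

text \<open>Inside a cell on which the kernel is at least \<open>c\<close>, the constant of \<open>mixed_cell_poincare\<close>
  depends only on \<open>c\<close> and on the measures of the two phases in the cell, and these have positive
  limits \<open>\<alpha>\<close> and \<open>\<beta>\<close>.\<close>

lemma poincare_on_cell:
  assumes U: "U \<in> sets M" and AB: "\<And>n. A n \<in> sets M" "\<And>n. B n \<in> sets M"
    and split: "\<And>n. U \<subseteq> A n \<union> B n" "\<And>n. A n \<inter> B n = {}"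
    and k: "bounded_kernel M k" and k0: "\<And>x y. k x y \<ge> 0"
    and c: "c > 0" "\<And>x y. x \<in> U \<Longrightarrow> y \<in> U \<Longrightarrow> k x y \<ge> c"
    and densA: "(\<lambda>n. measure M (A n \<inter> U)) \<longlonglongrightarrow> \<alpha>" "\<alpha> > 0"
    and densB: "(\<lambda>n. measure M (B n \<inter> U)) \<longlonglongrightarrow> \<beta>" "\<beta> > 0"
  shows "poincare_on M (\<lambda>n h. nonlocal_form M (\<lambda>x y. indicator (A n) x * indicator (B n) y * k x y) h h) U"
proof -
  define C where "C = (2 / \<beta> + 8 / \<alpha>) / c"
  have "C \<ge> 0" using c densA(2) densB(2) by (simp add: C_def)
  moreover have "\<forall>\<^sub>F n in sequentially. measure M (A n \<inter> U) > \<alpha> / 2"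
    using densA by (intro order_tendstoD) auto
  moreover have "\<forall>\<^sub>F n in sequentially. measure M (B n \<inter> U) > \<beta> / 2"
    using densB by (intro order_tendstoD) auto
  ultimately show ?thesis
    unfolding poincare_on_def
  proof (intro exI[of _ C] conjI, goal_cases)
    case 2
    from 2(2,3) show ?case
    proof eventually_elim
      case (elim n)
      show ?case
      proof (intro allI impI)
        fix h assume h: "square_integrable M h"
        define P where "P = A n \<inter> U"
        define Q where "Q = B n \<inter> U"
        define b where "b = (\<integral>y. indicator Q y * h y \<partial>M) / measure M Q"
        have PQ: "P \<in> sets M" "Q \<in> sets M" "P \<inter> Q = {}" "P \<union> Q = U"
          using AB U split(1)[of n] split(2)[of n] unfolding P_def Q_def by auto
        have m: "measure M P > \<alpha> / 2" "measure M Q > \<beta> / 2"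
          using elim by (auto simp: P_def Q_def)
        then have m0: "measure M P > 0" "measure M Q > 0" using densA densB by auto
        let ?S = "nonlocal_form M (\<lambda>x y. indicator P x * indicator Q y) h h"
        let ?E = "nonlocal_form M (\<lambda>x y. indicator (A n) x * indicator (B n) y * k x y) h h"
        have bk: "bounded_kernel M (\<lambda>x y. c * (indicator P x * indicator Q y * 1))"
          by (rule bounded_kernel_cut[OF bounded_kernel_one PQ(1,2)])
        have "nonlocal_form M (\<lambda>x y. c * (indicator P x * indicator Q y * 1)) h h \<le> ?E"
        proof (rule nonlocal_form_mono_kernel[OF bk _ h])
          show "bounded_kernel M (\<lambda>x y. indicator (A n) x * indicator (B n) y * k x y)"
            using bounded_kernel_cut[OF k AB, of 1] by simp
        qed (use c k0 in \<open>auto simp: indicator_def P_def Q_def\<close>)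
        moreover have "nonlocal_form M (\<lambda>x y. c * (indicator P x * indicator Q y * 1)) h h = c * ?S"
          by (simp add: nonlocal_form_def mult.assoc)
        ultimately have S: "?S \<le> ?E / c" using c by (simp add: field_simps)
        have S0: "?S \<ge> 0"
          unfolding nonlocal_form_def
          by (intro Bochner_Integration.integral_nonneg) (simp add: mult.assoc)
        have "(\<integral>x. indicator U x * (h x - b)\<^sup>2 \<partial>M) \<le> (1 / measure M Q + 4 / measure M P) * ?S"
          using mixed_cell_poincare[OF h PQ(1,2) m0 PQ(3)] by (simp add: PQ(4) b_def)
        also have "\<dots> \<le> (2 / \<beta> + 8 / \<alpha>) * ?S"
        proof (intro mult_right_mono add_mono)
          show "1 / measure M Q \<le> 2 / \<beta>" "4 / measure M P \<le> 8 / \<alpha>"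
            using m m0 densA densB by (auto simp: field_simps)
        qed (rule S0)
        also have "\<dots> \<le> (2 / \<beta> + 8 / \<alpha>) * (?E / c)"
          using S densA densB by (intro mult_left_mono) auto
        also have "\<dots> = C * ?E" by (simp add: C_def)
        finally show "\<exists>a. (\<integral>x. indicator U x * (h x - a)\<^sup>2 \<partial>M) \<le> C * ?E" by blast
      qed
    qed
  qed
qed

text \<open>The mean is the best constant in the mean square sense, so for a function of mean zero
  the constant \<open>a\<close> may be replaced by 0.\<close>

lemma poincare_on_space_mean_zero:
  assumes P: "poincare_on M E (space M)"
  shows "\<exists>C\<ge>0. \<forall>\<^sub>F n in sequentially. \<forall>h. square_integrable M h \<and> (\<integral>x. h x \<partial>M) = 0
    \<longrightarrow> (\<integral>x. (h x)\<^sup>2 \<partial>M) \<le> C * E n h"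
proof -
  obtain C where C: "C \<ge> 0" and ev: "\<forall>\<^sub>F n in sequentially. \<forall>h. square_integrable M h \<longrightarrow>
     (\<exists>a. (\<integral>x. indicator (space M) x * (h x - a)\<^sup>2 \<partial>M) \<le> C * E n h)"
    using P unfolding poincare_on_def by blast
  have "\<forall>\<^sub>F n in sequentially. \<forall>h. square_integrable M h \<and> (\<integral>x. h x \<partial>M) = 0
    \<longrightarrow> (\<integral>x. (h x)\<^sup>2 \<partial>M) \<le> C * E n h"
    using ev
  proof eventually_elim
    case (elim n)
    show ?case
    proof (intro allI impI)
      fix h assume h: "square_integrable M h \<and> (\<integral>x. h x \<partial>M) = 0"
      then obtain a where a: "(\<integral>x. indicator (space M) x * (h x - a)\<^sup>2 \<partial>M) \<le> C * E n h"
        using elim by blast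
      have ih: "integrable M h"
        using h by (intro square_integrable_imp_integrable) simp
      have ih2: "integrable M (\<lambda>x. (h x)\<^sup>2)"
        using h by (simp add: square_integrable_def)
      have "(\<integral>x. (h x)\<^sup>2 \<partial>M) \<le> (\<integral>x. (h x)\<^sup>2 \<partial>M) + a\<^sup>2 * measure M (space M)" by simp
      also have "\<dots> = (\<integral>x. (h x)\<^sup>2 + ((- 2 * a) * h x + a\<^sup>2) \<partial>M)"
        using ih ih2 h by simp
      also have "\<dots> = (\<integral>x. indicator (space M) x * (h x - a)\<^sup>2 \<partial>M)"
        by (rule Bochner_Integration.integral_cong) (auto simp: power2_eq_square algebra_simps)
      finally show "(\<integral>x. (h x)\<^sup>2 \<partial>M) \<le> C * E n h" using a by simp
    qed
  qed
  then show ?thesis using C by blast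
qed

end

lemma integral_lebesgue_on_subset:
  fixes F :: "'a::euclidean_space \<Rightarrow> real"
  assumes "S \<subseteq> \<Omega>" "S \<in> sets lebesgue" "\<Omega> \<in> sets lebesgue"
  shows "(\<integral>x. F x \<partial>lebesgue_on S) = (\<integral>x. indicator S x * F x \<partial>lebesgue_on \<Omega>)"
proof -
  have "(\<integral>x. indicator S x * F x \<partial>lebesgue_on \<Omega>) = (\<integral>x. (if x \<in> S then F x else 0) \<partial>lebesgue_on \<Omega>)"
    by (rule Bochner_Integration.integral_cong) (auto simp: indicator_def)
  then show ?thesis
    using integral_restrict[OF assms, of F] by simp
qed

lemma bounded_kernel_convolution:
  fixes K :: "'a::euclidean_space \<Rightarrow> real"
  assumes "continuous_on UNIV K" "bounded (range K)"
  shows "bounded_kernel (lebesgue_on \<Omega>) (\<lambda>x y. K (x - y))"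
proof -
  have [measurable]: "K \<in> borel_measurable borel"
    using assms(1) by (rule borel_measurable_continuous_onI)
  have [measurable]: "(\<lambda>x. x) \<in> borel_measurable (lebesgue_on \<Omega>)"
    using id_borel_measurable_lebesgue_on by (simp add: id_def)
  have "(\<lambda>p. K (fst p - snd p)) \<in> borel_measurable (lebesgue_on \<Omega> \<Otimes>\<^sub>M lebesgue_on \<Omega>)"
    by measurable
  moreover obtain b where "\<And>z. \<bar>K z\<bar> \<le> b"
    using assms(2) by (auto simp: bounded_iff)
  ultimately show ?thesis unfolding bounded_kernel_def by blast
qed

text \<open>A Poincare inequality whose constant does not see the scale of the mixture. Cover
  \<open>\<Omega>\<close> by finitely many cells so small that \<open>J (x - y) \<ge> J 0 / 2\<close> within each. By weak-*
  convergence every cell contains \<open>A n\<close> and \<open>B n\<close> in the limiting proportions \<open>X\<close> and \<open>1 - X\<close>, so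
  \<open>poincare_on_cell\<close> applies to each cell, and connectedness of \<open>\<Omega>\<close> links the cells.\<close>

lemma finely_mixed_poincare:
  fixes \<Omega> :: "(real^'n) set"
  assumes \<Omega>: "open \<Omega>" "connected \<Omega>" "\<Omega> \<noteq> {}" "bounded \<Omega>"
    and AB: "\<And>n. A n \<in> sets (lebesgue_on \<Omega>)" "\<And>n. B n = \<Omega> - A n"
    and weak: "weak_star_Linfty \<Omega> (\<lambda>n. indicator (A n)) (\<lambda>x. X)" and X: "0 < X" "X < 1"
    and J: "continuous_on UNIV J" "bounded (range J)" "\<And>z. J z \<ge> 0" "J 0 > 0"
  shows "\<exists>C\<ge>0. \<forall>\<^sub>F n in sequentially. \<forall>h. L2_on \<Omega> h \<and> (\<integral>x. h x \<partial>lebesgue_on \<Omega>) = 0 \<longrightarrow>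
    (\<integral>x. (h x)\<^sup>2 \<partial>lebesgue_on \<Omega>) \<le> C * nonlocal_form (lebesgue_on \<Omega>)
      (\<lambda>x y. indicator (A n) x * indicator (B n) y * J (x - y)) h h"
proof -
  let ?M = "lebesgue_on \<Omega>"
  let ?E = "\<lambda>n h. nonlocal_form ?M (\<lambda>x y. indicator (A n) x * indicator (B n) y * J (x - y)) h h"
  have lm: "\<Omega> \<in> lmeasurable" using \<Omega> by (simp add: lmeasurable_open)
  interpret finite_measure ?M using lm by (rule finite_measure_lebesgue_on)
  have BM: "B n \<in> sets ?M" for n using AB by auto
  have UM: "U \<in> sets ?M" if "open U" "U \<subseteq> \<Omega>" for U
    using that lm by (simp add: sets_restrict_space_iff)
  have m_pos: "measure ?M U > 0" if U: "open U" "U \<subseteq> \<Omega>" "U \<noteq> {}" for U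
  proof -
    have "U \<in> lmeasurable" using U \<Omega> by (meson bounded_subset lmeasurable_open)
    moreover have "\<not> negligible U" using U open_not_negligible by blast
    ultimately have "measure lebesgue U > 0"
      using negligible_iff_measure0 by (metis zero_less_measure_iff)
    moreover have "measure ?M U = measure lebesgue U"
      using U lm by (simp add: measure_restrict_space)
    ultimately show ?thesis by simp
  qed
  have E0: "?E n h \<ge> 0" for n h
    unfolding nonlocal_form_def using J(3)
    by (intro Bochner_Integration.integral_nonneg) (simp add: mult.assoc)
  have densA: "(\<lambda>n. measure ?M (A n \<inter> U)) \<longlonglongrightarrow> X * measure ?M U" if U: "U \<in> sets ?M" for U
  proof -
    have "(\<lambda>n. \<integral>x. indicator (A n) x * indicator U x \<partial>?M) \<longlonglongrightarrow> (\<integral>x. X * indicator U x \<partial>?M)"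
      using weak integrable_indicator_sets[OF U] unfolding weak_star_Linfty_def by blast
    moreover have "(\<integral>x. indicator (A n) x * indicator U x \<partial>?M) = measure ?M (A n \<inter> U)" for n
    proof -
      have "A n \<inter> U \<inter> \<Omega> = A n \<inter> U"
        using sets.sets_into_space[OF U] by auto
      then show ?thesis by (simp flip: indicator_inter_arith)
    qed
    moreover have "U \<inter> \<Omega> = U" using sets.sets_into_space[OF U] by auto
    ultimately show ?thesis by simp
  qed
  have densB: "(\<lambda>n. measure ?M (B n \<inter> U)) \<longlonglongrightarrow> (1 - X) * measure ?M U" if U: "U \<in> sets ?M" for U
  proof -
    have "measure ?M (B n \<inter> U) = measure ?M U - measure ?M (A n \<inter> U)" for n
    proof -
      have "U \<subseteq> \<Omega>" using sets.sets_into_space[OF U] by simp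
      then have "B n \<inter> U = U - A n \<inter> U" unfolding AB(2) by blast
      moreover have "measure ?M (U - A n \<inter> U) = measure ?M U - measure ?M (A n \<inter> U)"
        by (rule finite_measure_Diff) (use U AB(1)[of n] in auto)
      ultimately show ?thesis by simp
    qed
    then show ?thesis
      using tendsto_diff[OF tendsto_const densA[OF U], of "measure ?M U"] by (simp add: left_diff_distrib)
  qed
  obtain r where r: "r > 0" "\<And>z. norm z < r \<Longrightarrow> J z \<ge> J 0 / 2"
  proof -
    obtain d where "d > 0" "\<And>z. dist z 0 < d \<Longrightarrow> dist (J z) (J 0) < J 0 / 2"
      using J(1,4) unfolding continuous_on_iff by (metis UNIV_I half_gt_zero)
    have "J z \<ge> J 0 / 2" if "norm z < d" for z
    proof -
      have "\<bar>J z - J 0\<bar> < J 0 / 2"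
        using \<open>\<And>z. dist z 0 < d \<Longrightarrow> dist (J z) (J 0) < J 0 / 2\<close>[of z] that
        by (simp add: dist_real_def)
      then show ?thesis by linarith
    qed
    with \<open>d > 0\<close> show ?thesis by (rule that)
  qed
  have comp: "compact (closure \<Omega>)" using \<Omega> by simp
  have cov: "closure \<Omega> \<subseteq> \<Union>((\<lambda>p. ball p (r / 2)) ` closure \<Omega>)" using r(1) by force
  obtain D where D: "D \<subseteq> (\<lambda>p. ball p (r / 2)) ` closure \<Omega>" "finite D" "closure \<Omega> \<subseteq> \<Union>D"
    by (rule compactE[OF comp cov]) auto
  define F where "F = (\<lambda>U. U \<inter> \<Omega>) ` D"
  have F\<Omega>: "\<Union>F = \<Omega>" using D(3) closure_subset[of \<Omega>] by (auto simp: F_def)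
  have cell: "open U \<and> U \<noteq> {} \<and> (U \<subseteq> \<Omega> \<and> poincare_on ?M ?E U)" if "U \<in> F" for U
  proof -
    obtain V where V: "V \<in> D" "U = V \<inter> \<Omega>" using \<open>U \<in> F\<close> unfolding F_def by blast
    then have "V \<in> (\<lambda>p. ball p (r / 2)) ` closure \<Omega>" using D(1) by blast
    then obtain p where p: "p \<in> closure \<Omega>" "U = ball p (r / 2) \<inter> \<Omega>" using V(2) by blast
    have oU: "open U" "U \<subseteq> \<Omega>" using p \<Omega> by auto
    have ne: "U \<noteq> {}"
    proof -
      obtain q where "q \<in> \<Omega>" "dist q p < r / 2"
        using p(1) r(1) closure_approachable by (metis half_gt_zero)
      then show ?thesis using p(2) by (auto simp: dist_commute)
    qed
    have "poincare_on ?M ?E U"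
    proof (rule poincare_on_cell[OF UM[OF oU] AB(1) BM])
      show "J 0 / 2 \<le> J (x - y)" if "x \<in> U" "y \<in> U" for x y
      proof (rule r(2))
        have "dist x y < r / 2 + r / 2"
          using that p(2) dist_triangle_less_add[of x p "r / 2" y "r / 2"] by (auto simp: dist_commute)
        then show "norm (x - y) < r" by (simp add: dist_norm)
      qed
      show "(\<lambda>n. measure ?M (A n \<inter> U)) \<longlonglongrightarrow> X * measure ?M U" by (rule densA[OF UM[OF oU]])
      show "(\<lambda>n. measure ?M (B n \<inter> U)) \<longlonglongrightarrow> (1 - X) * measure ?M U" by (rule densB[OF UM[OF oU]])
    qed (use oU AB J X m_pos[OF oU ne] bounded_kernel_convolution in auto)
    then show ?thesis using oU ne by blast
  qed
  have "\<Union>F \<subseteq> \<Omega> \<and> poincare_on ?M ?E (\<Union>F)"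
  proof (rule connected_finite_cover_induct[where P = "\<lambda>U. U \<subseteq> \<Omega> \<and> poincare_on ?M ?E U"])
    show "finite F" "F \<noteq> {}" "connected (\<Union>F)"
      using D(2) F\<Omega> \<Omega> by (auto simp: F_def)
    show "open U \<and> U \<noteq> {} \<and> U \<subseteq> \<Omega> \<and> poincare_on ?M ?E U" if "U \<in> F" for U
      using cell[OF that] by blast
    show "U \<union> V \<subseteq> \<Omega> \<and> poincare_on ?M ?E (U \<union> V)"
      if "open U" "open V" "U \<inter> V \<noteq> {}" "U \<subseteq> \<Omega> \<and> poincare_on ?M ?E U"
        "V \<subseteq> \<Omega> \<and> poincare_on ?M ?E V" for U V
      using that E0 by (intro conjI poincare_on_union UM m_pos) auto
  qed
  then have "poincare_on ?M ?E (space ?M)" using F\<Omega> by simp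
  from poincare_on_space_mean_zero[OF this]
  show ?thesis by (simp add: L2_on_def square_integrable_def)
qed

section \<open>Geometry of the periodic holes\<close>

lemma smooth_fun_differentiable: "smooth_fun \<psi> \<Longrightarrow> \<psi> differentiable (at x)"
  unfolding smooth_fun_def by (metis C_k.simps(2))

text \<open>Near each of its points the frontier lies on the graph of a differentiable function over
  the hyperplane orthogonal to \<open>e\<close>, hence in a differentiable image of a null set.\<close>

lemma smooth_boundary_negligible_frontier:
  fixes S :: "(real^'n) set"
  assumes "open S" "smooth_boundary S"
  shows "negligible (frontier S)"
  unfolding locally_negligible_alt[of "frontier S"]
proof
  fix p assume p: "p \<in> frontier S"
  obtain r e \<psi> where r: "r > 0" and e: "norm e = 1" and \<psi>: "smooth_fun \<psi>"
    and S: "S \<inter> ball p r = {x \<in> ball p r. x \<bullet> e > \<psi> (x - (x \<bullet> e) *\<^sub>R e)}"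
    using assms(2) p unfolding smooth_boundary_def by blast
  let ?g = "\<lambda>y. y + \<psi> y *\<^sub>R e"
  have \<psi>c: "continuous (at x) \<psi>" for x
    using smooth_fun_differentiable[OF \<psi>] by (rule differentiable_imp_continuous_within)
  have "frontier S \<inter> ball p r \<subseteq> ?g ` {y. e \<bullet> y = 0}"
  proof
    fix x assume x: "x \<in> frontier S \<inter> ball p r"
    then have "x \<notin> S" "x \<in> closure S"
      using \<open>open S\<close> by (auto simp: frontier_def interior_open)
    then have le: "x \<bullet> e \<le> \<psi> (x - (x \<bullet> e) *\<^sub>R e)" using S x by force
    have "\<not> x \<bullet> e < \<psi> (x - (x \<bullet> e) *\<^sub>R e)"
    proof
      assume lt: "x \<bullet> e < \<psi> (x - (x \<bullet> e) *\<^sub>R e)"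
      let ?V = "{y. y \<bullet> e < \<psi> (y - (y \<bullet> e) *\<^sub>R e)}"
      have "continuous_on UNIV \<psi>"
        using \<psi>c by (simp add: continuous_at_imp_continuous_on)
      then have "continuous_on UNIV (\<lambda>y. \<psi> (y - (y \<bullet> e) *\<^sub>R e))"
        by (rule continuous_on_compose2) (auto intro!: continuous_intros)
      then have "open ?V"
        by (intro open_Collect_less) (auto intro!: continuous_intros)
      then have "open (?V \<inter> ball p r)" by auto
      moreover have "x \<in> ?V \<inter> ball p r" using x lt by simp
      ultimately obtain y where "y \<in> S" "y \<in> ?V \<inter> ball p r"
        using \<open>x \<in> closure S\<close> by (meson disjoint_iff open_Int_closure_eq_empty)
      then show False using S by force
    qed
    with le have "x = ?g (x - (x \<bullet> e) *\<^sub>R e)" by simp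
    moreover have "e \<bullet> (x - (x \<bullet> e) *\<^sub>R e) = 0"
      using e by (simp add: inner_diff_right inner_commute dot_square_norm)
    ultimately show "x \<in> ?g ` {y. e \<bullet> y = 0}" by blast
  qed
  moreover have "negligible (?g ` {y. e \<bullet> y = 0})"
  proof (rule negligible_differentiable_image_negligible)
    show "negligible {y. e \<bullet> y = 0}" by (rule negligible_hyperplane) (use e in auto)
    have "(?g has_derivative (\<lambda>v. v + frechet_derivative \<psi> (at y) v *\<^sub>R e)) (at y)" for y
    proof -
      have "(\<psi> has_derivative frechet_derivative \<psi> (at y)) (at y)"
        using smooth_fun_differentiable[OF \<psi>] frechet_derivative_works by blast
      then show ?thesis by (intro has_derivative_add has_derivative_ident has_derivative_scaleR_left)
    qed
    then have "?g differentiable (at y)" for y unfolding differentiable_def by blast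
    then show "?g differentiable_on {y. e \<bullet> y = 0}"
      by (simp add: differentiable_at_imp_differentiable_on)
  qed simp
  ultimately have "negligible (frontier S \<inter> ball p r)" by (rule negligible_subset[rotated])
  moreover have "openin (top_of_set (frontier S)) (frontier S \<inter> ball p r)"
    by (simp add: openin_open_Int)
  ultimately show "\<exists>U. openin (top_of_set (frontier S)) U \<and> p \<in> U \<and> negligible U"
    using p r by (metis Int_iff centre_in_ball)
qed

locale perforation =
  fixes \<Omega> T :: "(real^'n) set" and l :: "real^'n" and n :: nat
  assumes bounded_\<Omega>: "bounded \<Omega>"
    and open_T: "open T" and T_nonempty: "T \<noteq> {}"
    and smooth_T: "smooth_boundary T" and T_in_cell: "closure T \<subseteq> box 0 l"
    and l_pos: "\<And>i. l $ i > 0" and n_pos: "n \<ge> 1"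
begin

abbreviation I where "I \<equiv> hole_indices \<Omega> l T n"
abbreviation H where "H \<equiv> hole l T n"
abbreviation A where "A \<equiv> holes \<Omega> l T n"

lemma in_hole_componentwise:
  assumes "x \<in> H k"
  shows "real_of_int (k $ i) * l $ i < n * x $ i" "n * x $ i < real_of_int (k $ i) * l $ i + l $ i"
proof -
  obtain t where t: "t \<in> closure T" "x = (1 / real n) *\<^sub>R ((\<chi> i. real_of_int (k $ i) * l $ i) + t)"
    using assms unfolding hole_def by blast
  have "0 < t $ i" "t $ i < l $ i" using t(1) T_in_cell by (auto simp: mem_box_cart)
  moreover have "n * x $ i = real_of_int (k $ i) * l $ i + t $ i"
    using n_pos by (simp add: t(2))
  ultimately show "real_of_int (k $ i) * l $ i < n * x $ i"
    "n * x $ i < real_of_int (k $ i) * l $ i + l $ i" by auto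
qed

lemma hole_index_unique:
  assumes "x \<in> H k" "x \<in> H k'"
  shows "k = k'"
proof -
  have le: "k $ i \<le> k' $ i" if "x \<in> H k" "x \<in> H k'" for i k k'
  proof -
    have "real_of_int (k $ i) * l $ i < (real_of_int (k' $ i) + 1) * l $ i"
      using in_hole_componentwise[OF that(1), of i] in_hole_componentwise[OF that(2), of i]
      by (simp add: algebra_simps)
    then have "real_of_int (k $ i) < real_of_int (k' $ i) + 1"
      using l_pos[of i] by simp
    then show ?thesis by linarith
  qed
  show ?thesis
    unfolding vec_eq_iff using le[OF assms] le[OF assms(2,1)] by (auto intro: antisym)
qed

lemma compact_hole: "compact (H k)"
proof -
  have "bounded (closure T)" using T_in_cell bounded_box bounded_subset by blast
  then have "compact (closure T)" by (simp add: compact_eq_bounded_closed)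
  then show ?thesis unfolding hole_def
    by (intro compact_continuous_image) (auto intro!: continuous_intros)
qed

lemma dist_in_hole:
  assumes "x \<in> H k" "y \<in> H k"
  shows "dist x y \<le> norm l / n"
proof -
  have "norm (real n *\<^sub>R (x - y)) \<le> norm l"
  proof (rule norm_le_componentwise_cart)
    fix i
    show "norm ((real n *\<^sub>R (x - y)) $ i) \<le> norm (l $ i)"
      using in_hole_componentwise[OF assms(1), of i] in_hole_componentwise[OF assms(2), of i] l_pos[of i]
      by (auto simp: algebra_simps)
  qed
  then have "real n * norm (x - y) \<le> norm l" unfolding norm_scaleR by simp
  then show ?thesis using n_pos by (simp add: dist_norm pos_le_divide_eq mult.commute)
qed

lemma finite_hole_indices: "finite I"
proof -
  obtain b where b: "\<And>x. x \<in> \<Omega> \<Longrightarrow> norm x \<le> b" using bounded_\<Omega> by (auto simp: bounded_iff)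
  obtain t where t: "t \<in> closure T" using T_nonempty closure_subset by blast
  define N where "N = (\<lambda>i. \<lceil>(n * b + l $ i) / l $ i\<rceil>)"
  have "\<bar>k $ i\<bar> \<le> N i" if k: "k \<in> I" for k i
  proof -
    obtain x where x: "x \<in> H k" using t unfolding hole_def by blast
    then have "norm x \<le> b" using k b by (auto simp: hole_indices_def)
    then have "\<bar>x $ i\<bar> \<le> b" using component_le_norm_cart[of x i] by linarith
    then have "n * \<bar>x $ i\<bar> \<le> n * b" by (intro mult_left_mono) auto
    then have "\<bar>n * x $ i\<bar> \<le> n * b" by (simp add: abs_mult)
    then have "\<bar>real_of_int (k $ i)\<bar> * l $ i \<le> n * b + l $ i"
      using in_hole_componentwise[OF x, of i] l_pos[of i]
      by (cases "k $ i \<ge> 0") (auto simp: abs_le_iff)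
    then have "\<bar>real_of_int (k $ i)\<bar> \<le> (n * b + l $ i) / l $ i"
      using l_pos[of i] by (simp add: pos_le_divide_eq)
    then show ?thesis unfolding N_def by linarith
  qed
  then have "I \<subseteq> vec_lambda ` (PiE UNIV (\<lambda>i. {- N i..N i}))"
  proof (intro subsetI)
    fix k assume "k \<in> I"
    then have "vec_nth k \<in> PiE UNIV (\<lambda>i. {- N i..N i})"
      using \<open>\<And>k i. k \<in> I \<Longrightarrow> \<bar>k $ i\<bar> \<le> N i\<close> by (auto simp: abs_le_iff) (metis minus_le_iff)
    then show "k \<in> vec_lambda ` (PiE UNIV (\<lambda>i. {- N i..N i}))"
      by (metis image_eqI vec_nth_inverse)
  qed
  moreover have "finite (PiE (UNIV :: 'n set) (\<lambda>i. {- N i..N i}))"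
    by (intro finite_PiE) auto
  ultimately show ?thesis by (meson finite_imageI finite_subset)
qed

lemma compact_holes: "compact A"
  unfolding holes_def using finite_hole_indices compact_hole by (intro compact_UN) auto

lemma open_hole_core:
  "open ((\<lambda>x. (1 / real n) *\<^sub>R ((\<chi> i. real_of_int (k $ i) * l $ i) + x)) ` T)"
proof -
  have "open ((\<lambda>x. (1 / real n) *\<^sub>R x) ` ((+) (\<chi> i. real_of_int (k $ i) * l $ i) ` T))"
    using n_pos by (intro open_scaling open_translation open_T) auto
  then show ?thesis by (simp add: image_image)
qed

lemma hole_measure_pos: "measure lebesgue (H k) > 0"
proof -
  let ?O = "(\<lambda>x. (1 / real n) *\<^sub>R ((\<chi> i. real_of_int (k $ i) * l $ i) + x)) ` T"
  have "?O \<subseteq> H k" unfolding hole_def using closure_subset by blast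
  moreover have "\<not> negligible ?O" using open_hole_core[of k] T_nonempty open_not_negligible by blast
  ultimately have "\<not> negligible (H k)" using negligible_subset by blast
  moreover have "H k \<in> lmeasurable" using compact_hole by (rule lmeasurable_compact)
  ultimately show ?thesis using negligible_iff_measure0 by (metis zero_less_measure_iff)
qed

text \<open>The weak problem determines the Sobolev component of the solution on the interior of the
  holes only. That the remaining part of the holes is a null set allows one to integrate over the
  closed holes instead.\<close>

lemma negligible_holes_boundary: "negligible (A - interior A)"
proof -
  let ?\<tau> = "\<lambda>k x. (1 / real n) *\<^sub>R ((\<chi> i. real_of_int (k $ i) * l $ i) + x)"
  have "A - interior A \<subseteq> (\<Union>k\<in>I. ?\<tau> k ` frontier T)"
  proof
    fix x assume x: "x \<in> A - interior A"
    then obtain k t where k: "k \<in> I" and t: "t \<in> closure T" "x = ?\<tau> k t"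
      by (auto simp: holes_def hole_def)
    have "?\<tau> k ` T \<subseteq> A" using k closure_subset[of T] by (auto simp: holes_def hole_def)
    then have "?\<tau> k ` T \<subseteq> interior A" using open_hole_core by (rule interior_maximal)
    then have "t \<notin> T" using x t(2) by blast
    then have "t \<in> frontier T" using t(1) open_T by (simp add: frontier_def interior_open)
    then show "x \<in> (\<Union>k\<in>I. ?\<tau> k ` frontier T)" using k t(2) by blast
  qed
  moreover have "negligible (?\<tau> k ` frontier T)" for k
  proof (rule negligible_differentiable_image_negligible)
    show "negligible (frontier T)"
      by (intro smooth_boundary_negligible_frontier open_T smooth_T)
    have "(?\<tau> k has_derivative (\<lambda>v. (1 / real n) *\<^sub>R (0 + v))) (at x)" for x
      by (intro has_derivative_scaleR_right has_derivative_add has_derivative_const has_derivative_ident)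
    then have "?\<tau> k differentiable (at x)" for x unfolding differentiable_def by blast
    then show "?\<tau> k differentiable_on frontier T"
      by (simp add: differentiable_at_imp_differentiable_on)
  qed simp
  then have "negligible (\<Union>k\<in>I. ?\<tau> k ` frontier T)"
    using finite_hole_indices by (intro negligible_Union) auto
  ultimately show ?thesis by (rule negligible_subset[rotated])
qed

lemma the_hole_index:
  assumes "k \<in> I" "x \<in> H k"
  shows "(THE k. k \<in> I \<and> x \<in> H k) = k"
  using assms hole_index_unique by blast

lemma corrector_1_on_hole:
  assumes "k \<in> I" "x \<in> H k"
  shows "corrector_1 \<Omega> l T X u n x
    = 1 / measure lebesgue (H k) * (\<integral>z. u z / X \<partial>lebesgue_on (H k))"
proof -
  have "x \<in> A" using assms by (auto simp: holes_def)
  then show ?thesis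
    unfolding corrector_1_def Let_def the_hole_index[OF assms] by simp
qed

text \<open>On a hole the corrector is the average of \<open>u / X\<close> over a set of diameter at most
  \<open>norm l / n\<close>, so it differs from the value at a point by at most the oscillation of \<open>u / X\<close> at
  that scale.\<close>

lemma corrector_1_close:
  assumes u: "continuous_on (closure \<Omega>) u" and X: "X > 0"
    and osc: "\<And>y z. y \<in> \<Omega> \<Longrightarrow> z \<in> \<Omega> \<Longrightarrow> dist y z \<le> norm l / n \<Longrightarrow> \<bar>u y - u z\<bar> \<le> \<delta>"
    and x: "x \<in> A"
  shows "\<bar>corrector_1 \<Omega> l T X u n x - u x / X\<bar> \<le> \<delta> / X"
proof -
  obtain k where k: "k \<in> I" "x \<in> H k" using x by (auto simp: holes_def)
  have Hs: "H k \<subseteq> \<Omega>" using k by (simp add: hole_indices_def)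
  have lm: "H k \<in> lmeasurable" using compact_hole by (rule lmeasurable_compact)
  interpret finite_measure "lebesgue_on (H k)" using lm by (rule finite_measure_lebesgue_on)
  have m: "measure (lebesgue_on (H k)) (H k) = measure lebesgue (H k)"
    using lm by (simp add: measure_restrict_space)
  have m0: "measure lebesgue (H k) > 0" by (rule hole_measure_pos)
  have meas: "u \<in> borel_measurable (lebesgue_on (H k))"
    by (rule continuous_imp_measurable_on_sets_lebesgue)
      (use u Hs closure_subset lm in \<open>auto intro: continuous_on_subset\<close>)
  have dev: "\<bar>u z - u x\<bar> \<le> \<delta>" if "z \<in> H k" for z
    using osc that k Hs dist_in_hole by blast
  have int: "integrable (lebesgue_on (H k)) (\<lambda>z. u z / X - u x / X)"
  proof (rule integrable_const_bound[where B = "\<delta> / X"])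
    show "AE z in lebesgue_on (H k). norm (u z / X - u x / X) \<le> \<delta> / X"
      using dev X by (intro AE_I2) (simp add: divide_right_mono flip: diff_divide_distrib)
  qed (use meas in simp)
  have int_u: "integrable (lebesgue_on (H k)) (\<lambda>z. u z / X)"
    using Bochner_Integration.integrable_add[OF int integrable_const[of "u x / X"]] by simp
  have "(\<integral>z. u z / X - u x / X \<partial>lebesgue_on (H k))
      = (\<integral>z. u z / X \<partial>lebesgue_on (H k)) - measure lebesgue (H k) * (u x / X)"
    using int_u m by simp
  then have "corrector_1 \<Omega> l T X u n x - u x / X
      = (\<integral>z. u z / X - u x / X \<partial>lebesgue_on (H k)) / measure lebesgue (H k)"
    using m0 by (simp add: corrector_1_on_hole[OF k] field_simps)
  moreover have "\<bar>\<integral>z. u z / X - u x / X \<partial>lebesgue_on (H k)\<bar> \<le> \<delta> / X * measure lebesgue (H k)"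
  proof -
    have "\<bar>\<integral>z. u z / X - u x / X \<partial>lebesgue_on (H k)\<bar> \<le> (\<integral>z. \<delta> / X \<partial>lebesgue_on (H k))"
      using dev X integrable_abs[OF int] by (intro order_trans[OF integral_abs_bound] integral_mono)
        (auto simp: divide_right_mono abs_divide simp flip: diff_divide_distrib)
    then show ?thesis using m by (simp add: mult.commute)
  qed
  ultimately show ?thesis using m0 by (simp add: pos_divide_le_eq)
qed

end

section \<open>Partial derivatives of test functions integrate to zero\<close>

text \<open>The difference quotients of \<open>g\<close> in direction \<open>i\<close> have integral 0 because Lebesgue
  measure is invariant under translation. They converge to the partial derivative, and the mean
  value theorem bounds them by \<open>b\<close> on a fixed ball outside which they vanish.\<close>

lemma integral_partial_derivative_eq_0:
  fixes g :: "real^'n \<Rightarrow> real"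
  assumes diff: "\<And>x. g differentiable (at x)"
    and supp: "\<And>x. R \<le> norm x \<Longrightarrow> g x = 0"
    and bd: "\<And>x. \<bar>frechet_derivative g (at x) (axis i 1)\<bar> \<le> b"
  shows "(\<integral>x. frechet_derivative g (at x) (axis i 1) \<partial>lebesgue) = 0"
proof -
  let ?e = "axis i 1 :: real^'n"
  let ?d = "\<lambda>x. frechet_derivative g (at x) ?e"
  have cont: "continuous_on UNIV g"
    using diff by (simp add: continuous_at_imp_continuous_on differentiable_imp_continuous_within)
  have gm [measurable]: "g \<in> borel_measurable borel"
    using cont by (rule borel_measurable_continuous_onI)
  have line: "((\<lambda>t. g (x + t *\<^sub>R ?e)) has_real_derivative ?d (x + t *\<^sub>R ?e)) (at t)" for x t
  proof -
    have gd: "(g has_derivative frechet_derivative g (at (x + t *\<^sub>R ?e))) (at (x + t *\<^sub>R ?e))"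
      using diff frechet_derivative_works by blast
    have "((\<lambda>t. g (x + t *\<^sub>R ?e)) has_derivative
        (\<lambda>s. frechet_derivative g (at (x + t *\<^sub>R ?e)) (s *\<^sub>R ?e))) (at t)"
      by (rule has_derivative_compose[of "\<lambda>t. x + t *\<^sub>R ?e", OF _ gd])
        (auto intro!: derivative_eq_intros)
    moreover have "frechet_derivative g (at (x + t *\<^sub>R ?e)) (s *\<^sub>R ?e) = ?d (x + t *\<^sub>R ?e) * s" for s
      using linear_frechet_derivative[OF diff] by (simp add: linear_cmul)
    ultimately show ?thesis
      by (simp add: has_field_derivative_def)
  qed
  define h where "h m = 1 / real (Suc m)" for m
  have h: "0 < h m" "h m \<le> 1" for m by (auto simp: h_def)
  define D where "D m x = (g (x + h m *\<^sub>R ?e) - g x) / h m" for m x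
  have D_bound: "\<bar>D m x\<bar> \<le> b" for m x
  proof -
    obtain z where "z > 0" "g (x + h m *\<^sub>R ?e) - g (x + 0 *\<^sub>R ?e) = (h m - 0) * ?d (x + z *\<^sub>R ?e)"
      using MVT2[of 0 "h m" "\<lambda>t. g (x + t *\<^sub>R ?e)" "\<lambda>t. ?d (x + t *\<^sub>R ?e)"] line h by metis
    then have "D m x = ?d (x + z *\<^sub>R ?e)" using h(1)[of m] by (simp add: D_def)
    then show ?thesis using bd by simp
  qed
  have D_supp: "D m x = 0" if "\<not> norm x \<le> R + 1" for m x
  proof -
    have "norm (x + h m *\<^sub>R ?e) \<ge> norm x - norm (h m *\<^sub>R ?e)"
      by (metis add_diff_cancel norm_diff_ineq norm_minus_commute norm_triangle_sub diff_le_eq add.commute)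
    then have "norm (x + h m *\<^sub>R ?e) \<ge> R" using that h[of m] by simp
    then show ?thesis using that by (simp add: D_def supp)
  qed
  have int_g: "integrable lborel g"
  proof -
    have "integrable lborel (\<lambda>x. indicator (cball 0 R) x *\<^sub>R g x)"
      by (rule borel_integrable_compact) (use cont in \<open>auto intro: continuous_on_subset\<close>)
    moreover have "(\<lambda>x. indicator (cball 0 R) x *\<^sub>R g x) = g"
      using supp by (auto simp: indicator_def fun_eq_iff)
    ultimately show ?thesis by simp
  qed
  have shift: "integrable lborel (\<lambda>x. g (x + c)) \<and> (\<integral>x. g (x + c) \<partial>lborel) = (\<integral>x. g x \<partial>lborel)" for c
  proof -
    have "integrable (distr lborel borel ((+) c)) g" using int_g by (simp add: lborel_distr_plus)
    then have "integrable lborel (\<lambda>x. g (c + x))" by (subst (asm) integrable_distr_eq) auto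
    moreover have "(\<integral>x. g x \<partial>distr lborel borel ((+) c)) = (\<integral>x. g (c + x) \<partial>lborel)"
      by (subst integral_distr) auto
    ultimately show ?thesis by (simp add: lborel_distr_plus add.commute)
  qed
  have D_int: "(\<integral>x. D m x \<partial>lebesgue) = 0" for m
  proof -
    have "(\<integral>x. D m x \<partial>lebesgue) = (\<integral>x. D m x \<partial>lborel)"
      by (rule integral_completion) (simp add: D_def)
    also have "\<dots> = 0" unfolding D_def using shift int_g by simp
    finally show ?thesis .
  qed
  have D_lim: "(\<lambda>m. D m x) \<longlonglongrightarrow> ?d x" for x
  proof -
    have "((\<lambda>t. (g (x + t *\<^sub>R ?e) - g x) / t) \<longlongrightarrow> ?d x) (at 0)"
      using line[of x 0] by (simp add: has_field_derivative_iff)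
    moreover have "h \<longlonglongrightarrow> 0"
      using LIMSEQ_inverse_real_of_nat by (simp add: h_def[abs_def] inverse_eq_divide)
    then have "filterlim h (at 0) sequentially"
      unfolding filterlim_at using h(1) by (auto intro!: always_eventually simp: less_imp_neq[symmetric])
    ultimately show ?thesis unfolding D_def by (rule filterlim_compose)
  qed
  have D_meas [measurable]: "D m \<in> borel_measurable lebesgue" for m
    unfolding D_def by (rule measurable_completion) simp
  have "(\<lambda>m. \<integral>x. D m x \<partial>lebesgue) \<longlonglongrightarrow> (\<integral>x. ?d x \<partial>lebesgue)"
  proof (rule integral_dominated_convergence[where w = "\<lambda>x. b * indicator (cball 0 (R + 1)) x"])
    show "?d \<in> borel_measurable lebesgue"
      by (rule borel_measurable_LIMSEQ_metric[OF D_meas]) (rule D_lim)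
    show "integrable lebesgue (\<lambda>x. b * indicator (cball 0 (R + 1)) x)"
      by (intro integrable_mult_right integrable_real_indicator) (simp_all add: emeasure_bounded_finite[OF bounded_cball, simplified])
    show "AE x in lebesgue. norm (D m x) \<le> b * indicator (cball 0 (R + 1)) x" for m
      using D_bound[of m] D_supp[of _ m] by (intro AE_I2) (auto simp: indicator_def)
  qed (use D_lim in auto)
  then have "(\<lambda>m. 0) \<longlonglongrightarrow> (\<integral>x. ?d x \<partial>lebesgue)"
    unfolding D_int .
  from LIMSEQ_unique[OF this tendsto_const] show ?thesis .
qed

lemma test_function_partial_derivative:
  assumes "test_function U \<eta>"
  shows "continuous_on UNIV (\<lambda>x. frechet_derivative \<eta> (at x) (axis i 1))"
    and "x \<notin> fun_support \<eta> \<Longrightarrow> frechet_derivative \<eta> (at x) (axis i 1) = 0"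
    and "\<exists>b. \<forall>x. \<bar>frechet_derivative \<eta> (at x) (axis i 1)\<bar> \<le> b"
proof -
  let ?d = "\<lambda>x. frechet_derivative \<eta> (at x) (axis i 1)"
  have sm: "smooth_fun \<eta>" and K: "compact (fun_support \<eta>)"
    using assms by (auto simp: test_function_def)
  then have "C_k (Suc 0) \<eta>" by (simp add: smooth_fun_def)
  then show cont: "continuous_on UNIV ?d" by simp
  show zero: "?d x = 0" if "x \<notin> fun_support \<eta>" for x
  proof -
    have "open (- fun_support \<eta>)" by (simp add: fun_support_def open_Compl)
    moreover have "\<eta> y = 0" if "y \<in> - fun_support \<eta>" for y
      using that closure_subset by (force simp: fun_support_def)
    ultimately have "(\<eta> has_derivative (\<lambda>_. 0)) (at x)"
      by (intro has_derivative_transform_within_open[OF has_derivative_const[of 0]]) (use that in auto)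
    then show ?thesis using frechet_derivative_at by metis
  qed
  have "compact (?d ` fun_support \<eta>)"
    using K cont by (meson compact_continuous_image continuous_on_subset top_greatest)
  then obtain b where b: "\<And>x. x \<in> fun_support \<eta> \<Longrightarrow> \<bar>?d x\<bar> \<le> b"
    using compact_imp_bounded[of "?d ` fun_support \<eta>"] by (auto simp: bounded_iff)
  have "\<bar>?d x\<bar> \<le> max b 0" for x
    using b[of x] zero[of x] by (cases "x \<in> fun_support \<eta>") auto
  then show "\<exists>b. \<forall>x. \<bar>?d x\<bar> \<le> b" by blast
qed

text \<open>Restricting \<open>\<eta>\<close> to one of the sets \<open>H k\<close>, and extending by 0, gives again a differentiable
  function: the sets are closed and disjoint, hence separated, and \<open>\<eta>\<close> vanishes near the boundary of
  their union. The integral is that of a partial derivative of this restriction.\<close>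

lemma integral_partial_derivative_component_eq_0:
  fixes H :: "'k \<Rightarrow> (real^'n) set"
  assumes fin: "finite I" and cl: "\<And>k. k \<in> I \<Longrightarrow> closed (H k)"
    and disj: "\<And>k j. k \<in> I \<Longrightarrow> j \<in> I \<Longrightarrow> k \<noteq> j \<Longrightarrow> H k \<inter> H j = {}"
    and \<eta>: "test_function (interior (\<Union>k\<in>I. H k)) \<eta>" and k: "k \<in> I"
  shows "(\<integral>x. indicator (H k) x * frechet_derivative \<eta> (at x) (axis i 1) \<partial>lebesgue) = 0"
proof -
  let ?U = "interior (\<Union>k\<in>I. H k)"
  let ?g = "\<lambda>x. indicator (H k) x * \<eta> x"
  have sm: "smooth_fun \<eta>" and K: "compact (fun_support \<eta>)" "fun_support \<eta> \<subseteq> ?U"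
    using \<eta> by (auto simp: test_function_def)
  have \<eta>0: "\<eta> x = 0" if "x \<notin> fun_support \<eta>" for x
    using that closure_subset by (force simp: fun_support_def)
  have der: "(?g has_derivative (\<lambda>v. indicator (H k) x * frechet_derivative \<eta> (at x) v)) (at x)" for x
  proof -
    \<comment> \<open>A neighbourhood of \<open>x\<close> on which the restriction is either \<open>\<eta>\<close> or 0.\<close>
    define W where "W = (if x \<in> fun_support \<eta> then
      (if x \<in> H k then ?U - (\<Union>j\<in>I - {k}. H j) else - H k) else - fun_support \<eta>)"
    have oW: "open W"
      unfolding W_def using fin cl k by (auto simp: fun_support_def intro!: open_Diff closed_UN)
    have xW: "x \<in> W"
    proof (cases "x \<in> fun_support \<eta> \<and> x \<in> H k")
      case True
      then have "x \<notin> H j" if "j \<in> I - {k}" for j using disj[of k j] k that by blast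
      then show ?thesis using True K(2) by (auto simp: W_def)
    qed (auto simp: W_def)
    have eq: "indicator (H k) x * \<eta> y = ?g y" if y: "y \<in> W" for y
    proof (cases "x \<in> fun_support \<eta> \<and> x \<in> H k")
      case True
      then have "y \<in> (\<Union>j\<in>I. H j)" "y \<notin> (\<Union>j\<in>I - {k}. H j)"
        using y interior_subset[of "\<Union>j\<in>I. H j"] by (auto simp: W_def)
      then have "y \<in> H k" by blast
      then show ?thesis using True by simp
    next
      case False
      then show ?thesis using y \<eta>0[of y] by (auto simp: W_def indicator_def split: if_splits)
    qed
    have "(\<eta> has_derivative frechet_derivative \<eta> (at x)) (at x)"
      using smooth_fun_differentiable[OF sm] frechet_derivative_works by blast
    then have "((\<lambda>y. indicator (H k) x * \<eta> y) has_derivative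
        (\<lambda>v. indicator (H k) x * frechet_derivative \<eta> (at x) v)) (at x)"
      by (rule has_derivative_mult_right)
    then show ?thesis
      by (rule has_derivative_transform_within_open[OF _ oW xW eq])
  qed
  have fd: "frechet_derivative ?g (at x) = (\<lambda>v. indicator (H k) x * frechet_derivative \<eta> (at x) v)" for x
    using frechet_derivative_at[OF der] by simp
  obtain b where b: "\<And>x. \<bar>frechet_derivative \<eta> (at x) (axis i 1)\<bar> \<le> b"
    using test_function_partial_derivative(3)[OF \<eta>] by blast
  obtain R where R: "\<And>x. x \<in> fun_support \<eta> \<Longrightarrow> norm x \<le> R"
    using compact_imp_bounded[OF K(1)] by (auto simp: bounded_iff)
  have "(\<integral>x. frechet_derivative ?g (at x) (axis i 1) \<partial>lebesgue) = 0"
  proof (rule integral_partial_derivative_eq_0[where R = "R + 1" and b = "\<bar>b\<bar>"])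
    show "?g differentiable (at x)" for x using der unfolding differentiable_def by blast
    show "?g x = 0" if "R + 1 \<le> norm x" for x 
      using that R[of x] \<eta>0[of x] by (cases "x \<in> fun_support \<eta>") auto
    show "\<bar>frechet_derivative ?g (at x) (axis i 1)\<bar> \<le> \<bar>b\<bar>" for x
      using b[of x] unfolding fd by (cases "x \<in> H k") simp_all
  qed
  then show ?thesis unfolding fd .
qed

section \<open>Functions glued along a set and its complement\<close>

lemma L2_on_iff_square_integrable: "L2_on S h \<longleftrightarrow> square_integrable (lebesgue_on S) h"
  by (simp add: L2_on_def square_integrable_def)

lemma integrable_lebesgue_on_subset_iff:
  fixes F :: "'a::euclidean_space \<Rightarrow> real"
  assumes "S \<subseteq> \<Omega>" "S \<in> sets lebesgue" "\<Omega> \<in> sets lebesgue"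
  shows "integrable (lebesgue_on \<Omega>) (\<lambda>x. if x \<in> S then F x else 0) \<longleftrightarrow> integrable (lebesgue_on S) F"
proof -
  have "(\<lambda>x. if x \<in> \<Omega> then (if x \<in> S then F x else 0) else 0) = (\<lambda>x. if x \<in> S then F x else 0)"
    by (rule ext) (use assms(1) in auto)
  then show ?thesis
    using Lebesgue_Measure.integrable_restrict_UNIV[OF assms(3), of "\<lambda>x. if x \<in> S then F x else 0"]
      Lebesgue_Measure.integrable_restrict_UNIV[OF assms(2), of F] by simp
qed

lemma L2_on_subset_iff:
  assumes "S \<subseteq> \<Omega>" "S \<in> sets lebesgue" "\<Omega> \<in> sets lebesgue"
  shows "L2_on \<Omega> (\<lambda>x. if x \<in> S then F x else 0) \<longleftrightarrow> L2_on S F"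
proof -
  have "(if x \<in> S then F x else 0)\<^sup>2 = (if x \<in> S then (F x)\<^sup>2 else 0)" for x by simp
  then show ?thesis
    unfolding L2_on_def using integrable_lebesgue_on_subset_iff[OF assms, of "\<lambda>x. (F x)\<^sup>2"]
      borel_measurable_if_lebesgue_on[OF assms(2,3,1), of F] by simp
qed

lemma L2_on_cong: "(\<And>x. x \<in> S \<Longrightarrow> F x = F' x) \<Longrightarrow> L2_on S F \<longleftrightarrow> L2_on S F'"
  unfolding L2_on_def
  by (intro arg_cong2[of _ _ _ _ "(\<and>)"] measurable_cong Bochner_Integration.integrable_cong) auto

lemma L2_on_subset:
  assumes "L2_on \<Omega> F" "S \<subseteq> \<Omega>" "S \<in> sets lebesgue" "\<Omega> \<in> sets lebesgue"
  shows "L2_on S F"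
proof -
  have "square_integrable (lebesgue_on \<Omega>) (\<lambda>x. indicator S x * F x)"
    by (rule square_integrable_indicator_mult)
      (use assms in \<open>auto simp: L2_on_iff_square_integrable sets_restrict_space_iff\<close>)
  moreover have "(\<lambda>x. indicator S x * F x) = (\<lambda>x. if x \<in> S then F x else 0)" by (auto simp: indicator_def)
  ultimately show ?thesis
    using L2_on_subset_iff[OF assms(2-4)] by (simp add: L2_on_iff_square_integrable)
qed

text \<open>Lebesgue measure is complete, so the values of \<open>F\<close> on a null set affect neither
  measurability nor integrability.\<close>

lemma L2_on_negligible_diff:
  fixes F :: "real^'n \<Rightarrow> real"
  assumes F: "L2_on A' F" and sub: "A' \<subseteq> A" and neg: "negligible (A - A')"
    and meas: "A \<in> sets lebesgue" "A' \<in> sets lebesgue"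
  shows "L2_on A F"
proof -
  let ?f' = "\<lambda>x. if x \<in> A' then F x else 0" and ?f = "\<lambda>x. if x \<in> A then F x else 0"
  \<comment> \<open>Extended by 0, the two functions differ at most on \<open>A - A'\<close>.\<close>
  have ae: "AE x in lebesgue. ?f' x = ?f x"
  proof (rule AE_I')
    show "A - A' \<in> null_sets lebesgue" using neg negligible_iff_null_sets by blast
    show "{x \<in> space lebesgue. ?f' x \<noteq> ?f x} \<subseteq> A - A'" using sub by auto
  qed
  have m': "?f' \<in> borel_measurable lebesgue"
    using F borel_measurable_if[OF meas(2), of F] by (simp add: L2_on_def)
  then have m: "?f \<in> borel_measurable lebesgue" using ae by (rule borel_measurable_AE)
  have i': "integrable lebesgue (\<lambda>x. (?f' x)\<^sup>2)"
  proof -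
    have "(\<lambda>x. (?f' x)\<^sup>2) = (\<lambda>x. if x \<in> A' then (F x)\<^sup>2 else 0)" by auto
    then show ?thesis using F Lebesgue_Measure.integrable_restrict_UNIV[OF meas(2), of "\<lambda>x. (F x)\<^sup>2"] by (simp add: L2_on_def)
  qed
  have "integrable lebesgue (\<lambda>x. (?f x)\<^sup>2)"
  proof (rule integrable_cong_AE_imp[OF i'])
    show "(\<lambda>x. (?f x)\<^sup>2) \<in> borel_measurable lebesgue" using m by (rule borel_measurable_power)
    show "AE x in lebesgue. (?f' x)\<^sup>2 = (?f x)\<^sup>2" using ae by eventually_elim simp
  qed
  moreover have "(\<lambda>x. (?f x)\<^sup>2) = (\<lambda>x. if x \<in> A then (F x)\<^sup>2 else 0)" by auto
  ultimately show ?thesis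
    using m borel_measurable_if[OF meas(1), of F] Lebesgue_Measure.integrable_restrict_UNIV[OF meas(1), of "\<lambda>x. (F x)\<^sup>2"]
    by (simp add: L2_on_def)
qed

text \<open>A pair of functions on \<open>A\<close> and \<open>\<Omega> - A\<close> is treated below as a single function on \<open>\<Omega>\<close>.
  Both nonlocal terms of the energy then live on one measure space, and the interactions inside
  \<open>B\<close> and between \<open>A\<close> and \<open>B\<close> are described by a single kernel.\<close>

lemma L2_on_glue:
  assumes A: "A \<subseteq> \<Omega>" "A \<in> sets lebesgue" "\<Omega> \<in> sets lebesgue"
    and "L2_on A a" "L2_on (\<Omega> - A) b"
  shows "L2_on \<Omega> (\<lambda>x. if x \<in> A then a x else b x)"
proof -
  have "L2_on \<Omega> (\<lambda>x. if x \<in> A then a x else 0)"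
    using L2_on_subset_iff[OF A] assms by simp
  moreover have "L2_on \<Omega> (\<lambda>x. if x \<in> \<Omega> - A then b x else 0)"
    using L2_on_subset_iff[of "\<Omega> - A" \<Omega> b] assms by auto
  ultimately have "L2_on \<Omega> (\<lambda>x. (if x \<in> A then a x else 0) + (if x \<in> \<Omega> - A then b x else 0))"
    unfolding L2_on_iff_square_integrable by (rule square_integrable_add)
  then show ?thesis by (rule iffD1[OF L2_on_cong, rotated]) auto
qed

lemma integral_glue:
  fixes F :: "real^'n \<Rightarrow> real"
  assumes A: "A \<subseteq> \<Omega>" "A \<in> sets lebesgue" "\<Omega> \<in> sets lebesgue"
    and int: "integrable (lebesgue_on \<Omega>) F"
    and ab: "\<And>x. x \<in> A \<Longrightarrow> a x = F x" "\<And>x. x \<in> \<Omega> - A \<Longrightarrow> b x = F x"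
  shows "(\<integral>x. a x \<partial>lebesgue_on A) + (\<integral>x. b x \<partial>lebesgue_on (\<Omega> - A)) = (\<integral>x. F x \<partial>lebesgue_on \<Omega>)"
proof -
  have AM: "A \<in> sets (lebesgue_on \<Omega>)" "\<Omega> - A \<in> sets (lebesgue_on \<Omega>)"
    using A by (auto simp: sets_restrict_space_iff)
  have "(\<integral>x. a x \<partial>lebesgue_on A) = (\<integral>x. F x \<partial>lebesgue_on A)"
    "(\<integral>x. b x \<partial>lebesgue_on (\<Omega> - A)) = (\<integral>x. F x \<partial>lebesgue_on (\<Omega> - A))"
    using ab by (auto intro!: Bochner_Integration.integral_cong)
  moreover have "(\<integral>x. F x \<partial>lebesgue_on A) = (\<integral>x. indicator A x * F x \<partial>lebesgue_on \<Omega>)"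
    using A by (rule integral_lebesgue_on_subset)
  moreover have "(\<integral>x. F x \<partial>lebesgue_on (\<Omega> - A)) = (\<integral>x. indicator (\<Omega> - A) x * F x \<partial>lebesgue_on \<Omega>)"
    by (rule integral_lebesgue_on_subset) (use A in auto)
  moreover have "(\<integral>x. indicator A x * F x \<partial>lebesgue_on \<Omega>) + (\<integral>x. indicator (\<Omega> - A) x * F x \<partial>lebesgue_on \<Omega>)
      = (\<integral>x. indicator A x * F x + indicator (\<Omega> - A) x * F x \<partial>lebesgue_on \<Omega>)"
    by (rule Bochner_Integration.integral_add[symmetric])
      (use integrable_real_mult_indicator[OF _ int] AM in \<open>auto simp: mult.commute\<close>)
  moreover have "\<dots> = (\<integral>x. F x \<partial>lebesgue_on \<Omega>)"
    by (rule Bochner_Integration.integral_cong) (auto simp: indicator_def)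
  ultimately show ?thesis by simp
qed

section \<open>Piecewise constants have no weak gradient\<close>

lemma piecewise_constant_eq_sum:
  assumes fin: "finite I" and disj: "\<And>k j. k \<in> I \<Longrightarrow> j \<in> I \<Longrightarrow> k \<noteq> j \<Longrightarrow> H k \<inter> H j = {}"
    and p: "\<And>k x. k \<in> I \<Longrightarrow> x \<in> H k \<Longrightarrow> p x = c k" and x: "x \<in> S" "S \<subseteq> (\<Union>k\<in>I. H k)"
  shows "p x = (\<Sum>k\<in>I. c k * indicator (S \<inter> H k) x :: real)"
proof -
  obtain j where j: "j \<in> I" "x \<in> H j" using x by blast
  have "(\<Sum>k\<in>I. c k * indicator (S \<inter> H k) x) = (\<Sum>k\<in>I. if k = j then c j else 0)"
    using j x disj by (intro sum.cong refl) (auto simp: indicator_def)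
  then show ?thesis using p[OF j] j fin by simp
qed

lemma L2_on_piecewise_constant:
  fixes H :: "'k \<Rightarrow> (real^'n) set"
  assumes fin: "finite I" and comp: "\<And>k. k \<in> I \<Longrightarrow> compact (H k)"
    and disj: "\<And>k j. k \<in> I \<Longrightarrow> j \<in> I \<Longrightarrow> k \<noteq> j \<Longrightarrow> H k \<inter> H j = {}"
    and p: "\<And>k x. k \<in> I \<Longrightarrow> x \<in> H k \<Longrightarrow> p x = c k"
    and S: "S \<in> lmeasurable" "S \<subseteq> (\<Union>k\<in>I. H k)"
  shows "L2_on S p"
proof -
  interpret finite_measure "lebesgue_on S" using S(1) by (rule finite_measure_lebesgue_on)
  have HM: "S \<inter> H k \<in> sets (lebesgue_on S)" if "k \<in> I" for k
    using S(1) comp[OF that] by (auto simp: sets_restrict_space dest!: lmeasurable_compact)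
  have "square_integrable (lebesgue_on S) (\<lambda>x. \<Sum>k\<in>I. c k * indicator (S \<inter> H k) x)"
    using fin HM
  proof (induction I rule: finite_induct)
    case empty
    show ?case using square_integrable_const[of 0] by simp
  next
    case (insert k I)
    have "square_integrable (lebesgue_on S) (\<lambda>x. indicator (S \<inter> H k) x * c k)"
      using insert.prems by (intro square_integrable_indicator_mult square_integrable_const) auto
    then have "square_integrable (lebesgue_on S) (\<lambda>x. c k * indicator (S \<inter> H k) x
        + (\<Sum>k\<in>I. c k * indicator (S \<inter> H k) x))"
      using insert.IH insert.prems by (intro square_integrable_add) (auto simp: mult.commute)
    then show ?case
      unfolding sum.insert[OF insert.hyps(1,2)] .
  qed
  then have "L2_on S (\<lambda>x. \<Sum>k\<in>I. c k * indicator (S \<inter> H k) x)"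
    by (simp add: L2_on_iff_square_integrable)
  then show ?thesis
    by (rule iffD2[OF L2_on_cong, rotated]) (rule piecewise_constant_eq_sum[OF fin disj p _ S(2)])
qed

text \<open>A function that is constant on each of finitely many disjoint compact sets has zero weak
  gradient in the interior of their union, so subtracting it leaves the gradient unchanged. This is
  why the corrector averages over each hole: in \<open>A\<close> it carries no gradient energy.\<close>

lemma H1_gradient_diff_piecewise_constant:
  fixes H :: "'k \<Rightarrow> (real^'n) set"
  defines "U \<equiv> \<lambda>I. interior (\<Union>k\<in>I. H k)"
  assumes fin: "finite I" and comp: "\<And>k. k \<in> I \<Longrightarrow> compact (H k)"
    and disj: "\<And>k j. k \<in> I \<Longrightarrow> j \<in> I \<Longrightarrow> k \<noteq> j \<Longrightarrow> H k \<inter> H j = {}"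
    and u: "H1_gradient (U I) u g" and p: "\<And>k x. k \<in> I \<Longrightarrow> x \<in> H k \<Longrightarrow> p x = c k"
  shows "H1_gradient (U I) (\<lambda>x. u x - p x) g"
proof -
  let ?U = "U I"
  let ?M = "lebesgue_on ?U"
  have "compact (\<Union>k\<in>I. H k)" using fin comp by auto
  then have "bounded ?U" unfolding U_def
    using compact_imp_bounded bounded_subset interior_subset by blast
  moreover have "open ?U" by (simp add: U_def)
  ultimately have lm: "?U \<in> lmeasurable" by (simp add: lmeasurable_open)
  interpret finite_measure ?M using lm by (rule finite_measure_lebesgue_on)
  have HM: "?U \<inter> H k \<in> sets ?M" if "k \<in> I" for k
    using lm comp[OF that] by (auto simp: sets_restrict_space dest!: lmeasurable_compact)
  have sub: "?U \<subseteq> (\<Union>k\<in>I. H k)" by (simp add: U_def interior_subset)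
  have p_eq: "p x = (\<Sum>k\<in>I. c k * indicator (?U \<inter> H k) x)" if x: "x \<in> ?U" for x
    by (rule piecewise_constant_eq_sum[OF fin disj p x sub])
  have pL2: "L2_on ?U p" by (rule L2_on_piecewise_constant[OF fin comp disj p lm sub])
  have uL2: "L2_on ?U u" using u by (simp add: H1_gradient_def)
  have "L2_on ?U (\<lambda>x. u x - p x)"
    using square_integrable_diff uL2 pL2 by (simp add: L2_on_iff_square_integrable)
  moreover have "(\<integral>x. (u x - p x) * frechet_derivative \<eta> (at x) (axis i 1) \<partial>?M)
      = - (\<integral>x. (g x $ i) * \<eta> x \<partial>?M)" if \<eta>: "test_function ?U \<eta>" for \<eta> i
  proof -
    let ?d = "\<lambda>x. frechet_derivative \<eta> (at x) (axis i 1)"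
    obtain b where b: "\<And>x. \<bar>?d x\<bar> \<le> b" using test_function_partial_derivative(3)[OF \<eta>] by blast
    have dm: "?d \<in> borel_measurable ?M"
      using continuous_imp_measurable_on_sets_lebesgue[of ?U ?d] lm
        continuous_on_subset[OF test_function_partial_derivative(1)[OF \<eta>]] by (auto simp: fmeasurableD)
    have d: "square_integrable ?M ?d" by (rule square_integrable_bounded[OF dm b])
    have iu: "integrable ?M (\<lambda>x. u x * ?d x)" and ip: "integrable ?M (\<lambda>x. p x * ?d x)"
      using integrable_mult_square_integrable[OF _ d] uL2 pL2 by (auto simp: L2_on_iff_square_integrable)
    have ik: "integrable ?M (\<lambda>x. indicator (?U \<inter> H k) x * ?d x)" if "k \<in> I" for k
      by (rule square_integrable_imp_integrable[OF square_integrable_indicator_mult[OF d HM[OF that]]])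
    have zero: "(\<integral>x. indicator (?U \<inter> H k) x * ?d x \<partial>?M) = 0" if k: "k \<in> I" for k
    proof -
      have "(\<integral>x. indicator (?U \<inter> H k) x * ?d x \<partial>?M) = (\<integral>x. indicator (H k) x * ?d x \<partial>?M)"
        by (rule Bochner_Integration.integral_cong) (auto simp: indicator_def)
      also have "\<dots> = (\<integral>x. indicator ?U x * (indicator (H k) x * ?d x) \<partial>lebesgue_on UNIV)"
        by (rule integral_lebesgue_on_subset) (use lm in auto)
      also have "\<dots> = (\<integral>x. indicator (H k) x * ?d x \<partial>lebesgue)"
        unfolding lebesgue_on_UNIV_eq
      proof (rule Bochner_Integration.integral_cong[OF refl])
        show "indicator ?U x * (indicator (H k) x * ?d x) = indicator (H k) x * ?d x" for x
          using test_function_partial_derivative(2)[OF \<eta>, of x] \<eta>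
          by (cases "x \<in> ?U") (auto simp: test_function_def)
      qed
      also have "\<dots> = 0"
        by (rule integral_partial_derivative_component_eq_0[OF fin _ disj _ k])
          (use comp compact_imp_closed \<eta> in \<open>auto simp: U_def\<close>)
      finally show ?thesis .
    qed
    have "(\<integral>x. p x * ?d x \<partial>?M) = (\<integral>x. (\<Sum>k\<in>I. c k * (indicator (?U \<inter> H k) x * ?d x)) \<partial>?M)"
      by (rule Bochner_Integration.integral_cong) (auto simp: p_eq sum_distrib_right mult.assoc)
    also have "\<dots> = (\<Sum>k\<in>I. c k * (\<integral>x. indicator (?U \<inter> H k) x * ?d x \<partial>?M))"
      using ik by (subst Bochner_Integration.integral_sum) auto
    also have "\<dots> = 0" using zero by simp
    finally have "(\<integral>x. p x * ?d x \<partial>?M) = 0" .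
    moreover have "(\<integral>x. (u x - p x) * ?d x \<partial>?M) = (\<integral>x. u x * ?d x \<partial>?M) - (\<integral>x. p x * ?d x \<partial>?M)"
      using iu ip by (simp add: left_diff_distrib)
    ultimately show ?thesis using u \<eta> by (simp add: H1_gradient_def)
  qed
  ultimately show ?thesis using u by (simp add: H1_gradient_def)
qed

section \<open>The energy identity for the error\<close>

text \<open>The interaction between \<open>A\<close> and \<open>B\<close> is split evenly between the two orders of the
  variables. This makes the kernel symmetric without changing its quadratic form.\<close>

definition coupling_kernel ::
  "(real^'n \<Rightarrow> real) \<Rightarrow> (real^'n \<Rightarrow> real) \<Rightarrow> (real^'n) set \<Rightarrow> (real^'n) set \<Rightarrow> real^'n \<Rightarrow> real^'n \<Rightarrow> real"
  where
  "coupling_kernel J G A B x y =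
     1/2 * (indicator B x * indicator B y * G (x - y))
   + (1/2 * (indicator A x * indicator B y * J (x - y))
    + 1/2 * (indicator B x * indicator A y * J (x - y)))"

lemma interaction_kernelD:
  assumes "interaction_kernel K"
  shows "continuous_on UNIV K" "\<And>z. K z \<ge> 0" "K 0 > 0"
  using assms unfolding interaction_kernel_def by blast+

lemma interaction_kernel_bounded:
  assumes "interaction_kernel K"
  shows "bounded (range K)"
proof -
  have "compact (K ` fun_support K)"
    using assms unfolding interaction_kernel_def
    by (meson compact_continuous_image continuous_on_subset top_greatest)
  moreover have "range K \<subseteq> insert 0 (K ` fun_support K)"
    using closure_subset unfolding fun_support_def by fastforce
  ultimately show ?thesis
    using bounded_subset compact_imp_bounded bounded_insert by metis
qed

lemma interaction_kernel_sym:
  assumes "interaction_kernel K"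
  shows "K (x - y) = K (y - x)"
  using assms unfolding interaction_kernel_def by (metis norm_minus_commute)

lemma bounded_kernel_interaction:
  assumes "interaction_kernel K"
  shows "bounded_kernel (lebesgue_on \<Omega>) (\<lambda>x y. K (x - y))"
  by (rule bounded_kernel_convolution[OF interaction_kernelD(1)[OF assms] interaction_kernel_bounded[OF assms]])

lemma coupling_kernel_sym:
  assumes "interaction_kernel J" "interaction_kernel G"
  shows "coupling_kernel J G A B x y = coupling_kernel J G A B y x"
  unfolding coupling_kernel_def interaction_kernel_sym[OF assms(1), of x y]
    interaction_kernel_sym[OF assms(2), of x y] by (simp add: mult.commute mult.left_commute)

lemma bounded_kernel_coupling:
  assumes "interaction_kernel J" "interaction_kernel G" "A \<in> sets (lebesgue_on \<Omega>)" "B \<in> sets (lebesgue_on \<Omega>)"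
  shows "bounded_kernel (lebesgue_on \<Omega>) (coupling_kernel J G A B)"
  unfolding coupling_kernel_def[abs_def]
  by (intro bounded_kernel_add bounded_kernel_cut bounded_kernel_interaction assms)

lemma energy_form_eq_nonlocal_form:
  fixes \<Omega> A :: "(real^'n) set"
  defines "M \<equiv> lebesgue_on \<Omega>" and "B \<equiv> \<Omega> - A"
  assumes \<Omega>: "\<Omega> \<in> lmeasurable" and A: "A \<subseteq> \<Omega>" "A \<in> sets lebesgue"
    and J: "interaction_kernel J" and G: "interaction_kernel G"
    and z: "L2_on \<Omega> z" "\<And>x. x \<in> A \<Longrightarrow> z x = u x" "\<And>x. x \<in> B \<Longrightarrow> z x = v x"
    and h: "L2_on \<Omega> h" "\<And>x. x \<in> A \<Longrightarrow> h x = \<phi> x" "\<And>x. x \<in> B \<Longrightarrow> h x = \<theta> x"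
  shows "energy_form J G A B u Du v \<phi> D\<phi> \<theta>
    = (\<integral>x. Du x \<bullet> D\<phi> x \<partial>lebesgue_on A) + nonlocal_form M (coupling_kernel J G A B) z h"
proof -
  interpret finite_measure M unfolding M_def using \<Omega> by (rule finite_measure_lebesgue_on)
  have \<Omega>s: "\<Omega> \<in> sets lebesgue" using \<Omega> by auto
  have B: "B \<subseteq> \<Omega>" "B \<in> sets lebesgue" using A \<Omega>s by (auto simp: B_def)
  have AM: "A \<in> sets M" and BM: "B \<in> sets M"
    using A B \<Omega>s by (auto simp: M_def sets_restrict_space_iff)
  have sq: "square_integrable M z" "square_integrable M h"
    using z(1) h(1) by (auto simp: M_def L2_on_iff_square_integrable)
  have double: "(\<integral>x. (\<integral>y. F x y \<partial>lebesgue_on Q) \<partial>lebesgue_on P)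
      = (\<integral>x. (\<integral>y. indicator P x * (indicator Q y * F x y) \<partial>M) \<partial>M)"
    if "P \<subseteq> \<Omega>" "P \<in> sets lebesgue" "Q \<subseteq> \<Omega>" "Q \<in> sets lebesgue" for P Q and F :: "_ \<Rightarrow> _ \<Rightarrow> real"
    using integral_lebesgue_on_subset[OF that(1,2) \<Omega>s] integral_lebesgue_on_subset[OF that(3,4) \<Omega>s]
    by (simp add: M_def)
  have GG: "1/2 * (\<integral>x. (\<integral>y. G (x - y) * (v y - v x) * (\<theta> y - \<theta> x) \<partial>lebesgue_on B) \<partial>lebesgue_on B)
      = nonlocal_form M (\<lambda>x y. 1/2 * (indicator B x * indicator B y * G (x - y))) z h"
    unfolding double[OF B B] nonlocal_form_def
    unfolding integral_mult_right_zero[symmetric]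
    by (intro Bochner_Integration.integral_cong refl)
      (auto simp: indicator_def z(3) h(3))
  define k1 where "k1 = (\<lambda>x y. 1/2 * (indicator A x * indicator B y * J (x - y)))"
  define k2 where "k2 = (\<lambda>x y. 1/2 * (indicator B x * indicator A y * J (x - y)))"
  have bk: "bounded_kernel M k1" "bounded_kernel M k2"
      "bounded_kernel M (\<lambda>x y. 1/2 * (indicator B x * indicator B y * G (x - y)))"
    unfolding k1_def k2_def using AM BM J G
    by (auto intro!: bounded_kernel_cut simp: M_def bounded_kernel_interaction simp del: times_divide_eq_left)
  have "k2 = (\<lambda>x y. k1 y x)"
    using interaction_kernel_sym[OF J] by (auto simp: k1_def k2_def fun_eq_iff)
  then have swap: "nonlocal_form M k2 z h = nonlocal_form M k1 z h"
    using nonlocal_form_swap_kernel[OF bk(1) sq] by simp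
  have JJ: "(\<integral>x. (\<integral>y. J (x - y) * (v y - u x) * (\<theta> y - \<phi> x) \<partial>lebesgue_on B) \<partial>lebesgue_on A)
      = 2 * nonlocal_form M k1 z h"
    unfolding double[OF A B] nonlocal_form_def k1_def
    unfolding integral_mult_right_zero[symmetric]
    by (intro Bochner_Integration.integral_cong refl)
      (auto simp: indicator_def z(2,3) h(2,3))
  have "nonlocal_form M (coupling_kernel J G A B) z h
      = nonlocal_form M (\<lambda>x y. 1/2 * (indicator B x * indicator B y * G (x - y))) z h
        + (nonlocal_form M k1 z h + nonlocal_form M k2 z h)"
    unfolding coupling_kernel_def[abs_def] k1_def[symmetric] k2_def[symmetric]
    using nonlocal_form_add_kernel[OF bk(3) bounded_kernel_add[OF bk(1,2)] sq]
      nonlocal_form_add_kernel[OF bk(1,2) sq] by (simp add: k1_def k2_def)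
  then show ?thesis
    unfolding energy_form_def GG JJ swap by simp
qed

text \<open>Test the weak formulation with the error \<open>h\<close> itself. The gradient of the error is the
  gradient of \<open>u\<close>, so the local term is the integral of \<open>|Du|\<^sup>2\<close> and may be dropped. In the nonlocal
  term, moving the contribution of the corrector to the right-hand side and integrating it by parts
  leaves the residual of the corrector, tested with \<open>h\<close>.\<close>

lemma weak_solution_error_energy:
  fixes \<Omega> A :: "(real^'n) set" and p q u v :: "real^'n \<Rightarrow> real"
  defines "M \<equiv> lebesgue_on \<Omega>" and "B \<equiv> \<Omega> - A"
    and "w \<equiv> \<lambda>x. if x \<in> A then p x else q x"
    and "h \<equiv> \<lambda>x. if x \<in> A then u x - p x else v x - q x"
  assumes \<Omega>: "\<Omega> \<in> lmeasurable" and A: "A \<subseteq> \<Omega>" "A \<in> sets lebesgue" "negligible (A - interior A)"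
    and J: "interaction_kernel J" and G: "interaction_kernel G"
    and sol: "weak_solution J G A B F u v" and F: "L2_on \<Omega> F"
    and w: "L2_on \<Omega> w" "(\<integral>x. w x \<partial>M) = 0"
    and grad: "\<And>Du. H1_gradient (interior A) u Du \<Longrightarrow> H1_gradient (interior A) (\<lambda>x. u x - p x) Du"
  shows "L2_on \<Omega> h" and "(\<integral>x. h x \<partial>M) = 0"
    and "nonlocal_form M (coupling_kernel J G A B) h h
      \<le> - (\<integral>x. h x * (F x - 2 * (\<integral>y. coupling_kernel J G A B x y * (w y - w x) \<partial>M)) \<partial>M)"
proof -
  interpret finite_measure M unfolding M_def using \<Omega> by (rule finite_measure_lebesgue_on)
  let ?K = "coupling_kernel J G A B"
  have \<Omega>s: "\<Omega> \<in> sets lebesgue" using \<Omega> by auto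
  have B: "B \<subseteq> \<Omega>" "B \<in> sets lebesgue" using A \<Omega>s by (auto simp: B_def)
  have AM: "A \<in> sets M" and BM: "B \<in> sets M"
    using A B \<Omega>s by (auto simp: M_def sets_restrict_space_iff)
  have bk: "bounded_kernel M ?K"
    using J G AM BM unfolding M_def by (rule bounded_kernel_coupling)
  have W: "(u, v) \<in> W_space A B" using sol by (simp add: weak_solution_def)
  then obtain Du where Du: "H1_gradient (interior A) u Du"
    by (auto simp: W_space_def H1_def)
  then have uL2: "L2_on A u"
    by (intro L2_on_negligible_diff[OF _ interior_subset A(3) A(2)]) (auto simp: H1_gradient_def)
  have vL2: "L2_on B v" using W by (simp add: W_space_def)
  define z where "z = (\<lambda>x. if x \<in> A then u x else v x)"
  have zL2: "L2_on \<Omega> z"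
    unfolding z_def using L2_on_glue[OF A(1,2) \<Omega>s uL2] vL2 by (simp add: B_def)
  have h_eq: "h = (\<lambda>x. z x - w x)" by (auto simp: h_def z_def w_def)
  have sq: "square_integrable M z" "square_integrable M w" "square_integrable M F"
    using zL2 w(1) F by (auto simp: M_def L2_on_iff_square_integrable)
  have hsq: "square_integrable M h" unfolding h_eq by (rule square_integrable_diff[OF sq(1,2)])
  then show hL2: "L2_on \<Omega> h" by (simp add: M_def L2_on_iff_square_integrable)
  note glue = integral_glue[OF A(1,2) \<Omega>s, folded B_def M_def]
  have "(\<integral>x. z x \<partial>M) = 0"
    using glue[OF square_integrable_imp_integrable[OF sq(1)], of u v] W
    by (simp add: W_space_def z_def B_def)
  then show h0: "(\<integral>x. h x \<partial>M) = 0"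
    using w(2) square_integrable_imp_integrable[OF sq(1)] square_integrable_imp_integrable[OF sq(2)]
    unfolding h_eq by simp
  let ?\<phi> = "\<lambda>x. u x - p x" and ?\<theta> = "\<lambda>x. v x - q x"
  have D\<phi>: "H1_gradient (interior A) ?\<phi> Du" using Du by (rule grad)
  have "(?\<phi>, ?\<theta>) \<in> W_space A B"
  proof -
    have "L2_on B h" by (rule L2_on_subset[OF hL2 B \<Omega>s])
    then have "L2_on B ?\<theta>" by (rule iffD1[OF L2_on_cong, rotated]) (auto simp: h_def B_def)
    moreover have "?\<phi> \<in> H1 (interior A)" using D\<phi> by (auto simp: H1_def)
    moreover have "(\<integral>x. ?\<phi> x \<partial>lebesgue_on A) + (\<integral>x. ?\<theta> x \<partial>lebesgue_on B) = 0"
      using glue[OF square_integrable_imp_integrable[OF hsq], of ?\<phi> ?\<theta>] h0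
      by (simp add: h_def B_def)
    ultimately show ?thesis by (simp add: W_space_def)
  qed
  then have weak: "energy_form J G A B u Du v ?\<phi> Du ?\<theta>
      = - (\<integral>x. F x * ?\<phi> x \<partial>lebesgue_on A) - (\<integral>x. F x * ?\<theta> x \<partial>lebesgue_on B)"
    using sol Du D\<phi> unfolding weak_solution_def by blast
  have "energy_form J G A B u Du v ?\<phi> Du ?\<theta>
      = (\<integral>x. Du x \<bullet> Du x \<partial>lebesgue_on A) + nonlocal_form M ?K z h"
    unfolding B_def M_def
    by (rule energy_form_eq_nonlocal_form[OF \<Omega> A(1,2) J G zL2 _ _ hL2]) (auto simp: z_def h_def)
  moreover have "0 \<le> (\<integral>x. Du x \<bullet> Du x \<partial>lebesgue_on A)"
    by (intro Bochner_Integration.integral_nonneg) simp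
  moreover have iF: "integrable M (\<lambda>x. h x * F x)"
    by (rule integrable_mult_square_integrable[OF hsq sq(3)])
  have "(\<integral>x. F x * ?\<phi> x \<partial>lebesgue_on A) + (\<integral>x. F x * ?\<theta> x \<partial>lebesgue_on B) = (\<integral>x. h x * F x \<partial>M)"
    by (rule glue[OF iF]) (auto simp: h_def B_def)
  ultimately have 1: "nonlocal_form M ?K z h \<le> - (\<integral>x. h x * F x \<partial>M)"
    using weak by linarith
  let ?a = "\<lambda>x. \<integral>y. ?K x y * (w y - w x) \<partial>M"
  have "square_integrable M ?a"
    using square_integrable_kernel_average[OF bk sq(2) sq(2), of "\<lambda>_. 1"] by simp
  then have ia: "integrable M (\<lambda>x. h x * ?a x)"
    by (rule integrable_mult_square_integrable[OF hsq])
  have "nonlocal_form M ?K h h = nonlocal_form M ?K z h - nonlocal_form M ?K w h"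
    using nonlocal_form_diff[OF bk sq(1,2) hsq] unfolding h_eq .
  moreover have "nonlocal_form M ?K w h = - 2 * (\<integral>x. h x * ?a x \<partial>M)"
    by (rule nonlocal_form_by_parts[OF bk sq(2) hsq coupling_kernel_sym[OF J G]])
  moreover have "(\<integral>x. h x * (F x - 2 * ?a x) \<partial>M) = (\<integral>x. h x * F x - 2 * (h x * ?a x) \<partial>M)"
    by (rule Bochner_Integration.integral_cong) (auto simp: algebra_simps)
  moreover have "\<dots> = (\<integral>x. h x * F x \<partial>M) - 2 * (\<integral>x. h x * ?a x \<partial>M)"
    using iF ia by simp
  ultimately show "nonlocal_form M ?K h h \<le> - (\<integral>x. h x * (F x - 2 * ?a x) \<partial>M)"
    using 1 by linarith
qed

section \<open>The corrector almost solves the coupled problem\<close>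

text \<open>Young's inequality \<open>- C h R \<le> h\<^sup>2 / 2 + C\<^sup>2 R\<^sup>2 / 2\<close>; the first term on the right is
  absorbed into the left-hand side.\<close>

lemma (in finite_measure) square_norm_le_of_energy:
  assumes h: "square_integrable M h" and R: "square_integrable M R" and C: "C \<ge> 0"
    and hE: "(\<integral>x. (h x)\<^sup>2 \<partial>M) \<le> C * E" and E: "E \<le> - (\<integral>x. h x * R x \<partial>M)"
  shows "(\<integral>x. (h x)\<^sup>2 \<partial>M) \<le> C\<^sup>2 * (\<integral>x. (R x)\<^sup>2 \<partial>M)"
proof -
  have i: "integrable M (\<lambda>x. (h x)\<^sup>2)" "integrable M (\<lambda>x. (R x)\<^sup>2)" "integrable M (\<lambda>x. h x * R x)"
    using h R integrable_mult_square_integrable by (auto simp: square_integrable_def)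
  have "(\<integral>x. (h x)\<^sup>2 \<partial>M) \<le> C * (- (\<integral>x. h x * R x \<partial>M))"
    using hE mult_left_mono[OF E C] by linarith
  also have "\<dots> = (\<integral>x. - C * (h x * R x) \<partial>M)"
    by simp
  also have "\<dots> \<le> (\<integral>x. 1/2 * (h x)\<^sup>2 + C\<^sup>2 / 2 * (R x)\<^sup>2 \<partial>M)"
  proof (rule integral_mono)
    fix x
    have "0 \<le> (h x + C * R x)\<^sup>2" by simp
    also have "\<dots> = (h x)\<^sup>2 + C\<^sup>2 * (R x)\<^sup>2 + 2 * (C * (h x * R x))"
      by (simp add: power2_eq_square algebra_simps)
    finally show "- C * (h x * R x) \<le> 1/2 * (h x)\<^sup>2 + C\<^sup>2 / 2 * (R x)\<^sup>2"
      by (simp add: algebra_simps)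
  qed (use i in auto)
  also have "\<dots> = 1/2 * (\<integral>x. (h x)\<^sup>2 \<partial>M) + C\<^sup>2 / 2 * (\<integral>x. (R x)\<^sup>2 \<partial>M)"
    using i by simp
  finally show ?thesis by simp
qed

text \<open>The majorant is the supremum of \<open>|s n x|\<close> over \<open>S n\<close>, replaced by 0 for those finitely many
  \<open>n\<close> for which it may be infinite.\<close>

lemma uniform_majorant:
  fixes s :: "nat \<Rightarrow> 'a \<Rightarrow> real"
  assumes "\<And>\<epsilon>. \<epsilon> > 0 \<Longrightarrow> \<forall>\<^sub>F n in sequentially. \<forall>x\<in>S n. \<bar>s n x\<bar> \<le> \<epsilon>"
  obtains \<delta> where "\<delta> \<longlonglongrightarrow> 0" "\<And>n. \<delta> n \<ge> 0" "\<forall>\<^sub>F n in sequentially. \<forall>x\<in>S n. \<bar>s n x\<bar> \<le> \<delta> n"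
proof -
  define V where "V n = insert 0 ((\<lambda>x. \<bar>s n x\<bar>) ` S n)" for n
  define \<delta> where "\<delta> n = (if bdd_above (V n) then Sup (V n) else 0)" for n
  have nonneg: "\<delta> n \<ge> 0" for n
    unfolding \<delta>_def V_def by (auto intro: cSup_upper)
  have le: "\<forall>x\<in>S n. \<bar>s n x\<bar> \<le> \<delta> n" if "\<forall>x\<in>S n. \<bar>s n x\<bar> \<le> 1" for n
  proof -
    have "bdd_above (V n)" unfolding V_def using that by (auto intro!: bdd_aboveI2)
    then show ?thesis unfolding \<delta>_def by (auto simp: V_def intro!: cSup_upper)
  qed
  have up: "\<delta> n \<le> \<epsilon>" if "\<forall>x\<in>S n. \<bar>s n x\<bar> \<le> \<epsilon>" "\<epsilon> > 0" for n \<epsilon>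
  proof -
    have "Sup (V n) \<le> \<epsilon>" by (rule cSup_least) (use that in \<open>auto simp: V_def\<close>)
    then show ?thesis using that(2) by (simp add: \<delta>_def)
  qed
  have "\<delta> \<longlonglongrightarrow> 0"
    unfolding tendsto_iff
  proof (intro allI impI)
    fix e :: real assume e: "e > 0"
    then have "\<forall>\<^sub>F n in sequentially. \<forall>x\<in>S n. \<bar>s n x\<bar> \<le> e / 2" by (intro assms) simp
    then show "\<forall>\<^sub>F n in sequentially. dist (\<delta> n) 0 < e"
    proof eventually_elim
      case (elim n)
      then have "\<delta> n \<le> e / 2" using e by (intro up) auto
      then show ?case using nonneg[of n] e by (simp add: dist_real_def)
    qed
  qed
  moreover have "\<forall>\<^sub>F n in sequentially. \<forall>x\<in>S n. \<bar>s n x\<bar> \<le> \<delta> n"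
    using assms[OF zero_less_one] by (rule eventually_mono) (use le in auto)
  ultimately show thesis using that nonneg by blast
qed

locale homogenization =
  fixes \<Omega> :: "(real^'n) set" and J G :: "real^'n \<Rightarrow> real" and X :: real
    and f u v :: "real^'n \<Rightarrow> real" and A B :: "nat \<Rightarrow> (real^'n) set"
  assumes \<Omega>: "\<Omega> \<in> lmeasurable"
    and J: "interaction_kernel J" and G: "interaction_kernel G"
    and X: "0 < X" "X < 1"
    and A: "\<And>n. A n \<in> sets lebesgue" "\<And>n. A n \<subseteq> \<Omega>" and B_def: "\<And>n. B n = \<Omega> - A n"
    and weak: "weak_star_Linfty \<Omega> (\<lambda>n. indicator (A n)) (\<lambda>x. X)"
    and f: "L2_on \<Omega> f" and u: "L2_on \<Omega> u" and v: "L2_on \<Omega> v"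
    and lim: "limit_solution J G \<Omega> X f u v"
begin

abbreviation M where "M \<equiv> lebesgue_on \<Omega>"
definition U where "U x = u x / X"
definition V where "V x = v x / (1 - X)"
text \<open>The corrector before averaging over the holes and before the mean is corrected.\<close>

definition w0 where "w0 n x = (if x \<in> A n then U x else V x)"

sublocale finite_measure M using \<Omega> by (rule finite_measure_lebesgue_on)

lemma AM: "A n \<in> sets M" and BM: "B n \<in> sets M"
  using A \<Omega> by (auto simp: B_def sets_restrict_space_iff)

lemma sq: "square_integrable M f" "square_integrable M u" "square_integrable M v"
    "square_integrable M U" "square_integrable M V"
  using f u v square_integrable_cmult[of M u "1 / X"] square_integrable_cmult[of M v "1 / (1 - X)"]
  by (auto simp: L2_on_iff_square_integrable U_def[abs_def] V_def[abs_def])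

lemma sq_w0: "square_integrable M (w0 n)"
proof -
  have "L2_on \<Omega> (w0 n)" unfolding w0_def
  proof (rule L2_on_glue)
    show "L2_on (A n) U" "L2_on (\<Omega> - A n) V"
      using sq(4,5) A \<Omega> by (auto intro!: L2_on_subset[of \<Omega>] simp: L2_on_iff_square_integrable[symmetric])
  qed (use A \<Omega> in auto)
  then show ?thesis by (simp add: L2_on_iff_square_integrable)
qed

lemma weak_A: "integrable M g \<Longrightarrow> (\<lambda>n. \<integral>x. (indicator (A n) x - X) * g x \<partial>M) \<longlonglongrightarrow> 0"
proof -
  assume g: "integrable M g"
  have "(\<lambda>n. (\<integral>x. indicator (A n) x * g x \<partial>M) - (\<integral>x. X * g x \<partial>M)) \<longlonglongrightarrow> 0"
    using weak g unfolding weak_star_Linfty_def by (intro LIM_zero) blast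
  moreover have "(\<integral>x. indicator (A n) x * g x \<partial>M) - (\<integral>x. X * g x \<partial>M)
      = (\<integral>x. (indicator (A n) x - X) * g x \<partial>M)" for n
  proof -
    have "integrable M (\<lambda>x. indicator (A n) x * g x)"
      using integrable_real_mult_indicator[OF AM g] by (simp add: mult.commute)
    then show ?thesis using g by (simp add: left_diff_distrib)
  qed
  ultimately show ?thesis by simp
qed

lemma weak_B: "integrable M g \<Longrightarrow> (\<lambda>n. \<integral>x. (indicator (B n) x - (1 - X)) * g x \<partial>M) \<longlonglongrightarrow> 0"
proof -
  assume g: "integrable M g"
  have "(\<integral>x. (indicator (B n) x - (1 - X)) * g x \<partial>M) = (\<integral>x. - ((indicator (A n) x - X) * g x) \<partial>M)" for n
    by (rule Bochner_Integration.integral_cong) (auto simp: B_def indicator_def algebra_simps)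
  then show ?thesis using tendsto_minus[OF weak_A[OF g]] by simp
qed

lemma measure_A: "(\<lambda>n. measure lebesgue (A n)) \<longlonglongrightarrow> X * measure lebesgue \<Omega>"
proof -
  have 1: "(\<lambda>n. (\<integral>x. (indicator (A n) x - X) * 1 \<partial>M) + X * measure lebesgue \<Omega>)
      \<longlonglongrightarrow> 0 + X * measure lebesgue \<Omega>"
    by (intro tendsto_add weak_A tendsto_const) simp
  have "(\<integral>x. (indicator (A n) x - X) * 1 \<partial>M) + X * measure lebesgue \<Omega> = measure lebesgue (A n)" for n
  proof -
    have "measure M (A n) = measure lebesgue (A n)" "measure M \<Omega> = measure lebesgue \<Omega>"
      using A \<Omega> by (auto simp: measure_restrict_space)
    moreover have "A n \<inter> \<Omega> = A n" using A by auto
    ultimately show ?thesis using AM[of n] by simp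
  qed
  with 1 show ?thesis by simp
qed

lemma measure_B: "measure lebesgue (B n) = measure lebesgue \<Omega> - measure lebesgue (A n)"
  unfolding B_def using A \<Omega> by (intro measurable_measure_Diff) auto

text \<open>In the weak limit the profile has density \<open>X U + (1 - X) V = u + v\<close>, whose integral is
  prescribed to be 0.\<close>

lemma integral_w0: "(\<lambda>n. \<integral>x. w0 n x \<partial>M) \<longlonglongrightarrow> 0"
proof -
  have i: "integrable M U" "integrable M V" "integrable M u" "integrable M v"
    using sq by (auto intro: square_integrable_imp_integrable)
  have "(\<integral>x. w0 n x \<partial>M) = (\<integral>x. (indicator (A n) x - X) * (U x - V x) \<partial>M)" for n
  proof -
    have "(\<integral>x. w0 n x \<partial>M) = (\<integral>x. (indicator (A n) x - X) * (U x - V x) + (X * U x + (1 - X) * V x) \<partial>M)"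
      by (rule Bochner_Integration.integral_cong) (auto simp: w0_def indicator_def algebra_simps)
    also have "\<dots> = (\<integral>x. (indicator (A n) x - X) * (U x - V x) \<partial>M) + (\<integral>x. X * U x + (1 - X) * V x \<partial>M)"
    proof (rule Bochner_Integration.integral_add)
      have "square_integrable M (\<lambda>x. (indicator (A n) x - X) * (U x - V x))"
        by (rule square_integrable_bounded_mult[where K = 1])
          (use AM X sq in \<open>auto intro!: square_integrable_diff simp: indicator_def\<close>)
      then show "integrable M (\<lambda>x. (indicator (A n) x - X) * (U x - V x))"
        by (rule square_integrable_imp_integrable)
    qed (use i in simp)
    also have "(\<integral>x. X * U x + (1 - X) * V x \<partial>M) = (\<integral>x. u x + v x \<partial>M)"
      using X by (intro Bochner_Integration.integral_cong) (auto simp: U_def V_def)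
    also have "\<dots> = 0" using i lim by (simp add: limit_solution_def)
    finally show ?thesis by simp
  qed
  then show ?thesis using weak_A[of "\<lambda>x. U x - V x"] i by simp
qed

text \<open>The errors \<open>osc1\<close>, \<open>osc2\<close>, \<open>osc3\<close> arise when, in the nonlocal operators applied to \<open>w0\<close>, the
  indicators of \<open>B n\<close> and \<open>A n\<close> are replaced by their weak limits \<open>1 - X\<close> and \<open>X\<close>.\<close>

definition osc1 where "osc1 n x = (\<integral>y. (indicator (B n) y - (1 - X)) * (J (x - y) * (V y - U x)) \<partial>M)"
definition osc2 where "osc2 n x = (\<integral>y. (indicator (B n) y - (1 - X)) * (G (x - y) * (V y - V x)) \<partial>M)"
definition osc3 where "osc3 n x = (\<integral>y. (indicator (A n) y - X) * (J (x - y) * (U y - V x)) \<partial>M)"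

lemma osc_tendsto_0:
  "(\<lambda>n. \<integral>x. (osc1 n x)\<^sup>2 \<partial>M) \<longlonglongrightarrow> 0" "(\<lambda>n. \<integral>x. (osc2 n x)\<^sup>2 \<partial>M) \<longlonglongrightarrow> 0"
  "(\<lambda>n. \<integral>x. (osc3 n x)\<^sup>2 \<partial>M) \<longlonglongrightarrow> 0"
proof -
  note k = bounded_kernel_interaction[OF J, of \<Omega>] bounded_kernel_interaction[OF G, of \<Omega>]
  have c: "(\<lambda>y. indicator (A n) y - X) \<in> borel_measurable M"
    "(\<lambda>y. indicator (B n) y - (1 - X)) \<in> borel_measurable M"
    "\<bar>indicator (A n) y - X\<bar> \<le> 1" "\<bar>indicator (B n) y - (1 - X)\<bar> \<le> 1" for n and y :: "real^'n"
    using AM BM X by (auto simp: indicator_def)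
  show "(\<lambda>n. \<integral>x. (osc1 n x)\<^sup>2 \<partial>M) \<longlonglongrightarrow> 0"
    unfolding osc1_def by (rule oscillating_average_tendsto_0[OF k(1) sq(5,4) c(2,4) weak_B])
  show "(\<lambda>n. \<integral>x. (osc2 n x)\<^sup>2 \<partial>M) \<longlonglongrightarrow> 0"
    unfolding osc2_def by (rule oscillating_average_tendsto_0[OF k(2) sq(5,5) c(2,4) weak_B])
  show "(\<lambda>n. \<integral>x. (osc3 n x)\<^sup>2 \<partial>M) \<longlonglongrightarrow> 0"
    unfolding osc3_def by (rule oscillating_average_tendsto_0[OF k(1) sq(4,5) c(1,3) weak_A])
qed

lemma sq_osc: "square_integrable M (osc1 n)" "square_integrable M (osc2 n)" "square_integrable M (osc3 n)"
proof -
  note k = bounded_kernel_interaction[OF J, of \<Omega>] bounded_kernel_interaction[OF G, of \<Omega>]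
  have c: "(\<lambda>y. indicator (A n) y - X) \<in> borel_measurable M"
    "(\<lambda>y. indicator (B n) y - (1 - X)) \<in> borel_measurable M"
    "\<bar>indicator (A n) y - X\<bar> \<le> 1" "\<bar>indicator (B n) y - (1 - X)\<bar> \<le> 1" for y :: "real^'n"
    using AM BM X by (auto simp: indicator_def)
  show "square_integrable M (osc1 n)" "square_integrable M (osc2 n)" "square_integrable M (osc3 n)"
    unfolding osc1_def[abs_def] osc2_def[abs_def] osc3_def[abs_def]
    by (intro square_integrable_kernel_average k sq c)+
qed

abbreviation K where "K n \<equiv> coupling_kernel J G (A n) (B n)"

lemma bounded_kernel_K: "bounded_kernel M (K n)"
  using J G AM BM by (rule bounded_kernel_coupling)

text \<open>Up to the oscillation errors, the nonlocal operator applied to \<open>w0\<close> is the right-hand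
  side of the first limit equation divided by \<open>X\<close> on \<open>A n\<close>, and that of the second one divided by
  \<open>1 - X\<close> on \<open>B n\<close>. Both quotients are equal to \<open>f\<close>.\<close>

lemma coupling_average_limit:
  "AE x in M. 2 * (\<integral>y. K n x y * (w0 n y - w0 n x) \<partial>M)
     = f x + (if x \<in> A n then osc1 n x else osc2 n x + osc3 n x)"
proof -
  note k = bounded_kernel_interaction[OF J, of \<Omega>] bounded_kernel_interaction[OF G, of \<Omega>]
  have split_average: "(\<integral>y. indicator S y * F y \<partial>M)
      = (\<integral>y. (indicator S y - c) * F y \<partial>M) + c * (\<integral>y. F y \<partial>M)"
    if "S \<in> sets M" "integrable M F" for S c and F :: "real^'n \<Rightarrow> real"
  proof -
    have "integrable M (\<lambda>y. indicator S y * F y)"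
      using integrable_real_mult_indicator[OF that] by (simp add: mult.commute)
    then show ?thesis using that(2) by (simp add: left_diff_distrib)
  qed
  have "AE x in M. f x * X = (\<integral>y. J (x - y) * (X * v y - (1 - X) * u x) \<partial>M)"
    "AE x in M. f x * (1 - X) = (\<integral>y. G (x - y) * ((1 - X) * v y - (1 - X) * v x) \<partial>M)
                      + (\<integral>y. J (x - y) * ((1 - X) * u y - X * v x) \<partial>M)"
    using lim by (auto simp: limit_solution_def)
  with AE_space show ?thesis
  proof eventually_elim
    case (elim x)
    then have x: "x \<in> space M" by simp
    note iJ = integrable_kernel_section[OF k(1) _ x] and iG = integrable_kernel_section[OF k(2) _ x]
    show ?case
    proof (cases "x \<in> A n")
      case True
      have "2 * (\<integral>y. K n x y * (w0 n y - w0 n x) \<partial>M) = (\<integral>y. 2 * (K n x y * (w0 n y - w0 n x)) \<partial>M)"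
        by simp
      also have "\<dots> = (\<integral>y. indicator (B n) y * (J (x - y) * (V y - U x)) \<partial>M)"
        using True by (intro Bochner_Integration.integral_cong)
          (auto simp: coupling_kernel_def w0_def B_def indicator_def)
      also have "\<dots> = osc1 n x + (1 - X) * (\<integral>y. J (x - y) * (V y - U x) \<partial>M)"
        unfolding osc1_def by (rule split_average[OF BM iJ[OF sq(5)]])
      also have "(\<integral>y. J (x - y) * (V y - U x) \<partial>M)
          = (\<integral>y. 1 / (X * (1 - X)) * (J (x - y) * (X * v y - (1 - X) * u x)) \<partial>M)"
        using X by (intro Bochner_Integration.integral_cong) (auto simp: U_def V_def field_simps)
      also have "\<dots> = 1 / (X * (1 - X)) * (f x * X)"
        unfolding elim(2) by simp
      finally show ?thesis using True X by simp
    next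
      case False
      have "2 * (\<integral>y. K n x y * (w0 n y - w0 n x) \<partial>M) = (\<integral>y. 2 * (K n x y * (w0 n y - w0 n x)) \<partial>M)"
        by simp
      also have "\<dots> = (\<integral>y. indicator (B n) y * (G (x - y) * (V y - V x))
                          + indicator (A n) y * (J (x - y) * (U y - V x)) \<partial>M)"
        using False x by (intro Bochner_Integration.integral_cong)
          (auto simp: coupling_kernel_def w0_def B_def indicator_def)
      also have "\<dots> = (\<integral>y. indicator (B n) y * (G (x - y) * (V y - V x)) \<partial>M)
                     + (\<integral>y. indicator (A n) y * (J (x - y) * (U y - V x)) \<partial>M)"
        using integrable_real_mult_indicator[OF BM iG[OF sq(5)]]
          integrable_real_mult_indicator[OF AM iJ[OF sq(4)]]
        by (intro Bochner_Integration.integral_add) (simp_all add: mult.commute)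
      also have "\<dots> = (osc2 n x + (1 - X) * (\<integral>y. G (x - y) * (V y - V x) \<partial>M))
                     + (osc3 n x + X * (\<integral>y. J (x - y) * (U y - V x) \<partial>M))"
        unfolding osc2_def osc3_def
        using split_average[OF BM iG[OF sq(5)]] split_average[OF AM iJ[OF sq(4)]] by simp
      also have "(\<integral>y. G (x - y) * (V y - V x) \<partial>M)
          = (\<integral>y. 1 / (1 - X)\<^sup>2 * (G (x - y) * ((1 - X) * v y - (1 - X) * v x)) \<partial>M)"
        using X by (intro Bochner_Integration.integral_cong)
          (auto simp: V_def field_simps power2_eq_square)
      also have "\<dots> = 1 / (1 - X)\<^sup>2 * (\<integral>y. G (x - y) * ((1 - X) * v y - (1 - X) * v x) \<partial>M)" by simp
      also have "(\<integral>y. J (x - y) * (U y - V x) \<partial>M)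
          = (\<integral>y. 1 / (X * (1 - X)) * (J (x - y) * ((1 - X) * u y - X * v x)) \<partial>M)"
        using X by (intro Bochner_Integration.integral_cong) (auto simp: U_def V_def field_simps)
      also have "\<dots> = 1 / (X * (1 - X)) * (\<integral>y. J (x - y) * ((1 - X) * u y - X * v x) \<partial>M)" by simp
      finally have eq: "2 * (\<integral>y. K n x y * (w0 n y - w0 n x) \<partial>M)
          = osc2 n x + osc3 n x
            + ((1 - X) * (1 / (1 - X)\<^sup>2 * (\<integral>y. G (x - y) * ((1 - X) * v y - (1 - X) * v x) \<partial>M))
              + X * (1 / (X * (1 - X)) * (\<integral>y. J (x - y) * ((1 - X) * u y - X * v x) \<partial>M)))"
        by simp
      have "Y * (1 / Y\<^sup>2 * a) + X * (1 / (X * Y) * b) = (a + b) / Y" if "Y \<noteq> 0" for a b Y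
        using X that by (simp add: power2_eq_square add_divide_distrib)
      from this[of "1 - X"] have "2 * (\<integral>y. K n x y * (w0 n y - w0 n x) \<partial>M)
          = osc2 n x + osc3 n x + f x * (1 - X) / (1 - X)"
        unfolding eq using elim(3) X by simp
      then show ?thesis using False X by simp
    qed
  qed
qed

text \<open>The residual is the sum of the error in the source, the oscillation errors, and the effect
  of replacing \<open>w0\<close> by \<open>w\<close>, which is at most a constant times \<open>\<delta> n\<close>.\<close>

lemma residual_tendsto_0:
  fixes F :: "nat \<Rightarrow> real^'n \<Rightarrow> real" and w :: "nat \<Rightarrow> real^'n \<Rightarrow> real"
  defines "R \<equiv> \<lambda>n x. F n x - 2 * (\<integral>y. K n x y * (w n y - w n x) \<partial>M)"
  assumes F: "\<forall>\<^sub>F n in sequentially. L2_on \<Omega> (F n)" "(\<lambda>n. L2_norm_on \<Omega> (\<lambda>x. F n x - f x)) \<longlonglongrightarrow> 0"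
    and w: "\<forall>\<^sub>F n in sequentially. L2_on \<Omega> (w n)"
      "\<forall>\<^sub>F n in sequentially. \<forall>x\<in>\<Omega>. \<bar>w n x - w0 n x\<bar> \<le> \<delta> n" and \<delta>: "\<delta> \<longlonglongrightarrow> 0"
  shows "\<forall>\<^sub>F n in sequentially. square_integrable M (R n)"
    and "(\<lambda>n. \<integral>x. (R n x)\<^sup>2 \<partial>M) \<longlonglongrightarrow> 0"
proof -
  obtain jb where jb: "\<And>z. \<bar>J z\<bar> \<le> jb"
    using interaction_kernel_bounded[OF J] by (auto simp: bounded_iff)
  obtain gb where gb: "\<And>z. \<bar>G z\<bar> \<le> gb"
    using interaction_kernel_bounded[OF G] by (auto simp: bounded_iff)
  define \<kappa> where "\<kappa> = jb + gb"
  have jg0: "jb \<ge> 0" "gb \<ge> 0" using jb[of 0] gb[of 0] by auto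
  have K_le: "\<bar>K n x y\<bar> \<le> \<kappa>" for n x y
    using jb[of "x - y"] gb[of "x - y"] jg0
    by (auto simp: coupling_kernel_def indicator_def \<kappa>_def B_def)
  have \<kappa>0: "\<kappa> \<ge> 0" using jg0 by (simp add: \<kappa>_def)
  \<comment> \<open>One factor 2 stands in front of the average in \<open>R\<close>, the other comes from
      \<open>\<bar>s y - s x\<bar> \<le> 2 * \<delta> n\<close>.\<close>
  define c where "c = 4 * \<kappa> * measure M (space M)"
  have R_sq: "square_integrable M (R n)" if "L2_on \<Omega> (F n)" "L2_on \<Omega> (w n)" for n
  proof -
    have "square_integrable M (\<lambda>x. \<integral>y. K n x y * (w n y - w n x) \<partial>M)"
      using square_integrable_kernel_average[OF bounded_kernel_K, of "w n" "w n" "\<lambda>_. 1"] that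
      by (simp add: L2_on_iff_square_integrable)
    then show ?thesis
      unfolding R_def using that
      by (intro square_integrable_diff square_integrable_cmult) (auto simp: L2_on_iff_square_integrable)
  qed
  show "\<forall>\<^sub>F n in sequentially. square_integrable M (R n)"
    using F(1) w(1) by eventually_elim (rule R_sq)
  define T where "T n = 5 * ((\<integral>x. (F n x - f x)\<^sup>2 \<partial>M) + (\<integral>x. (osc1 n x)\<^sup>2 \<partial>M)
      + (\<integral>x. (osc2 n x)\<^sup>2 \<partial>M) + (\<integral>x. (osc3 n x)\<^sup>2 \<partial>M) + (c * \<delta> n)\<^sup>2 * measure M (space M))" for n
  have bound: "(\<integral>x. (R n x)\<^sup>2 \<partial>M) \<le> T n"
    if Fn: "L2_on \<Omega> (F n)" and wn: "L2_on \<Omega> (w n)" and d: "\<forall>x\<in>\<Omega>. \<bar>w n x - w0 n x\<bar> \<le> \<delta> n" for n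
  proof -
    define s where "s x = w n x - w0 n x" for x
    have s_sq: "square_integrable M s"
      unfolding s_def using wn sq_w0 by (intro square_integrable_diff) (auto simp: L2_on_iff_square_integrable)
    define S where "S x = 2 * (\<integral>y. K n x y * (s y - s x) \<partial>M)" for x
    have S_le: "\<bar>S x\<bar> \<le> c * \<delta> n" if x: "x \<in> space M" for x
    proof -
      have "\<bar>\<integral>y. K n x y * (s y - s x) \<partial>M\<bar> \<le> (\<integral>y. \<kappa> * (2 * \<delta> n) \<partial>M)"
      proof (rule order_trans[OF integral_abs_bound], rule integral_mono)
        show "integrable M (\<lambda>y. \<bar>K n x y * (s y - s x)\<bar>)"
          using integrable_kernel_section[OF bounded_kernel_K s_sq x] by (rule integrable_abs)
        fix y assume y: "y \<in> space M"
        have "\<bar>s x\<bar> \<le> \<delta> n" "\<bar>s y\<bar> \<le> \<delta> n" using d x y by (auto simp: s_def)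
        then have "\<bar>s y - s x\<bar> \<le> 2 * \<delta> n" by linarith
        then show "\<bar>K n x y * (s y - s x)\<bar> \<le> \<kappa> * (2 * \<delta> n)"
          unfolding abs_mult using K_le \<kappa>0 by (intro mult_mono) auto
      qed simp
      then show ?thesis by (simp add: S_def c_def mult.assoc mult.commute mult.left_commute)
    qed
    have R_eq: "AE x in M. R n x = (F n x - f x) - (if x \<in> A n then osc1 n x else osc2 n x + osc3 n x) - S x"
      using coupling_average_limit[of n] AE_space
    proof eventually_elim
      case (elim x)
      have "(\<integral>y. K n x y * (w n y - w n x) \<partial>M)
          = (\<integral>y. K n x y * (w0 n y - w0 n x) + K n x y * (s y - s x) \<partial>M)"
        by (rule Bochner_Integration.integral_cong) (auto simp: s_def algebra_simps)
      also have "\<dots> = (\<integral>y. K n x y * (w0 n y - w0 n x) \<partial>M) + (\<integral>y. K n x y * (s y - s x) \<partial>M)"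
        by (intro Bochner_Integration.integral_add integrable_kernel_section[OF bounded_kernel_K]
          sq_w0 s_sq elim(2))
      finally show ?case using elim(1) by (simp add: R_def S_def)
    qed
    have five: "(a + b + c + d + e)\<^sup>2 \<le> 5 * (a\<^sup>2 + b\<^sup>2 + c\<^sup>2 + d\<^sup>2 + e\<^sup>2)" for a b c d e :: real
    proof -
      have "5 * (a\<^sup>2 + b\<^sup>2 + c\<^sup>2 + d\<^sup>2 + e\<^sup>2) - (a + b + c + d + e)\<^sup>2
          = (a - b)\<^sup>2 + (a - c)\<^sup>2 + (a - d)\<^sup>2 + (a - e)\<^sup>2 + (b - c)\<^sup>2 + (b - d)\<^sup>2 + (b - e)\<^sup>2
            + (c - d)\<^sup>2 + (c - e)\<^sup>2 + (d - e)\<^sup>2"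
        by (simp add: power2_eq_square algebra_simps)
      also have "\<dots> \<ge> 0" by simp
      finally show ?thesis by simp
    qed
    \<comment> \<open>Only \<open>osc1\<close> contributes on \<open>A n\<close>, only \<open>osc2\<close> and \<open>osc3\<close> on \<open>B n\<close>; with \<open>five_mono\<close> one
      bound serves on both sets.\<close>
    have five_mono: "5 * (a + b1 + b2 + b3 + b4) \<le> 5 * (a + c1 + c2 + c3 + c4)"
      if "b1 \<le> c1" "b2 \<le> c2" "b3 \<le> c3" "b4 \<le> c4" for a b1 b2 b3 b4 c1 c2 c3 c4 :: real
      using that by simp
    have i: "integrable M (\<lambda>x. (F n x - f x)\<^sup>2)" "integrable M (\<lambda>x. (osc1 n x)\<^sup>2)"
      "integrable M (\<lambda>x. (osc2 n x)\<^sup>2)" "integrable M (\<lambda>x. (osc3 n x)\<^sup>2)"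
      "integrable M (\<lambda>x. (R n x)\<^sup>2)"
      using square_integrable_diff[of M "F n" f] Fn sq(1) sq_osc[of n] R_sq[OF Fn wn]
      by (auto simp: square_integrable_def L2_on_iff_square_integrable)
    have "(\<integral>x. (R n x)\<^sup>2 \<partial>M) \<le> (\<integral>x. 5 * ((F n x - f x)\<^sup>2 + (osc1 n x)\<^sup>2
        + (osc2 n x)\<^sup>2 + (osc3 n x)\<^sup>2 + (c * \<delta> n)\<^sup>2) \<partial>M)"
    proof (rule integral_mono_AE)
      show "AE x in M. (R n x)\<^sup>2 \<le> 5 * ((F n x - f x)\<^sup>2 + (osc1 n x)\<^sup>2
        + (osc2 n x)\<^sup>2 + (osc3 n x)\<^sup>2 + (c * \<delta> n)\<^sup>2)"
        using R_eq AE_space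
      proof eventually_elim
        case (elim x)
        have S2: "(S x)\<^sup>2 \<le> (c * \<delta> n)\<^sup>2"
          using power_mono[OF S_le[OF elim(2)], of 2] by simp
        show ?case
        proof (cases "x \<in> A n")
          case True
          then have "(R n x)\<^sup>2 = ((F n x - f x) + (- osc1 n x) + 0 + 0 + (- S x))\<^sup>2"
            using elim(1) by simp
          also have "\<dots> \<le> 5 * ((F n x - f x)\<^sup>2 + (- osc1 n x)\<^sup>2 + 0\<^sup>2 + 0\<^sup>2 + (- S x)\<^sup>2)"
            by (rule five)
          also have "\<dots> \<le> 5 * ((F n x - f x)\<^sup>2 + (osc1 n x)\<^sup>2
              + (osc2 n x)\<^sup>2 + (osc3 n x)\<^sup>2 + (c * \<delta> n)\<^sup>2)"
            by (rule five_mono) (use S2 in auto)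
          finally show ?thesis .
        next
          case False
          then have "R n x = (F n x - f x) + 0 + (- osc2 n x) + (- osc3 n x) + (- S x)"
            using elim(1) by auto
          then have "(R n x)\<^sup>2 = ((F n x - f x) + 0 + (- osc2 n x) + (- osc3 n x) + (- S x))\<^sup>2"
            by (rule arg_cong)
          also have "\<dots> \<le> 5 * ((F n x - f x)\<^sup>2 + 0\<^sup>2 + (- osc2 n x)\<^sup>2 + (- osc3 n x)\<^sup>2 + (- S x)\<^sup>2)"
            by (rule five)
          also have "\<dots> \<le> 5 * ((F n x - f x)\<^sup>2 + (osc1 n x)\<^sup>2
              + (osc2 n x)\<^sup>2 + (osc3 n x)\<^sup>2 + (c * \<delta> n)\<^sup>2)"
            by (rule five_mono) (use S2 in auto)
          finally show ?thesis .
        qed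
      qed
    qed (use i in auto)
    also have "\<dots> = T n" using i by (simp add: T_def mult.commute)
    finally show ?thesis .
  qed
  have "(\<lambda>n. (L2_norm_on \<Omega> (\<lambda>x. F n x - f x))\<^sup>2) \<longlonglongrightarrow> 0"
    using tendsto_power[OF F(2), of 2] by simp
  moreover have "(L2_norm_on \<Omega> (\<lambda>x. F n x - f x))\<^sup>2 = (\<integral>x. (F n x - f x)\<^sup>2 \<partial>M)" for n
    unfolding L2_norm_on_def by (intro real_sqrt_pow2 Bochner_Integration.integral_nonneg) simp
  ultimately have "(\<lambda>n. \<integral>x. (F n x - f x)\<^sup>2 \<partial>M) \<longlonglongrightarrow> 0" by simp
  then have "T \<longlonglongrightarrow> 5 * (0 + 0 + 0 + 0 + (c * 0)\<^sup>2 * measure M (space M))"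
    unfolding T_def using osc_tendsto_0 \<delta> by (intro tendsto_intros)
  then have T0: "T \<longlonglongrightarrow> 0" by simp
  show "(\<lambda>n. \<integral>x. (R n x)\<^sup>2 \<partial>M) \<longlonglongrightarrow> 0"
  proof (rule tendsto_sandwich[OF _ _ tendsto_const T0])
    show "\<forall>\<^sub>F n in sequentially. 0 \<le> (\<integral>x. (R n x)\<^sup>2 \<partial>M)"
      by (intro always_eventually allI Bochner_Integration.integral_nonneg) simp
    show "\<forall>\<^sub>F n in sequentially. (\<integral>x. (R n x)\<^sup>2 \<partial>M) \<le> T n"
      using F(1) w by eventually_elim (rule bound)
  qed
qed

text \<open>The uniform Poincare inequality bounds the square norm of the error by its energy, the
  energy is at most the pairing of the error with the residual, and the residual tends to 0. The
  constant doubles because the symmetrised kernel dominates only half of the one-sided kernel in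
  the Poincare inequality.\<close>

lemma error_tendsto_0:
  fixes F :: "nat \<Rightarrow> real^'n \<Rightarrow> real" and p q uu vv :: "nat \<Rightarrow> real^'n \<Rightarrow> real"
  defines "w \<equiv> \<lambda>n x. if x \<in> A n then p n x else q n x"
  assumes top: "open \<Omega>" "connected \<Omega>" "\<Omega> \<noteq> {}" "bounded \<Omega>"
    and F: "\<forall>\<^sub>F n in sequentially. L2_on \<Omega> (F n)" "(\<lambda>n. L2_norm_on \<Omega> (\<lambda>x. F n x - f x)) \<longlonglongrightarrow> 0"
    and w: "\<forall>\<^sub>F n in sequentially. L2_on \<Omega> (w n)" "\<forall>\<^sub>F n in sequentially. (\<integral>x. w n x \<partial>M) = 0"
      "\<forall>\<^sub>F n in sequentially. \<forall>x\<in>\<Omega>. \<bar>w n x - w0 n x\<bar> \<le> \<delta> n" and \<delta>: "\<delta> \<longlonglongrightarrow> 0"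
    and bdry: "\<forall>\<^sub>F n in sequentially. negligible (A n - interior (A n))"
    and sol: "\<forall>\<^sub>F n in sequentially. weak_solution J G (A n) (B n) (F n) (uu n) (vv n)"
    and grad: "\<forall>\<^sub>F n in sequentially. \<forall>Du. H1_gradient (interior (A n)) (uu n) Du
      \<longrightarrow> H1_gradient (interior (A n)) (\<lambda>x. uu n x - p n x) Du"
  shows "(\<lambda>n. L2_norm_on (A n) (\<lambda>x. uu n x - p n x) + L2_norm_on (B n) (\<lambda>x. vv n x - q n x)) \<longlonglongrightarrow> 0"
proof -
  define R where "R n x = F n x - 2 * (\<integral>y. K n x y * (w n y - w n x) \<partial>M)" for n x
  define h where "h n x = (if x \<in> A n then uu n x - p n x else vv n x - q n x)" for n x
  note res = residual_tendsto_0[OF F w(1,3) \<delta>, folded R_def]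
  let ?k = "\<lambda>n x y. indicator (A n) x * indicator (B n) y * J (x - y)"
  have "J 0 > 0" "continuous_on UNIV J" and J0: "\<And>z. J z \<ge> 0" and G0: "\<And>z. G z \<ge> 0"
    using interaction_kernelD[OF J] interaction_kernelD[OF G] by auto
  then obtain C where C: "C \<ge> 0" "\<forall>\<^sub>F n in sequentially. \<forall>h. L2_on \<Omega> h \<and> (\<integral>x. h x \<partial>M) = 0 \<longrightarrow>
    (\<integral>x. (h x)\<^sup>2 \<partial>M) \<le> C * nonlocal_form M (?k n) h h"
    using finely_mixed_poincare[OF top AM B_def weak X _ interaction_kernel_bounded[OF J]] by blast
  have bound: "\<forall>\<^sub>F n in sequentially. L2_norm_on (A n) (\<lambda>x. uu n x - p n x)
      + L2_norm_on (B n) (\<lambda>x. vv n x - q n x) \<le> 2 * sqrt ((2 * C)\<^sup>2 * (\<integral>x. (R n x)\<^sup>2 \<partial>M))"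
    using F(1) w(1,2) bdry sol grad res(1) C(2)
  proof eventually_elim
    case (elim n)
    note err = weak_solution_error_energy[OF \<Omega> A(2,1) elim(4) J G elim(5)[unfolded B_def] elim(1)
      elim(2,3)[unfolded w_def], folded B_def w_def h_def R_def]
    have grad_n: "\<And>Du. H1_gradient (interior (A n)) (uu n) Du
        \<Longrightarrow> H1_gradient (interior (A n)) (\<lambda>x. uu n x - p n x) Du" using elim(6) by blast
    have hL2: "L2_on \<Omega> (h n)" and h0: "(\<integral>x. h n x \<partial>M) = 0"
      and en: "nonlocal_form M (K n) (h n) (h n) \<le> - (\<integral>x. h n x * R n x \<partial>M)"
      using err[OF grad_n] unfolding h_def[abs_def] R_def w_def B_def by blast+
    have hsq: "square_integrable M (h n)" using hL2 by (simp add: L2_on_iff_square_integrable)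
    have bk: "bounded_kernel M (\<lambda>x y. 1/2 * ?k n x y)"
      by (rule bounded_kernel_cut[OF bounded_kernel_interaction[OF J] AM BM])
    have "1/2 * nonlocal_form M (?k n) (h n) (h n) = nonlocal_form M (\<lambda>x y. 1/2 * ?k n x y) (h n) (h n)"
      unfolding nonlocal_form_def by (simp add: mult.assoc flip: integral_mult_right_zero)
    also have "\<dots> \<le> nonlocal_form M (K n) (h n) (h n)"
      by (rule nonlocal_form_mono_kernel[OF bk bounded_kernel_K hsq])
        (use J0 G0 in \<open>auto simp: coupling_kernel_def indicator_def\<close>)
    finally have "C * nonlocal_form M (?k n) (h n) (h n) \<le> C * (2 * nonlocal_form M (K n) (h n) (h n))"
      using C(1) by (intro mult_left_mono) auto
    moreover have "(\<integral>x. (h n x)\<^sup>2 \<partial>M) \<le> C * nonlocal_form M (?k n) (h n) (h n)"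
      using elim(8) hL2 h0 by blast
    ultimately have "(\<integral>x. (h n x)\<^sup>2 \<partial>M) \<le> 2 * C * nonlocal_form M (K n) (h n) (h n)"
      by linarith
    then have h_le: "(\<integral>x. (h n x)\<^sup>2 \<partial>M) \<le> (2 * C)\<^sup>2 * (\<integral>x. (R n x)\<^sup>2 \<partial>M)"
      using square_norm_le_of_energy[OF hsq elim(7) _ _ en, of "2 * C"] C(1) by simp
    have "(\<integral>x. (uu n x - p n x)\<^sup>2 \<partial>lebesgue_on (A n)) + (\<integral>x. (vv n x - q n x)\<^sup>2 \<partial>lebesgue_on (B n))
        = (\<integral>x. (h n x)\<^sup>2 \<partial>M)"
      unfolding B_def
      by (rule integral_glue) (use A \<Omega> hsq in \<open>auto simp: h_def square_integrable_def\<close>)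
    moreover have "0 \<le> (\<integral>x. (uu n x - p n x)\<^sup>2 \<partial>lebesgue_on (A n))"
      "0 \<le> (\<integral>x. (vv n x - q n x)\<^sup>2 \<partial>lebesgue_on (B n))"
      by (intro Bochner_Integration.integral_nonneg; simp)+
    ultimately have "(\<integral>x. (uu n x - p n x)\<^sup>2 \<partial>lebesgue_on (A n)) \<le> (2 * C)\<^sup>2 * (\<integral>x. (R n x)\<^sup>2 \<partial>M)"
      "(\<integral>x. (vv n x - q n x)\<^sup>2 \<partial>lebesgue_on (B n)) \<le> (2 * C)\<^sup>2 * (\<integral>x. (R n x)\<^sup>2 \<partial>M)"
      using h_le by linarith+
    then have "L2_norm_on (A n) (\<lambda>x. uu n x - p n x) \<le> sqrt ((2 * C)\<^sup>2 * (\<integral>x. (R n x)\<^sup>2 \<partial>M))"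
      "L2_norm_on (B n) (\<lambda>x. vv n x - q n x) \<le> sqrt ((2 * C)\<^sup>2 * (\<integral>x. (R n x)\<^sup>2 \<partial>M))"
      unfolding L2_norm_on_def by (auto intro!: real_sqrt_le_mono)
    then show ?case by linarith
  qed
  have lim0: "(\<lambda>n. 2 * sqrt ((2 * C)\<^sup>2 * (\<integral>x. (R n x)\<^sup>2 \<partial>M))) \<longlonglongrightarrow> 0"
  proof -
    have "(\<lambda>n. 2 * sqrt ((2 * C)\<^sup>2 * (\<integral>x. (R n x)\<^sup>2 \<partial>M))) \<longlonglongrightarrow> 2 * sqrt ((2 * C)\<^sup>2 * 0)"
      by (intro tendsto_intros res(2))
    then show ?thesis by simp
  qed
  show ?thesis
  proof (rule tendsto_sandwich[OF _ bound tendsto_const lim0])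
    show "\<forall>\<^sub>F n in sequentially. 0 \<le> L2_norm_on (A n) (\<lambda>x. uu n x - p n x)
        + L2_norm_on (B n) (\<lambda>x. vv n x - q n x)"
      unfolding L2_norm_on_def
      by (intro always_eventually allI add_nonneg_nonneg real_sqrt_ge_zero
        Bochner_Integration.integral_nonneg) auto
  qed
qed

end

section \<open>Convergence of the corrector\<close>

theorem theorem2p2:
  fixes \<Omega> T :: "(real^'n) set" and l :: "real^'n" and J G :: "real^'n \<Rightarrow> real"
    and X :: real
    and f u v :: "real^'n \<Rightarrow> real"
    and f\<^sub>n u\<^sub>n v\<^sub>n :: "nat \<Rightarrow> real^'n \<Rightarrow> real"
    and A B :: "nat \<Rightarrow> (real^'n) set"
    and w1 w2 :: "nat \<Rightarrow> real^'n \<Rightarrow> real" and m :: "nat \<Rightarrow> real"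
  defines "A \<equiv> holes \<Omega> l T"
    and "B \<equiv> (\<lambda>n. \<Omega> - A n)"
    and "w1 \<equiv> corrector_1 \<Omega> l T X u"
    and "w2 \<equiv> corrector_2 \<Omega> l T X v"
    and "m \<equiv> (\<lambda>n. (\<integral>x. w1 n x \<partial>lebesgue_on (A n)) + (\<integral>x. w2 n x \<partial>lebesgue_on (B n)))"
  assumes "CARD('n) \<ge> 2"
    and "smooth_bounded_domain \<Omega>"
    and "interaction_kernel J" and "interaction_kernel G"
    and "\<exists>R > diameter \<Omega>. ball 0 R \<subseteq> fun_support J"
    and "\<And>i. l $ i > 0"
    and "open T" and "T \<noteq> {}" and "smooth_boundary T" and "closure T \<subseteq> box 0 l"
    and "weak_star_Linfty \<Omega> (\<lambda>n. indicator (A n)) (\<lambda>x. X)"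
    and "0 < X" and "X < 1"
    and "L2_on \<Omega> f"
    and "\<And>n. n \<ge> 1 \<Longrightarrow> A n \<noteq> {} \<Longrightarrow> L2_on \<Omega> (f\<^sub>n n)"
    and "\<And>n. n \<ge> 1 \<Longrightarrow> A n \<noteq> {} \<Longrightarrow> (\<integral>x. f\<^sub>n n x \<partial>lebesgue_on \<Omega>) = 0"
    and "(\<lambda>n. L2_norm_on \<Omega> (\<lambda>x. f\<^sub>n n x - f x)) \<longlonglongrightarrow> 0"
    and "\<And>n. n \<ge> 1 \<Longrightarrow> A n \<noteq> {} \<Longrightarrow> weak_solution J G (A n) (B n) (f\<^sub>n n) (u\<^sub>n n) (v\<^sub>n n)"
    and "L2_on \<Omega> u" and "L2_on \<Omega> v" and "continuous_on (closure \<Omega>) u"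
    and "limit_solution J G \<Omega> X f u v"
  shows "(\<lambda>n. L2_norm_on (A n) (\<lambda>x. u\<^sub>n n x - (w1 n x - 1/2 * (m n / measure lebesgue (A n))))
            + L2_norm_on (B n) (\<lambda>x. v\<^sub>n n x - (w2 n x - 1/2 * (m n / measure lebesgue (B n)))))
         \<longlonglongrightarrow> 0"
proof -
  have top: "open \<Omega>" "connected \<Omega>" "\<Omega> \<noteq> {}" "bounded \<Omega>"
    using \<open>smooth_bounded_domain \<Omega>\<close> by (auto simp: smooth_bounded_domain_def)
  have lm: "\<Omega> \<in> lmeasurable" using top by (simp add: lmeasurable_open)
  have perf: "perforation \<Omega> T l n" if "n \<ge> 1" for n
    by unfold_locales (fact top \<open>open T\<close> \<open>T \<noteq> {}\<close> \<open>smooth_boundary T\<close> \<open>closure T \<subseteq> box 0 l\<close>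
      \<open>\<And>i. l $ i > 0\<close> that)+
  have A_sub: "A n \<subseteq> \<Omega>" for n by (auto simp: A_def holes_def hole_indices_def)
  have A_meas: "A n \<in> sets lebesgue" for n
  proof (cases "n \<ge> 1")
    case True
    then have "compact (A n)" unfolding A_def by (rule perforation.compact_holes[OF perf])
    then show ?thesis by (auto dest!: lmeasurable_compact)
  next
    \<comment> \<open>For \<open>n = 0\<close> the factor \<open>1 / real n\<close> is \<open>0\<close>, so every hole collapses to the origin.\<close>
    case False
    then have "A n \<subseteq> {0}" by (auto simp: A_def holes_def hole_def)
    then have "finite (A n)" by (rule finite_subset) simp
    then show ?thesis by (intro negligible_imp_sets negligible_finite)
  qed
  interpret hom: homogenization \<Omega> J G X f u v A B
    by unfold_locales (use lm A_sub A_meas assms in \<open>auto simp: B_def\<close>)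
  let ?M = "lebesgue_on \<Omega>" and ?\<mu> = "measure lebesgue \<Omega>"
  have B_sub: "B n \<subseteq> \<Omega>" "B n \<in> sets lebesgue" for n
    using A_meas lm by (auto simp: B_def)
  have \<mu>_pos: "?\<mu> > 0"
    using open_not_negligible[OF top(1,3)] negligible_iff_measure0[OF lm]
    by (metis zero_less_measure_iff)
  have B_lim: "(\<lambda>n. measure lebesgue (B n)) \<longlonglongrightarrow> (1 - X) * ?\<mu>"
    unfolding hom.measure_B using tendsto_diff[OF tendsto_const hom.measure_A, of ?\<mu>]
    by (simp add: left_diff_distrib)
  have ev: "\<forall>\<^sub>F n in sequentially. n \<ge> 1 \<and> A n \<noteq> {} \<and> measure lebesgue (A n) > 0 \<and> measure lebesgue (B n) > 0"
  proof -
    have "\<forall>\<^sub>F n in sequentially. measure lebesgue (A n) > 0"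
      using \<mu>_pos \<open>0 < X\<close> by (intro order_tendstoD(1)[OF hom.measure_A]) simp
    moreover have "\<forall>\<^sub>F n in sequentially. measure lebesgue (B n) > 0"
      using \<mu>_pos \<open>X < 1\<close> by (intro order_tendstoD(1)[OF B_lim]) simp
    ultimately show ?thesis
      using eventually_ge_at_top[of "1 :: nat"] by eventually_elim auto
  qed
  have close: "\<forall>\<^sub>F n in sequentially. \<forall>x\<in>A n. \<bar>w1 n x - u x / X\<bar> \<le> \<epsilon>" if \<epsilon>: "\<epsilon> > 0" for \<epsilon>
  proof -
    have "uniformly_continuous_on (closure \<Omega>) u"
      using \<open>continuous_on (closure \<Omega>) u\<close> top(4) by (intro compact_uniformly_continuous) auto
    moreover have "\<epsilon> * X > 0" using \<epsilon> \<open>0 < X\<close> by simp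
    ultimately obtain d where d: "d > 0"
      "\<And>y z. y \<in> closure \<Omega> \<Longrightarrow> z \<in> closure \<Omega> \<Longrightarrow> dist z y < d \<Longrightarrow> dist (u z) (u y) < \<epsilon> * X"
      unfolding uniformly_continuous_on_def by blast
    have "(\<lambda>n. norm l / real n) \<longlonglongrightarrow> 0" by (rule lim_const_over_n)
    then have "\<forall>\<^sub>F n in sequentially. norm l / real n < d"
      using d(1) by (rule order_tendstoD(2))
    then show ?thesis
      using eventually_ge_at_top[of "1 :: nat"]
    proof eventually_elim
      case (elim n)
      interpret perforation \<Omega> T l n using elim(2) by (rule perf)
      have osc: "\<bar>u y - u z\<bar> \<le> \<epsilon> * X" if "y \<in> \<Omega>" "z \<in> \<Omega>" "dist y z \<le> norm l / n" for y z
      proof -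
        have "y \<in> closure \<Omega>" "z \<in> closure \<Omega>" using that closure_subset by auto
        then have "dist (u y) (u z) < \<epsilon> * X" using d(2)[of z y] that(3) elim(1) by simp
        then show ?thesis by (simp add: dist_real_def)
      qed
      show ?case
      proof
        fix x assume x: "x \<in> A n"
        have "\<bar>w1 n x - u x / X\<bar> \<le> \<epsilon> * X / X"
          unfolding w1_def using x unfolding A_def
          by (intro corrector_1_close osc) (use \<open>continuous_on (closure \<Omega>) u\<close> \<open>0 < X\<close> in auto)
        then show "\<bar>w1 n x - u x / X\<bar> \<le> \<epsilon>" using \<open>0 < X\<close> by simp
      qed
    qed
  qed
  obtain \<eta> where \<eta>: "\<eta> \<longlonglongrightarrow> 0" "\<And>n. \<eta> n \<ge> 0"
    "\<forall>\<^sub>F n in sequentially. \<forall>x\<in>A n. \<bar>w1 n x - u x / X\<bar> \<le> \<eta> n"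
    by (rule uniform_majorant[OF close]) (assumption, rule that)
  \<comment> \<open>The corrector as one function on \<open>\<Omega>\<close>, before its mean \<open>m n\<close> is removed.\<close>
  define w' where "w' n x = (if x \<in> A n then w1 n x else w2 n x)" for n x
  have w2_B: "w2 n x = hom.V x" if "x \<in> B n" for n x
    using that by (simp add: w2_def corrector_2_def hom.V_def B_def A_def)
  have w'_close: "\<forall>\<^sub>F n in sequentially. \<forall>x\<in>\<Omega>. \<bar>w' n x - hom.w0 n x\<bar> \<le> \<eta> n"
    using \<eta>(3)
  proof eventually_elim
    case (elim n)
    then show ?case
      using \<eta>(2)[of n] w2_B[of _ n] by (auto simp: w'_def hom.w0_def hom.U_def B_def)
  qed
  have w'_L2: "L2_on \<Omega> (w' n)" if n: "n \<ge> 1" for n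
    unfolding w'_def
  proof (rule L2_on_glue[OF A_sub A_meas])
    interpret perforation \<Omega> T l n using n by (rule perf)
    show "L2_on (A n) (w1 n)"
    proof (rule L2_on_piecewise_constant)
      show "finite (hole_indices \<Omega> l T n)" by (rule finite_hole_indices)
      show "compact (hole l T n k)" for k by (rule compact_hole)
      show "hole l T n k \<inter> hole l T n j = {}" if "k \<noteq> j" for k j
        using that hole_index_unique by blast
      show "w1 n x = 1 / measure lebesgue (hole l T n k) * (\<integral>z. u z / X \<partial>lebesgue_on (hole l T n k))"
        if "k \<in> hole_indices \<Omega> l T n" "x \<in> hole l T n k" for k x
        unfolding w1_def using that by (rule corrector_1_on_hole)
      show "A n \<in> lmeasurable" unfolding A_def using compact_holes by (rule lmeasurable_compact)
      show "A n \<subseteq> (\<Union>k\<in>hole_indices \<Omega> l T n. hole l T n k)" by (simp add: A_def holes_def)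
    qed
    have "L2_on \<Omega> hom.V" using hom.sq(5) by (simp add: L2_on_iff_square_integrable)
    then have "L2_on (B n) hom.V"
      by (rule L2_on_subset[OF _ B_sub fmeasurableD[OF lm]])
    then have "L2_on (B n) (w2 n)" by (rule iffD2[OF L2_on_cong, rotated]) (rule w2_B)
    then show "L2_on (\<Omega> - A n) (w2 n)" by (simp add: B_def)
  qed (use lm in auto)
  have w'_int: "integrable ?M (w' n)" if "n \<ge> 1" for n
    using w'_L2[OF that] hom.square_integrable_imp_integrable by (simp add: L2_on_iff_square_integrable)
  have m_eq: "m n = (\<integral>x. w' n x \<partial>?M)" if "n \<ge> 1" for n
    unfolding m_def B_def using lm
    by (intro integral_glue A_sub A_meas w'_int that) (auto simp: w'_def)
  have m_lim: "m \<longlonglongrightarrow> 0"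
  proof -
    have bd: "\<forall>\<^sub>F n in sequentially. norm (m n - (\<integral>x. hom.w0 n x \<partial>?M)) \<le> \<eta> n * ?\<mu>"
      using w'_close eventually_ge_at_top[of "1 :: nat"]
    proof eventually_elim
      case (elim n)
      have i0: "integrable ?M (hom.w0 n)" by (rule hom.square_integrable_imp_integrable[OF hom.sq_w0])
      have "m n - (\<integral>x. hom.w0 n x \<partial>?M) = (\<integral>x. w' n x - hom.w0 n x \<partial>?M)"
        unfolding m_eq[OF elim(2)] using w'_int[OF elim(2)] i0 by simp
      moreover have "\<bar>\<integral>x. w' n x - hom.w0 n x \<partial>?M\<bar> \<le> (\<integral>x. \<eta> n \<partial>?M)"
      proof (rule order_trans[OF integral_abs_bound], rule integral_mono)
        show "integrable ?M (\<lambda>x. \<bar>w' n x - hom.w0 n x\<bar>)"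
          using w'_int[OF elim(2)] i0 by simp
        show "integrable ?M (\<lambda>x. \<eta> n)" by (rule hom.integrable_const)
        show "\<bar>w' n x - hom.w0 n x\<bar> \<le> \<eta> n" if "x \<in> space ?M" for x
          using elim(1) that by simp
      qed
      moreover have "measure ?M \<Omega> = ?\<mu>" using lm by (simp add: measure_restrict_space)
      ultimately show ?case by (simp add: mult.commute)
    qed
    have "(\<lambda>n. \<eta> n * ?\<mu>) \<longlonglongrightarrow> 0" using \<eta>(1) by (rule tendsto_mult_left_zero)
    then have "(\<lambda>n. m n - (\<integral>x. hom.w0 n x \<partial>?M)) \<longlonglongrightarrow> 0" using bd by (rule Lim_null_comparison[rotated])
    from tendsto_add[OF this hom.integral_w0] show ?thesis by simp
  qed
  \<comment> \<open>Half of the mean is removed on \<open>A n\<close> and half on \<open>B n\<close>. Both constants tend to 0 because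
    \<open>m n\<close> does and the two measures have positive limits.\<close>
  define a where "a n = 1/2 * (m n / measure lebesgue (A n))" for n
  define b where "b n = 1/2 * (m n / measure lebesgue (B n))" for n
  have "a \<longlonglongrightarrow> 1/2 * (0 / (X * ?\<mu>))"
    unfolding a_def using \<mu>_pos \<open>0 < X\<close> by (intro tendsto_intros m_lim hom.measure_A) simp
  then have a_lim: "a \<longlonglongrightarrow> 0" by simp
  have "b \<longlonglongrightarrow> 1/2 * (0 / ((1 - X) * ?\<mu>))"
    unfolding b_def using \<mu>_pos \<open>X < 1\<close> by (intro tendsto_intros m_lim B_lim) simp
  then have b_lim: "b \<longlonglongrightarrow> 0" by simp
  let ?w = "\<lambda>n x. if x \<in> A n then w1 n x - a n else w2 n x - b n"
  have c_L2: "L2_on \<Omega> (\<lambda>x. if x \<in> A n then a n else b n)" for n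
    unfolding L2_on_iff_square_integrable
    by (rule hom.square_integrable_bounded[where K = "max \<bar>a n\<bar> \<bar>b n\<bar>"])
      (use hom.AM in \<open>auto intro!: measurable_If_set\<close>)
  have w_eq: "?w n = (\<lambda>x. w' n x - (if x \<in> A n then a n else b n))" for n
    by (auto simp: w'_def)
  have w_L2: "L2_on \<Omega> (?w n)" if "n \<ge> 1" for n
    unfolding w_eq using w'_L2[OF that] c_L2
    unfolding L2_on_iff_square_integrable by (rule square_integrable_diff)
  have w_mean: "(\<integral>x. ?w n x \<partial>?M) = 0"
    if n: "n \<ge> 1" and pos: "measure lebesgue (A n) > 0" "measure lebesgue (B n) > 0" for n
  proof -
    have ic: "integrable ?M (\<lambda>x. if x \<in> A n then a n else b n)"
      using c_L2 hom.square_integrable_imp_integrable by (simp add: L2_on_iff_square_integrable)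
    have "(\<integral>x. a n \<partial>lebesgue_on (A n)) + (\<integral>x. b n \<partial>lebesgue_on (\<Omega> - A n))
        = (\<integral>x. (if x \<in> A n then a n else b n) \<partial>?M)"
      by (rule integral_glue[OF A_sub A_meas _ ic]) (use lm in auto)
    moreover have "measure (lebesgue_on (A n)) (A n) = measure lebesgue (A n)"
      "measure (lebesgue_on (\<Omega> - A n)) (\<Omega> - A n) = measure lebesgue (B n)"
      using A_meas[of n] B_sub[of n] by (auto simp: measure_restrict_space B_def)
    ultimately have "(\<integral>x. (if x \<in> A n then a n else b n) \<partial>?M) = m n"
      using pos by (simp add: a_def b_def)
    then show ?thesis
      unfolding w_eq using m_eq[OF n] w'_int[OF n] ic by simp
  qed
  define \<delta> where "\<delta> n = \<eta> n + (\<bar>a n\<bar> + \<bar>b n\<bar>)" for n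
  have "\<delta> \<longlonglongrightarrow> 0 + (\<bar>0\<bar> + \<bar>0\<bar>)"
    unfolding \<delta>_def by (intro tendsto_intros \<eta>(1) a_lim b_lim)
  then have \<delta>_lim: "\<delta> \<longlonglongrightarrow> 0" by simp
  have "(\<lambda>n. L2_norm_on (A n) (\<lambda>x. u\<^sub>n n x - (w1 n x - a n))
      + L2_norm_on (B n) (\<lambda>x. v\<^sub>n n x - (w2 n x - b n))) \<longlonglongrightarrow> 0"
  proof (rule hom.error_tendsto_0[OF top])
    show "\<forall>\<^sub>F n in sequentially. L2_on \<Omega> (f\<^sub>n n)"
      using ev by eventually_elim (use assms in blast)
    show "(\<lambda>n. L2_norm_on \<Omega> (\<lambda>x. f\<^sub>n n x - f x)) \<longlonglongrightarrow> 0" by fact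
    show "\<forall>\<^sub>F n in sequentially. L2_on \<Omega> (?w n)"
      using ev by eventually_elim (use w_L2 in blast)
    show "\<forall>\<^sub>F n in sequentially. (\<integral>x. ?w n x \<partial>?M) = 0"
      using ev by eventually_elim (use w_mean in blast)
    show "\<forall>\<^sub>F n in sequentially. \<forall>x\<in>\<Omega>. \<bar>?w n x - hom.w0 n x\<bar> \<le> \<delta> n"
      using w'_close
    proof eventually_elim
      case (elim n)
      show ?case
      proof
        fix x assume "x \<in> \<Omega>"
        then have "\<bar>w' n x - hom.w0 n x\<bar> \<le> \<eta> n" using elim by blast
        then show "\<bar>?w n x - hom.w0 n x\<bar> \<le> \<delta> n"
          by (cases "x \<in> A n") (simp_all add: w'_def \<delta>_def)
      qed
    qed
    show "\<delta> \<longlonglongrightarrow> 0" by (rule \<delta>_lim)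
    show "\<forall>\<^sub>F n in sequentially. negligible (A n - interior (A n))"
      using ev
    proof eventually_elim
      case (elim n)
      then show ?case unfolding A_def by (intro perforation.negligible_holes_boundary perf) simp
    qed
    show "\<forall>\<^sub>F n in sequentially. weak_solution J G (A n) (B n) (f\<^sub>n n) (u\<^sub>n n) (v\<^sub>n n)"
      using ev by eventually_elim (use assms in blast)
    show "\<forall>\<^sub>F n in sequentially. \<forall>Du. H1_gradient (interior (A n)) (u\<^sub>n n) Du
      \<longrightarrow> H1_gradient (interior (A n)) (\<lambda>x. u\<^sub>n n x - (w1 n x - a n)) Du"
      using ev
    proof eventually_elim
      case (elim n)
      interpret perforation \<Omega> T l n by (rule perf) (use elim in simp)
      show ?case
        unfolding A_def holes_def
      proof (intro allI impI, rule H1_gradient_diff_piecewise_constant)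
        show "w1 n x - a n = 1 / measure lebesgue (hole l T n k)
            * (\<integral>z. u z / X \<partial>lebesgue_on (hole l T n k)) - a n"
          if "k \<in> hole_indices \<Omega> l T n" "x \<in> hole l T n k" for k x
          unfolding w1_def corrector_1_on_hole[OF that] ..
        show "hole l T n k \<inter> hole l T n j = {}" if "k \<noteq> j" for k j
          using that hole_index_unique by blast
      qed (use finite_hole_indices compact_hole in auto)
    qed
  qed
  then show ?thesis unfolding a_def b_def .
qed

end
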